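(* The $P_2$-packing problem can be solved in time $\mathcal{O}^*(2.482^{3k})$.
   Context: $P_2$-packing: given an undirected graph $G$ and an integer $k$, decide whether $G$ contains $k$ pairwise vertex-disjoint paths with three vertices and two edges. The notation $\mathcal{O}^*(f(k))$ means $\mathcal{O}(f(k)\cdot \mathrm{poly}(|G|,k))$, i.e. polynomial factors are suppressed. *)

theory Defs
  imports Complex_Main "HOL-Library.Log_Nat"
begin

section \<open>Packings of paths on three vertices\<close>

text \<open>Graphs that serve as inputs of algorithms have the numbers below \<open>nverts G\<close> as vertices.\<close>

record ugraph =
  nverts :: nat
  edges :: "nat set set"

definition simple_graph :: "ugraph \<Rightarrow> bool" where
  "simple_graph G \<longleftrightarrow> edges G \<subseteq> {{u, v} | u v. u < nverts G \<and> v < nverts G \<and> u \<noteq> v}"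

definition graph_size :: "ugraph \<Rightarrow> nat" where
  "graph_size G = nverts G + card (edges G)"

text \<open>The triple \<open>(u, v, w)\<close> stands for the path with edges \<open>{u, v}\<close> and \<open>{v, w}\<close>.  A path
  corresponds to two triples, which are not vertex-disjoint and so never occur in the same packing.\<close>

fun path_verts :: "nat \<times> nat \<times> nat \<Rightarrow> nat set" where
  "path_verts (u, v, w) = {u, v, w}"

fun is_P2 :: "ugraph \<Rightarrow> nat \<times> nat \<times> nat \<Rightarrow> bool" where
  "is_P2 G (u, v, w) \<longleftrightarrow> distinct [u, v, w] \<and> {u, v} \<in> edges G \<and> {v, w} \<in> edges G"

definition has_P2_packing :: "ugraph \<Rightarrow> nat \<Rightarrow> bool" where
  "has_P2_packing G k \<longleftrightarrow>
     (\<exists>Q. finite Q \<and> card Q = k \<and> (\<forall>p\<in>Q. is_P2 G p) \<and>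
          pairwise (\<lambda>p q. disjnt (path_verts p) (path_verts q)) Q)"


section \<open>Random access machines with logarithmic cost\<close>

text \<open>A random access machine in the style of Cook and Reckhow, with structured control flow
  instead of jumps.  Memory cells hold natural numbers of unbounded size; the only arithmetic
  operations are addition and truncated subtraction.  Every access to a number, be it an address,
  an operand or a stored result, is charged with its binary length, so that arithmetic on very long
  numbers is not free.  With unit cost the model would allow bit-parallel computations that
  distort the base of an exponential running time.\<close>

type_synonym mem = "nat \<Rightarrow> nat"

datatype aexp =
    Num nat
  | Cell aexp
  | Add aexp aexp
  | Sub aexp aexp

datatype com =
    Skip
  | Store aexp aexp
  | Seq com com
  | Cond aexp com com
  | While aexp com

fun aval :: "aexp \<Rightarrow> mem \<Rightarrow> nat" where
  "aval (Num n) s = n"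
| "aval (Cell a) s = s (aval a s)"
| "aval (Add a b) s = aval a s + aval b s"
| "aval (Sub a b) s = aval a s - aval b s"

definition len :: "nat \<Rightarrow> nat" where
  "len n = max 1 (floorlog 2 n)"

fun acost :: "aexp \<Rightarrow> mem \<Rightarrow> nat" where
  "acost (Num n) s = len n"
| "acost (Cell a) s = acost a s + len (aval a s) + len (s (aval a s))"
| "acost (Add a b) s = acost a s + acost b s + len (aval a s) + len (aval b s)"
| "acost (Sub a b) s = acost a s + acost b s + len (aval a s) + len (aval b s)"

text \<open>\<open>exec c s t s'\<close>: started in memory \<open>s\<close>, the program \<open>c\<close> halts with memory \<open>s'\<close> at cost
  \<open>t\<close>.  In \<open>Store a b\<close> the expression \<open>a\<close> is the address; guards hold when they are nonzero.\<close>

inductive exec :: "com \<Rightarrow> mem \<Rightarrow> nat \<Rightarrow> mem \<Rightarrow> bool" where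
  Skip: "exec Skip s 1 s"
| Store: "exec (Store a b) s
    (acost a s + acost b s + len (aval a s) + len (aval b s)) (s(aval a s := aval b s))"
| Seq: "exec c1 s t1 s1 \<Longrightarrow> exec c2 s1 t2 s2 \<Longrightarrow> exec (Seq c1 c2) s (t1 + t2) s2"
| CondTrue: "aval b s \<noteq> 0 \<Longrightarrow> exec c1 s t s1 \<Longrightarrow>
    exec (Cond b c1 c2) s (acost b s + len (aval b s) + t) s1"
| CondFalse: "aval b s = 0 \<Longrightarrow> exec c2 s t s1 \<Longrightarrow>
    exec (Cond b c1 c2) s (acost b s + len (aval b s) + t) s1"
| WhileFalse: "aval b s = 0 \<Longrightarrow> exec (While b c) s (acost b s + len (aval b s)) s"
| WhileTrue: "aval b s \<noteq> 0 \<Longrightarrow> exec c s t1 s1 \<Longrightarrow> exec (While b c) s1 t2 s2 \<Longrightarrow>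
    exec (While b c) s (acost b s + len (aval b s) + t1 + t2) s2"

inductive_cases SkipE: "exec Skip s t s'"
inductive_cases StoreE: "exec (Store a b) s t s'"
inductive_cases SeqE: "exec (Seq c1 c2) s t s'"
inductive_cases CondE: "exec (Cond b c1 c2) s t s'"
inductive_cases WhileE: "exec (While b c) s t s'"

lemma exec_deterministic:
  "exec c s t s' \<Longrightarrow> exec c s u s'' \<Longrightarrow> u = t \<and> s'' = s'"
proof (induction arbitrary: u s'' rule: exec.induct)
  case (Skip s)
  then show ?case by (rule SkipE) simp
next
  case (Store a b s)
  then show ?case by (rule StoreE) simp
next
  case (Seq c1 s t1 s1 c2 t2 s2)
  from Seq.prems show ?case by (rule SeqE) (metis Seq.IH)
next
  case (CondTrue b s c1 t s1 c2)
  from CondTrue.prems show ?case by (rule CondE) (use CondTrue.hyps(1) in \<open>auto dest: CondTrue.IH\<close>)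
next
  case (CondFalse b s c2 t s1 c1)
  from CondFalse.prems show ?case by (rule CondE) (use CondFalse.hyps(1) in \<open>auto dest: CondFalse.IH\<close>)
next
  case (WhileFalse b s c)
  from WhileFalse.prems show ?case by (rule WhileE) (use WhileFalse.hyps in auto)
next
  case (WhileTrue b s c t1 s1 t2 s2)
  from WhileTrue.prems show ?case by (rule WhileE) (use WhileTrue.hyps(1) in \<open>auto dest: WhileTrue.IH\<close>)
qed


section \<open>Parameterized graph problems and their running time\<close>

text \<open>The initial memory contains the parameter, the number of vertices and, row by row, the
  adjacency matrix.\<close>

definition input_mem :: "ugraph \<Rightarrow> nat \<Rightarrow> mem" where
  "input_mem G k i =
    (if i = 0 then k
     else if i = 1 then nverts G
     else if i < 2 + nverts G * nverts G \<and>
             {(i - 2) div nverts G, (i - 2) mod nverts G} \<in> edges G then 1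
     else 0)"

text \<open>\<open>solvable_in_Ostar \<Pi> f\<close>: the problem \<open>\<Pi>\<close> is decided in time \<open>O\<^sup>*(f(k))\<close> by one program for all
  instances, the answer (1 for yes, 0 for no) being left in cell 0.  The summand 1 makes the
  polynomial factor positive on the empty instance.\<close>

definition solvable_in_Ostar :: "(ugraph \<Rightarrow> nat \<Rightarrow> bool) \<Rightarrow> (nat \<Rightarrow> real) \<Rightarrow> bool" where
  "solvable_in_Ostar \<Pi> f \<longleftrightarrow>
    (\<exists>c (C :: real) (d :: nat). \<forall>G k. simple_graph G \<longrightarrow>
      (\<exists>t s. exec c (input_mem G k) t s \<and>
             s 0 = (if \<Pi> G k then 1 else 0) \<and>
             real t \<le> C * f k * real (graph_size G + k + 1) ^ d))"

end

theory Submission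
  imports Defs "HOL-Library.FuncSet" "HOL-Library.Sublist"
begin

text \<open>Let \<open>P\<close> be a maximal packing of \<open>j < k\<close> paths, found greedily, and \<open>S\<close> its vertex set.  A packing \<open>Q\<close>
  of size \<open>k\<close> that shares as many paths as possible with \<open>P\<close> meets every path of \<open>P\<close> in at least two
  vertices and hence has at most \<open>3 k - 2 j\<close> vertices outside \<open>S\<close>.  The graph outside \<open>S\<close> has components
  with at most two vertices, so its vertices can be processed in a linear order in which both vertices of
  a component are neighbours; it suffices to remember which vertices of \<open>S\<close> are used and which ones are
  centres of paths that still lack their second endpoint outside \<open>S\<close>.  Let a used vertex weigh 1 and
  such a centre 4.  A path of \<open>Q\<close> never weighs more than twice the number of its vertices outside \<open>S\<close>,
  so that only states of weight at most \<open>6 k - 4 j\<close> matter.  There are at most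
  \<open>(1 + y + y\<^sup>4)\<^bsup>3j\<^esup> / y\<^bsup>6k - 4j\<^esup>\<close> of them for every \<open>0 < y < 1\<close>; the choice \<open>y = 2 / 3\<close> bounds their
  number by \<open>14.6\<^sup>k\<close>, whereas \<open>2.482\<^sup>3 > 15.2\<close>.  Paths inside \<open>S\<close> are added at the end, when there
  are no unfinished paths and hence at most \<open>2\<^bsup>3j\<^esup>\<close> states.  The states are explored by a worklist algorithm
  with a table of visited states, which is indexed by numbers encoding the states.\<close>

section \<open>Packings and the search space\<close>

text \<open>The price 4 is the largest one that the budget permits: a path has budget 2 for each
  vertex outside \<open>S\<close>, and an unfinished path has two such vertices. A finished path
  with a single vertex outside \<open>S\<close> uses two vertices of \<open>S\<close> and exhausts
  its budget as well. A high price matters because it makes states with many unfinished centres too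
  heavy to be kept. The number y has to control two rates at once: (1 + y + y^4)^3 / y^2 for each
  path of \<open>P\<close>, and y^-6 for each path by which \<open>P\<close> falls short of k; the
  second one rules out small values of y.

  The machine charges the length of every number and cannot multiply. This costs only polynomial
  factors: a state is encoded by n + 2 digits in base n + 5, so all addresses and codes have
  polynomial length. Its exponential extent does not enter the running time, since an access to a
  far cell costs no more than the length of its address; only the number of visited states
  counts.\<close>

definition packing :: "ugraph \<Rightarrow> (nat \<times> nat \<times> nat) set \<Rightarrow> bool" where
  "packing G Q \<longleftrightarrow> finite Q \<and> (\<forall>p\<in>Q. is_P2 G p) \<and>
     pairwise (\<lambda>p q. disjnt (path_verts p) (path_verts q)) Q"

definition verts :: "(nat \<times> nat \<times> nat) set \<Rightarrow> nat set" where
  "verts Q = (\<Union>q\<in>Q. path_verts q)"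

lemma has_P2_packing_iff: "has_P2_packing G k \<longleftrightarrow> (\<exists>Q. packing G Q \<and> card Q = k)"
  by (auto simp: has_P2_packing_def packing_def)

lemma finite_path_verts [simp]: "finite (path_verts p)"
  by (cases p) auto

lemma card_path_verts: "is_P2 G p \<Longrightarrow> card (path_verts p) = 3"
  by (cases p) auto

lemma packing_finite: "packing G Q \<Longrightarrow> finite Q"
  and packing_is_P2: "packing G Q \<Longrightarrow> p \<in> Q \<Longrightarrow> is_P2 G p"
  by (auto simp: packing_def)

lemma packing_unique:
  "packing G Q \<Longrightarrow> p \<in> Q \<Longrightarrow> q \<in> Q \<Longrightarrow> x \<in> path_verts p \<Longrightarrow> x \<in> path_verts q \<Longrightarrow> p = q"
  unfolding packing_def pairwise_def disjnt_def by blast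

lemma finite_verts: "packing G Q \<Longrightarrow> finite (verts Q)"
  by (auto simp: verts_def packing_def)

lemma card_verts: "packing G Q \<Longrightarrow> card (verts Q) = 3 * card Q"
proof -
  assume Q: "packing G Q"
  have "card (verts Q) = (\<Sum>q\<in>Q. card (path_verts q))"
    unfolding verts_def using Q
    by (intro card_UN_disjoint) (auto simp: packing_def pairwise_def disjnt_def)
  also have "\<dots> = (\<Sum>q\<in>Q. 3)"
    using Q by (intro sum.cong) (auto simp: packing_def card_path_verts)
  finally show ?thesis by simp
qed

lemma packing_subset: "packing G Q \<Longrightarrow> Q' \<subseteq> Q \<Longrightarrow> packing G Q'"
  unfolding packing_def by (blast intro: finite_subset pairwise_subset)

lemma has_P2_packing_mono:
  assumes "has_P2_packing G m" "l \<le> m"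
  shows "has_P2_packing G l"
proof -
  obtain Q where Q: "packing G Q" "card Q = m" using assms by (auto simp: has_P2_packing_iff)
  obtain Q' where "Q' \<subseteq> Q" "card Q' = l" using obtain_subset_with_card_n[of l Q] assms Q by auto
  then show ?thesis using packing_subset[OF Q(1)] by (auto simp: has_P2_packing_iff)
qed

lemma packing_insert:
  assumes "packing G Q" "is_P2 G p" "path_verts p \<inter> verts Q = {}"
  shows "packing G (insert p Q)" "p \<notin> Q"
proof -
  show "p \<notin> Q" using assms by (cases p) (auto simp: verts_def)
  show "packing G (insert p Q)"
    using assms unfolding packing_def pairwise_insert disjnt_def verts_def by blast
qed

lemma edge_less: "simple_graph G \<Longrightarrow> {u, v} \<in> edges G \<Longrightarrow> u < nverts G \<and> v < nverts G \<and> u \<noteq> v"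
  by (fastforce simp: simple_graph_def doubleton_eq_iff)

lemma is_P2_less: "simple_graph G \<Longrightarrow> is_P2 G p \<Longrightarrow> x \<in> path_verts p \<Longrightarrow> x < nverts G"
  by (cases p) (auto dest: edge_less)

lemma verts_less: "simple_graph G \<Longrightarrow> packing G Q \<Longrightarrow> x \<in> verts Q \<Longrightarrow> x < nverts G"
  by (auto simp: verts_def intro: is_P2_less packing_is_P2)

lemma card_packing_le: "simple_graph G \<Longrightarrow> packing G Q \<Longrightarrow> 3 * card Q \<le> nverts G"
proof -
  assume *: "simple_graph G" "packing G Q"
  then have "verts Q \<subseteq> {..<nverts G}" by (auto intro: verts_less)
  then have "card (verts Q) \<le> nverts G" by (metis card_lessThan card_mono finite_lessThan)
  with * show ?thesis by (simp add: card_verts)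
qed

text \<open>Choose the packing that shares as many paths as possible with \<open>P\<close>: a path of \<open>P\<close> which it meets
  in at most one vertex could be exchanged for one of its paths outside \<open>P\<close>.\<close>

lemma packing_overlap:
  assumes P: "packing G P" and Q: "packing G Q" and less: "card P < card Q"
  obtains Q' where "packing G Q'" "card Q' = card Q"
    "\<And>p. p \<in> P \<Longrightarrow> 2 \<le> card (path_verts p \<inter> verts Q')"
proof -
  let ?C = "\<lambda>Q'. packing G Q' \<and> card Q' = card Q"
  have fP: "finite P" using P by (rule packing_finite)
  \<comment> \<open>The intersections with \<open>P\<close> have at most \<open>card P\<close>
    elements, so a largest one exists.\<close>
  have "\<exists>Q'. ?C Q' \<and> (\<forall>Q''. ?C Q'' \<longrightarrow> card (P \<inter> Q'') \<le> card (P \<inter> Q'))"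
    by (rule ex_has_greatest_nat[where b = "card P + 1" and k = Q])
      (use Q fP in \<open>auto simp: less_Suc_eq_le intro!: card_mono\<close>)
  then obtain Q' where Q': "packing G Q'" "card Q' = card Q"
    and max: "\<And>Q''. packing G Q'' \<Longrightarrow> card Q'' = card Q \<Longrightarrow> card (P \<inter> Q'') \<le> card (P \<inter> Q')"
    by blast
  have fQ': "finite Q'" using Q'(1) by (rule packing_finite)
  have "2 \<le> card (path_verts p \<inter> verts Q')" if p: "p \<in> P" for p
  proof (rule ccontr)
    assume "\<not> ?thesis"
    then have le1: "card (path_verts p \<inter> verts Q') \<le> 1" by simp
    have pP2: "is_P2 G p" using P p by (rule packing_is_P2)
    have pnot: "p \<notin> Q'"
    proof
      assume "p \<in> Q'"
      then have "path_verts p \<inter> verts Q' = path_verts p" by (auto simp: verts_def)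
      with le1 card_path_verts[OF pP2] show False by simp
    qed
    \<comment> \<open>The path to be given up. If \<open>p\<close> meets no path of
      \<open>Q'\<close>, any path outside \<open>P\<close> will do, and one exists because
      \<open>Q'\<close> is larger than \<open>P\<close>. Otherwise it is the only path that
      \<open>p\<close> meets; it is not in \<open>P\<close> because distinct paths of
      \<open>P\<close> are disjoint.\<close>
    obtain q where q: "q \<in> Q'" "q \<notin> P" "path_verts p \<inter> verts Q' \<subseteq> path_verts q"
    proof (cases "path_verts p \<inter> verts Q' = {}")
      case True
      have "\<not> Q' \<subseteq> P" using less Q'(2) card_mono[OF fP, of Q'] by linarith
      then show ?thesis using True that by blast
    next
      case False
      then obtain x where x: "path_verts p \<inter> verts Q' = {x}"
        using le1 by (metis card_1_singletonE card_0_eq finite_Int finite_path_verts le_antisym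
            less_one not_le)
      then obtain q where q: "q \<in> Q'" "x \<in> path_verts q" unfolding verts_def by blast
      have "q \<notin> P" using packing_unique[OF P p, of q x] x q pnot by auto
      then show ?thesis using that q x by auto
    qed
    have "path_verts p \<inter> verts (Q' - {q}) = {}"
    proof (rule equals0I)
      fix x assume "x \<in> path_verts p \<inter> verts (Q' - {q})"
      then obtain q' where "q' \<in> Q'" "q' \<noteq> q" "x \<in> path_verts q'" "x \<in> path_verts p"
        by (auto simp: verts_def)
      moreover from this have "x \<in> path_verts q" using q(3) by (auto simp: verts_def)
      ultimately show False using packing_unique[OF Q'(1)] q(1) by blast
    qed
    then have new: "packing G (insert p (Q' - {q}))" "p \<notin> Q' - {q}"
      using packing_insert[OF packing_subset[OF Q'(1)] pP2, of "Q' - {q}"] by auto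
    have "card (insert p (Q' - {q})) = card Q'"
      using fQ' q(1) new(2) card_Suc_Diff1[of Q' q] by simp
    then have "card (P \<inter> insert p (Q' - {q})) \<le> card (P \<inter> Q')"
      using max new Q'(2) by simp
    \<comment> \<open>Giving up \<open>q\<close> costs nothing here because \<open>q\<close> is not
      in \<open>P\<close>, so the exchange increases the intersection, against its
      maximality.\<close>
    moreover have "P \<inter> insert p (Q' - {q}) = insert p (P \<inter> Q')" using p q by auto
    ultimately show False using pnot fP by simp
  qed
  then show ?thesis using that Q' by blast
qed

text \<open>\<open>S\<close> is the vertex set of a maximal packing \<open>P\<close>.  The vertices outside \<open>S\<close> are numbered from 1,
  \<open>pos\<close> being 0 on \<open>S\<close>.  A search state is a function \<open>f\<close>: for vertices \<open>v \<in> S\<close> the value \<open>f v\<close> is 0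
  (free), 1 (used) or 4 (centre of a path of which only one endpoint, outside \<open>S\<close>, is chosen);
  \<open>f (nverts G)\<close> is the largest position used so far, and \<open>f (nverts G + 1)\<close> counts the completed
  paths.  The value 4 is the price of a half-finished path in the pruning condition.  Adjacent vertices
  outside \<open>S\<close> have consecutive positions, so that no other path uses a position between them.\<close>

locale path_search =
  fixes G :: ugraph and P :: "(nat \<times> nat \<times> nat) set" and pos :: "nat \<Rightarrow> nat" and k :: nat
  assumes simple: "simple_graph G"
    and packP: "packing G P"
    and maximal: "\<And>p. is_P2 G p \<Longrightarrow> path_verts p \<inter> verts P \<noteq> {}"
    and small: "card P < k"
    and pos0: "\<And>v. v < nverts G \<Longrightarrow> pos v = 0 \<longleftrightarrow> v \<in> verts P"
    and pos_inj: "inj_on pos ({..<nverts G} - verts P)"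
    and pos_le: "\<And>v. v < nverts G \<Longrightarrow> pos v \<le> nverts G"
    and pos_adj: "\<And>u v. {u, v} \<in> edges G \<Longrightarrow> u \<notin> verts P \<Longrightarrow> v \<notin> verts P \<Longrightarrow>
      pos u = Suc (pos v) \<or> pos v = Suc (pos u)"
begin

abbreviation "n \<equiv> nverts G"
abbreviation "S \<equiv> verts P"

lemma S_less: "x \<in> S \<Longrightarrow> x < n"
  using verts_less[OF simple packP] .

lemma pos_S [simp]: "x \<in> S \<Longrightarrow> pos x = 0"
  using pos0 S_less by blast

section \<open>Search states and moves\<close>

text \<open>Outside \<open>S\<close>, every position up to \<open>f n\<close> counts as spent, used
  or not. This is why a state needs one number for the outside vertices and not a set.\<close>

definition avail :: "(nat \<Rightarrow> nat) \<Rightarrow> nat \<Rightarrow> bool" where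
  "avail f v \<longleftrightarrow> (if pos v = 0 then f v = 0 else f n < pos v)"

text \<open>The maximum makes the order irrelevant in which two outside vertices of one path are
  taken; their availability is tested beforehand in the old state.\<close>

definition take_vertex :: "nat \<Rightarrow> (nat \<Rightarrow> nat) \<Rightarrow> (nat \<Rightarrow> nat)" where
  "take_vertex v f = (if pos v = 0 then f(v := 1) else f(n := max (f n) (pos v)))"

definition take_path :: "nat \<Rightarrow> nat \<Rightarrow> nat \<Rightarrow> (nat \<Rightarrow> nat) \<Rightarrow> (nat \<Rightarrow> nat)" where
  "take_path x y z f = (take_vertex z (take_vertex y (take_vertex x f)))(n + 1 := f (n + 1) + 1)"

text \<open>The endpoint chosen by \<open>First\<close> is not recorded. It cannot be chosen again,
  since later outside vertices have larger positions, and \<open>Second\<close> needs no more than a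
  new neighbour of the centre. The condition \<open>f n < pos z\<close> also forces \<open>z\<close>
  to lie outside \<open>S\<close>, as positions there are positive.\<close>

inductive move :: "(nat \<Rightarrow> nat) \<Rightarrow> (nat \<Rightarrow> nat) \<Rightarrow> bool" where
  Whole: "\<lbrakk>{x, y} \<in> edges G; {y, z} \<in> edges G; x \<noteq> z; avail f x; avail f y; avail f z\<rbrakk>
    \<Longrightarrow> move f (take_path x y z f)"
| First: "\<lbrakk>{x, z} \<in> edges G; pos x = 0; f x = 0; f n < pos z\<rbrakk> \<Longrightarrow> move f (f(x := 4, n := pos z))"
| Second: "\<lbrakk>{x, z} \<in> edges G; f x = 4; f n < pos z\<rbrakk>
    \<Longrightarrow> move f (f(x := 1, n := pos z, n + 1 := f (n + 1) + 1))"

definition valid :: "(nat \<Rightarrow> nat) \<Rightarrow> bool" where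
  "valid f \<longleftrightarrow> (\<Sum>v<n. f v) \<le> 6 * k - 4 * card P \<or> (\<forall>v<n. f v \<noteq> 4)"

inductive reach :: "(nat \<Rightarrow> nat) \<Rightarrow> bool" where
  Start: "reach (\<lambda>_. 0)"
| Step: "reach f \<Longrightarrow> move f f' \<Longrightarrow> valid f' \<Longrightarrow> reach f'"

section \<open>Soundness of the moves\<close>

lemma take_path_apply:
  assumes "x < n" "y < n" "z < n"
  shows "v < n \<Longrightarrow> take_path x y z f v = (if pos v = 0 \<and> v \<in> {x, y, z} then 1 else f v)"
    and "take_path x y z f n = max (f n) (max (pos x) (max (pos y) (pos z)))"
    and "take_path x y z f (Suc n) = Suc (f (Suc n))"
    and "l > Suc n \<Longrightarrow> take_path x y z f l = f l"
  using assms by (auto simp: take_path_def take_vertex_def)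

text \<open>What the state has forgotten is kept as existential witnesses: \<open>Q\<close> consists
  of the completed paths, and \<open>h\<close> gives each waiting centre the endpoint already chosen
  for it. Everything chosen outside \<open>S\<close> lies at positions up to
  \<open>f n\<close>.\<close>

definition sane :: "(nat \<Rightarrow> nat) \<Rightarrow> bool" where
  "sane f \<longleftrightarrow> (\<forall>v<n. f v \<in> {0, 1, 4} \<and> (f v \<noteq> 0 \<longrightarrow> v \<in> S)) \<and> f n \<le> n \<and> (\<forall>l>Suc n. f l = 0) \<and>
     (\<exists>Q h. packing G Q \<and> card Q = f (Suc n) \<and>
        (\<forall>v\<in>verts Q. if v \<in> S then f v = 1 else pos v \<le> f n) \<and>
        (\<forall>x<n. f x = 4 \<longrightarrow> {x, h x} \<in> edges G \<and> h x \<notin> S \<and> h x \<notin> verts Q \<and> pos (h x) \<le> f n) \<and>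
        inj_on h {x. x < n \<and> f x = 4})"

lemma sane_start: "sane (\<lambda>_. 0)"
  unfolding sane_def by (intro conjI exI[of _ "{}"]) (auto simp: packing_def verts_def)

text \<open>New outside vertices lie beyond \<open>f n\<close>, while those of \<open>Q\<close> and
  of \<open>h\<close> do not, so they are automatically different. Inside \<open>S\<close> the
  values 0, 1 and 4 tell free vertices from the others.\<close>

lemma sane_move:
  assumes "sane f" "move f f'"
  shows "sane f'"
proof -
  have sane: "v < n \<Longrightarrow> f v \<in> {0, 1, 4}" "v < n \<Longrightarrow> f v \<noteq> 0 \<Longrightarrow> v \<in> S" "f n \<le> n"
      "l > Suc n \<Longrightarrow> f l = 0" for v l
    using \<open>sane f\<close> unfolding sane_def by blast+
  note vals = sane(1,2) and le = sane(3) and high = sane(4)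
  from \<open>sane f\<close> obtain Q h where Q: "packing G Q" "card Q = f (Suc n)"
    and vQ': "\<forall>v\<in>verts Q. if v \<in> S then f v = 1 else pos v \<le> f n"
    and h': "\<forall>x<n. f x = 4 \<longrightarrow>
      {x, h x} \<in> edges G \<and> h x \<notin> S \<and> h x \<notin> verts Q \<and> pos (h x) \<le> f n"
    and inj: "inj_on h {x. x < n \<and> f x = 4}"
    unfolding sane_def by blast
  have vQ: "v \<in> S \<Longrightarrow> f v = 1" "v \<notin> S \<Longrightarrow> pos v \<le> f n" if "v \<in> verts Q" for v
    using vQ' that by auto
  have h: "{x, h x} \<in> edges G \<and> h x \<notin> S \<and> h x \<notin> verts Q \<and> pos (h x) \<le> f n"
    if "x < n" "f x = 4" for x using h' that by blast
  from \<open>move f f'\<close> show ?thesis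
  proof cases
    case (Whole x y z)
    have lt: "x < n" "y < n" "z < n" and ne: "x \<noteq> y" "y \<noteq> z" using Whole edge_less[OF simple] by blast+
    have P2: "is_P2 G (x, y, z)" using Whole ne by simp
    \<comment> \<open>For vertices outside \<open>S\<close> this is the comparison with
      \<open>f n\<close>; for those in \<open>S\<close> the value 0 excludes vertices of completed
      paths and waiting centres.\<close>
    have new: "v \<notin> verts Q \<and> (\<forall>u<n. f u = 4 \<longrightarrow> h u \<noteq> v) \<and> f v \<noteq> 4" if "v \<in> {x, y, z}" for v
    proof -
      have "avail f v" "v < n" using that Whole lt by auto
      then show ?thesis using vQ h vals(2)[of v] pos0[of v] pos_S
        by (fastforce simp: avail_def split: if_splits)
    qed
    have Q': "packing G (insert (x, y, z) Q)" "(x, y, z) \<notin> Q"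
      using packing_insert[OF Q(1) P2] new by auto
    show ?thesis unfolding sane_def Whole(1)
    proof (intro conjI exI[of _ "insert (x, y, z) Q"] exI[of _ h])
      show "\<forall>v<n. take_path x y z f v \<in> {0, 1, 4} \<and> (take_path x y z f v \<noteq> 0 \<longrightarrow> v \<in> S)"
        using vals pos0 by (auto simp: take_path_apply[OF lt])
      show "take_path x y z f n \<le> n" using le pos_le lt by (simp add: take_path_apply[OF lt])
      show "\<forall>l>Suc n. take_path x y z f l = 0" using high by (simp add: take_path_apply[OF lt])
      show "packing G (insert (x, y, z) Q)" by (fact Q')
      show "card (insert (x, y, z) Q) = take_path x y z f (Suc n)"
        using Q' Q packing_finite by (simp add: take_path_apply[OF lt])
      show "\<forall>v\<in>verts (insert (x, y, z) Q). if v \<in> S then take_path x y z f v = 1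
          else pos v \<le> take_path x y z f n"
      proof
        fix v assume "v \<in> verts (insert (x, y, z) Q)"
        then consider "v \<in> {x, y, z}" | "v \<notin> {x, y, z}" "v \<in> verts Q" by (auto simp: verts_def)
        then show "if v \<in> S then take_path x y z f v = 1 else pos v \<le> take_path x y z f n"
          by cases (use vQ[of v] S_less in \<open>auto simp: take_path_apply[OF lt] le_max_iff_disj\<close>)
      qed
      have four: "take_path x y z f v = 4 \<longleftrightarrow> f v = 4" if "v < n" for v
        using that new by (auto simp: take_path_apply[OF lt])
      show "\<forall>u<n. take_path x y z f u = 4 \<longrightarrow> {u, h u} \<in> edges G \<and> h u \<notin> S \<and>
          h u \<notin> verts (insert (x, y, z) Q) \<and> pos (h u) \<le> take_path x y z f n"
      proof (intro allI impI)
        fix u assume u: "u < n" "take_path x y z f u = 4"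
        then have f4: "f u = 4" using four by blast
        with h[of u] u new show "{u, h u} \<in> edges G \<and> h u \<notin> S \<and>
          h u \<notin> verts (insert (x, y, z) Q) \<and> pos (h u) \<le> take_path x y z f n"
          by (auto simp: take_path_apply[OF lt] verts_def le_max_iff_disj)
      qed
      show "inj_on h {u. u < n \<and> take_path x y z f u = 4}"
        by (rule inj_on_subset[OF inj]) (use four in auto)
    qed
  next
    case (First x z)
    have lt: "x < n" "z < n" using First edge_less[OF simple] by blast+
    have xS: "x \<in> S" using First pos0 lt by simp
    have zS: "z \<notin> S" using First pos0[of z] lt by auto
    have zQ: "z \<notin> verts Q" using vQ(2)[of z] zS First by auto
    have zh: "h u \<noteq> z" if "u < n" "f u = 4" for u using h[OF that] First by auto
    show ?thesis unfolding sane_def First(1)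
    proof (intro conjI exI[of _ Q] exI[of _ "h(x := z)"])
      show "\<forall>v\<in>verts Q. if v \<in> S then (f(x := 4, n := pos z)) v = 1 else pos v \<le> (f(x := 4, n := pos z)) n"
        using vQ S_less First by (force dest: order.strict_implies_order)
      show "\<forall>u<n. (f(x := 4, n := pos z)) u = 4 \<longrightarrow> {u, (h(x := z)) u} \<in> edges G \<and> (h(x := z)) u \<notin> S \<and>
          (h(x := z)) u \<notin> verts Q \<and> pos ((h(x := z)) u) \<le> (f(x := 4, n := pos z)) n"
      proof (intro allI impI)
        fix u assume u: "u < n" "(f(x := 4, n := pos z)) u = 4"
        show "{u, (h(x := z)) u} \<in> edges G \<and> (h(x := z)) u \<notin> S \<and>
          (h(x := z)) u \<notin> verts Q \<and> pos ((h(x := z)) u) \<le> (f(x := 4, n := pos z)) n"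
        proof (cases "u = x")
          case False
          then have "f u = 4" using u by (simp split: if_splits)
          from h[OF u(1) this] False First show ?thesis by simp
        qed (use First zS zQ in simp)
      qed
      show "inj_on (h(x := z)) {u. u < n \<and> (f(x := 4, n := pos z)) u = 4}"
      proof (rule inj_onI)
        fix a b
        assume "a \<in> {u. u < n \<and> (f(x := 4, n := pos z)) u = 4}"
          "b \<in> {u. u < n \<and> (f(x := 4, n := pos z)) u = 4}" "(h(x := z)) a = (h(x := z)) b"
        then show "a = b"
          using zh[of a] zh[of b] inj_onD[OF inj, of a b] by (auto split: if_splits)
      qed
    qed (use vals le high Q lt xS pos_le in auto)
  next
    case (Second x z)
    have lt: "x < n" "z < n" using Second edge_less[OF simple] by blast+
    have xS: "x \<in> S" using Second vals(2)[of x] lt by simp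
    have zS: "z \<notin> S" using Second pos0[of z] lt by auto
    have zQ: "z \<notin> verts Q" using vQ(2)[of z] zS Second by auto
    have xQ: "x \<notin> verts Q" using vQ(1)[of x] xS Second by auto
    have zh: "h u \<noteq> z" if "u < n" "f u = 4" for u using h[OF that] Second by auto
    have hx: "{x, h x} \<in> edges G" "h x \<notin> S" "h x \<notin> verts Q" "pos (h x) \<le> f n"
      using h[of x] Second lt by auto
    \<comment> \<open>The forgotten endpoint comes back from \<open>h\<close>. Injectivity of
      \<open>h\<close> keeps it apart from the endpoints of the centres that still wait.\<close>
    let ?p = "(h x, x, z)"
    have P2: "is_P2 G ?p" using Second hx zh lt xS zS by (auto simp: insert_commute)
    have Q': "packing G (insert ?p Q)" "?p \<notin> Q"
      using packing_insert[OF Q(1) P2] zQ xQ hx by auto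
    show ?thesis unfolding sane_def Second(1)
    proof (intro conjI exI[of _ "insert ?p Q"] exI[of _ h])
      let ?f = "f(x := 1, n := pos z, n + 1 := f (n + 1) + 1)"
      show "\<forall>v\<in>verts (insert ?p Q). if v \<in> S then ?f v = 1 else pos v \<le> ?f n"
      proof
        fix v assume "v \<in> verts (insert ?p Q)"
        then consider "v = x" | "v = h x" | "v = z" | "v \<in> verts Q" by (auto simp: verts_def)
        then show "if v \<in> S then ?f v = 1 else pos v \<le> ?f n"
        proof cases
          case 4
          then show ?thesis using vQ[of v] S_less[of v] Second by auto
        qed (use xS zS hx lt Second in auto)
      qed
      show "\<forall>u<n. ?f u = 4 \<longrightarrow> {u, h u} \<in> edges G \<and> h u \<notin> S \<and> h u \<notin> verts (insert ?p Q) \<and> pos (h u) \<le> ?f n"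
      proof (intro allI impI)
        fix u assume u: "u < n" "?f u = 4"
        then have u4: "f u = 4" "u \<noteq> x" by (auto split: if_splits)
        have "h u \<noteq> h x" using inj u4 u Second lt by (auto simp: inj_on_def)
        with h[OF u(1) u4(1)] zh[OF u(1) u4(1)] xS Second(4)
        show "{u, h u} \<in> edges G \<and> h u \<notin> S \<and> h u \<notin> verts (insert ?p Q) \<and> pos (h u) \<le> ?f n"
          by (auto simp: verts_def)
      qed
      show "inj_on h {u. u < n \<and> ?f u = 4}"
        using inj by (rule inj_on_subset) (auto split: if_splits)
      show "card (insert ?p Q) = ?f (Suc n)" using Q' Q packing_finite by simp
    qed (use vals le high Q' lt xS pos_le in auto)
  qed
qed

lemma sane_reach: "reach f \<Longrightarrow> sane f"
  by (induction rule: reach.induct) (auto intro: sane_start sane_move)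

lemma sane_count: "sane f \<Longrightarrow> has_P2_packing G (f (Suc n))"
  unfolding sane_def has_P2_packing_iff by blast

lemma sane_count_le: "sane f \<Longrightarrow> f (Suc n) \<le> n"
  using card_packing_le[OF simple] unfolding sane_def by fastforce

section \<open>Counting the search states\<close>

lemma R_pos: "x < n \<Longrightarrow> x \<notin> S \<Longrightarrow> 0 < pos x"
  using pos0 by blast

text \<open>Counting with a generating function: if every assignment of weight w is counted with
  (2/3)^w, then those of weight at most W count at least (2/3)^W each, and the sum over all
  assignments factors over the vertices of \<open>S\<close>. The two counters contribute (n + 1)^2,
  the states without the value 4 the summand with base 2.\<close>

lemma valid_count:
  fixes F :: "(nat \<Rightarrow> nat) set"
  defines "F \<equiv> {f. sane f \<and> valid f}"
  shows "finite F"
    and "real (card F) \<le> real ((n + 1)\<^sup>2) *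
      ((3/2) ^ (6 * k - 4 * card P) * (151/81) ^ (3 * card P) + 2 ^ (3 * card P))"
proof -
  define W where "W = 6 * k - 4 * card P"
  define D where "D = {d \<in> S \<rightarrow>\<^sub>E {0, 1, 4::nat}. (\<Sum>x\<in>S. d x) \<le> W}"
  define A where "A = (D \<union> (S \<rightarrow>\<^sub>E {0, 1::nat})) \<times> {..n} \<times> {..n}"
  define \<phi> where "\<phi> = (\<lambda>f :: nat \<Rightarrow> nat. (restrict f S, f n, f (Suc n)))"
  have finS: "finite S" using finite_verts[OF packP] .
  have finD: "finite D" unfolding D_def using finS by (intro finite_subset[OF _ finite_PiE[of S "\<lambda>_. {0, 1, 4}"]]) auto
  have finA: "finite A" unfolding A_def using finD finS by (auto intro!: finite_PiE)
  \<comment> \<open>Sane functions vanish outside \<open>S\<close> except at the two cells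
    \<open>n\<close> and \<open>Suc n\<close>.\<close>
  have inj: "inj_on \<phi> F"
  proof (rule inj_onI)
    fix f g assume fg: "f \<in> F" "g \<in> F" "\<phi> f = \<phi> g"
    show "f = g"
    proof
      fix v
      have z: "v < n \<Longrightarrow> v \<notin> S \<Longrightarrow> f v = 0 \<and> g v = 0" "v > Suc n \<Longrightarrow> f v = 0 \<and> g v = 0"
        using fg unfolding F_def sane_def by blast+
      have "v \<in> S \<Longrightarrow> restrict f S v = restrict g S v" "f n = g n" "f (Suc n) = g (Suc n)"
        using fg(3) by (simp_all add: \<phi>_def)
      with z show "f v = g v" by (cases "v \<in> S"; cases v n rule: linorder_cases; cases "v = Suc n") auto
    qed
  qed
  have sub: "\<phi> ` F \<subseteq> A"
  proof
    fix a assume "a \<in> \<phi> ` F"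
    then obtain f where f: "sane f" "valid f" "a = \<phi> f" by (auto simp: F_def)
    have vals: "\<And>v. v < n \<Longrightarrow> f v \<in> {0, 1, 4}" and zero: "\<And>v. v < n \<Longrightarrow> v \<notin> S \<Longrightarrow> f v = 0"
      and le: "f n \<le> n" using f(1) unfolding sane_def by blast+
    have "restrict f S \<in> D \<union> (S \<rightarrow>\<^sub>E {0, 1})"
    proof (cases "\<forall>v<n. f v \<noteq> 4")
      case True
      then have "restrict f S \<in> S \<rightarrow>\<^sub>E {0, 1}" using vals S_less by fastforce
      then show ?thesis by simp
    next
      case False
      then have "(\<Sum>v<n. f v) \<le> W" using f(2) by (auto simp: valid_def W_def)
      moreover have "(\<Sum>v<n. f v) = (\<Sum>v\<in>S. f v)"
        by (intro sum.mono_neutral_right) (use S_less zero in auto)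
      ultimately have "restrict f S \<in> D" using vals S_less by (auto simp: D_def)
      then show ?thesis by simp
    qed
    with le sane_count_le[OF f(1)] show "a \<in> A" by (auto simp: f(3) \<phi>_def A_def)
  qed
  show "finite F" using finite_imageD[OF finite_subset[OF sub finA] inj] .
  have "card F \<le> card A" using card_inj_on_le[OF inj sub finA] .
  also have "card A \<le> (card D + card (S \<rightarrow>\<^sub>E {0, 1::nat})) * (n + 1)\<^sup>2"
    unfolding A_def card_cartesian_product power2_eq_square
    using mult_le_mono1[OF card_Un_le[of D "S \<rightarrow>\<^sub>E {0, 1::nat}"], of "Suc n * Suc n"] by simp
  finally have "real (card F) \<le> real ((card D + card (S \<rightarrow>\<^sub>E {0, 1::nat})) * (n + 1)\<^sup>2)"
    by (rule of_nat_mono)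
  moreover have "card (S \<rightarrow>\<^sub>E {0, 1::nat}) = 2 ^ (3 * card P)"
    using finS card_verts[OF packP] by (simp add: card_PiE numeral_2_eq_2)
  moreover have "real (card D) \<le> (3/2) ^ W * (151/81) ^ (3 * card P)"
  proof -
    have "real (card D) = (\<Sum>d\<in>D. 1)" by simp
    also have "\<dots> \<le> (\<Sum>d\<in>D. (3/2) ^ W * (\<Prod>x\<in>S. (2/3) ^ d x))"
    proof (rule sum_mono)
      fix d assume "d \<in> D"
      then have "(\<Sum>x\<in>S. d x) \<le> W" by (simp add: D_def)
      then have "(2/3::real) ^ W \<le> (2/3) ^ (\<Sum>x\<in>S. d x)" by (intro power_decreasing) auto
      then have "(3/2) ^ W * (2/3::real) ^ W \<le> (3/2) ^ W * (\<Prod>x\<in>S. (2/3) ^ d x)"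
        by (simp add: power_sum)
      then show "1 \<le> (3/2::real) ^ W * (\<Prod>x\<in>S. (2/3) ^ d x)"
        by (simp add: power_mult_distrib[symmetric])
    qed
    also have "\<dots> \<le> (\<Sum>d\<in>S \<rightarrow>\<^sub>E {0, 1, 4}. (3/2) ^ W * (\<Prod>x\<in>S. (2/3) ^ d x))"
      using finS by (intro sum_mono2) (auto simp: D_def intro!: finite_PiE prod_nonneg mult_nonneg_nonneg)
    also have "\<dots> = (3/2) ^ W * (\<Sum>d\<in>S \<rightarrow>\<^sub>E {0, 1, 4}. \<Prod>x\<in>S. (2/3) ^ d x)"
      by (simp add: sum_distrib_left)
    also have "(\<Sum>d\<in>S \<rightarrow>\<^sub>E {0, 1, 4::nat}. \<Prod>x\<in>S. (2/3::real) ^ d x) = (\<Prod>x\<in>S. \<Sum>a\<in>{0, 1, 4::nat}. (2/3) ^ a)"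
      using finS by (intro prod_sum_PiE[symmetric]) auto
    \<comment> \<open>1 + 2/3 + (2/3)^4 = (81 + 54 + 16) / 81.\<close>
    also have "\<dots> = (151/81) ^ card S" by (simp add: power_divide)
    finally show ?thesis using card_verts[OF packP] by simp
  qed
  ultimately have "real (card F) \<le> ((3/2) ^ W * (151/81) ^ (3 * card P) + 2 ^ (3 * card P)) * real ((n + 1)\<^sup>2)"
    by (auto intro: order_trans mult_right_mono)
  then show "real (card F) \<le> real ((n + 1)\<^sup>2) *
      ((3/2) ^ (6 * k - 4 * card P) * (151/81) ^ (3 * card P) + 2 ^ (3 * card P))"
    by (simp add: mult.commute W_def)
qed

text \<open>The paths of \<open>Q\<close> that leave \<open>S\<close> are completed in the order of their last positions.
  \<open>owed Q t x\<close> is the value of the vertex \<open>x\<close> once all positions up to \<open>t\<close> are used; \<open>split_at\<close> describes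
  paths with both vertices of an edge outside \<open>S\<close>, which are completed in one step, so that no
  search state corresponds to a position between them.\<close>

definition finished :: "nat \<Rightarrow> nat \<times> nat \<times> nat \<Rightarrow> bool" where
  "finished t q \<longleftrightarrow> path_verts q - S \<noteq> {} \<and> (\<forall>v\<in>path_verts q - S. pos v \<le> t)"

fun half :: "nat \<Rightarrow> nat \<times> nat \<times> nat \<Rightarrow> bool" where
  "half t (u, v, w) \<longleftrightarrow> u \<notin> S \<and> v \<in> S \<and> w \<notin> S \<and> (pos u \<le> t) \<noteq> (pos w \<le> t)"

definition owed :: "(nat \<times> nat \<times> nat) set \<Rightarrow> nat \<Rightarrow> nat \<Rightarrow> nat" where
  "owed Q t x = (if \<exists>q\<in>Q. x \<in> path_verts q \<inter> S \<and> finished t q then 1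
     else if \<exists>q\<in>Q. x \<in> path_verts q \<inter> S \<and> half t q then 4 else 0)"

definition split_at :: "nat \<Rightarrow> nat \<times> nat \<times> nat \<Rightarrow> bool" where
  "split_at t q \<longleftrightarrow> fst (snd q) \<notin> S \<and> (\<exists>v\<in>path_verts q - S. pos v \<le> t) \<and> (\<exists>v\<in>path_verts q - S. t < pos v)"

text \<open>An inequality for \<open>f n\<close>, since position \<open>t\<close> may belong to no
  path of \<open>Q\<close>; the state of an earlier position then serves for \<open>t\<close> as
  well.\<close>

definition reached :: "(nat \<times> nat \<times> nat) set \<Rightarrow> nat \<Rightarrow> bool" where
  "reached Q t \<longleftrightarrow> (\<exists>f. reach f \<and> f n \<le> t \<and> (\<forall>x<n. f x = owed Q t x) \<and>
     f (Suc n) = card {q\<in>Q. finished t q})"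

section \<open>The weight of a fixed packing during the search\<close>

lemma owed_eq:
  assumes "packing G Q" "q \<in> Q" "x \<in> path_verts q" "x \<in> S"
  shows "owed Q t x = (if finished t q then 1 else if half t q then 4 else 0)"
proof -
  have "(\<exists>q'\<in>Q. x \<in> path_verts q' \<inter> S \<and> R q') \<longleftrightarrow> R q" for R
    using assms packing_unique[OF assms(1,2)] by blast
  then show ?thesis unfolding owed_def by simp
qed

lemma owed_0: "x \<notin> verts Q \<Longrightarrow> owed Q t x = 0" "x \<notin> S \<Longrightarrow> owed Q t x = 0"
  by (auto simp: owed_def verts_def)

lemma owed_cong:
  assumes "\<And>q. q \<in> Q \<Longrightarrow> x \<in> path_verts q \<Longrightarrow>
    (finished t q \<longleftrightarrow> finished t' q) \<and> (half t q \<longleftrightarrow> half t' q)"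
  shows "owed Q t x = owed Q t' x"
proof -
  have "(\<exists>q\<in>Q. x \<in> path_verts q \<inter> S \<and> finished t q) \<longleftrightarrow> (\<exists>q\<in>Q. x \<in> path_verts q \<inter> S \<and> finished t' q)"
    "(\<exists>q\<in>Q. x \<in> path_verts q \<inter> S \<and> half t q) \<longleftrightarrow> (\<exists>q\<in>Q. x \<in> path_verts q \<inter> S \<and> half t' q)"
    using assms by blast+
  then show ?thesis unfolding owed_def by (simp only:)
qed

text \<open>The values inside \<open>S\<close> are charged to the outside vertices of the same path,
  two units each. As every path of \<open>P\<close> meets \<open>Q\<close> in two vertices,
  \<open>Q\<close> has at least \<open>2 * card P\<close> of its \<open>3 * k\<close> vertices in
  \<open>S\<close>. The bound holds at every time \<open>t\<close>, so no state on the way is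
  pruned.\<close>

lemma owed_sum_le:
  assumes "packing G Q" "card Q = k" "\<And>p. p \<in> P \<Longrightarrow> 2 \<le> card (path_verts p \<inter> verts Q)"
  shows "(\<Sum>x<n. owed Q t x) \<le> 6 * k - 4 * card P"
proof -
  have fQ: "finite Q" using assms(1) packing_finite by blast
  have disj: "(path_verts p \<inter> A) \<inter> (path_verts q \<inter> A) = {}"
    if "packing G Q'" "p \<in> Q'" "q \<in> Q'" "p \<noteq> q" for p q Q' A
    using packing_unique[OF that(1-3)] that(4) by blast
  have "(\<Sum>x<n. owed Q t x) = (\<Sum>x\<in>(\<Union>q\<in>Q. path_verts q \<inter> S). owed Q t x)"
    by (intro sum.mono_neutral_right) (use S_less in \<open>auto simp: owed_def split: if_splits\<close>)
  also have "\<dots> = (\<Sum>q\<in>Q. \<Sum>x\<in>path_verts q \<inter> S. owed Q t x)"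
    using fQ disj[OF assms(1)] by (intro sum.UNION_disjoint ballI impI) simp_all
  also have "\<dots> \<le> (\<Sum>q\<in>Q. 2 * card (path_verts q - S))"
  proof (rule sum_mono)
    fix q assume q: "q \<in> Q"
    have c: "card (path_verts q \<inter> S) + card (path_verts q - S) = 3"
      using card_Int_Diff[of "path_verts q" S] card_path_verts packing_is_P2[OF assms(1) q] by simp
    have eq: "(\<Sum>x\<in>path_verts q \<inter> S. owed Q t x) =
        (\<Sum>x\<in>path_verts q \<inter> S. if finished t q then 1 else if half t q then 4 else 0)"
      using owed_eq[OF assms(1) q] by (intro sum.cong) auto
    consider "finished t q" | "\<not> finished t q" "half t q" | "\<not> finished t q" "\<not> half t q" by blast
    then show "(\<Sum>x\<in>path_verts q \<inter> S. owed Q t x) \<le> 2 * card (path_verts q - S)"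
    proof cases
      \<comment> \<open>With c >= 1 vertices outside, the remaining 3 - c vertices of value 1 weigh
        at most 2 c.\<close>
      case 1
      then have "card (path_verts q - S) > 0"
        unfolding finished_def by (metis card_gt_0_iff finite_Diff finite_path_verts)
      then show ?thesis using eq 1 c by simp
    next
      \<comment> \<open>One centre of value 4 against two endpoints outside \<open>S\<close>: the
        estimate is sharp.\<close>
      case 2
      obtain u v w where uvw: "q = (u, v, w)" by (cases q)
      with 2 have "path_verts q \<inter> S = {v}" by auto
      then show ?thesis using eq 2 c by simp
    qed (use eq in simp)
  qed
  also have "\<dots> = 2 * card (\<Union>q\<in>Q. path_verts q - S)"
    unfolding sum_distrib_left[symmetric] Diff_eq using fQ disj[OF assms(1), where A = "- S"]
    by (subst card_UN_disjoint) simp_all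
  also have "(\<Union>q\<in>Q. path_verts q - S) = verts Q - S" by (auto simp: verts_def)
  also have "card (verts Q - S) \<le> 3 * k - 2 * card P"
  proof -
    have "2 * card P \<le> (\<Sum>p\<in>P. card (path_verts p \<inter> verts Q))"
      using sum_mono[of P "\<lambda>_. 2" "\<lambda>p. card (path_verts p \<inter> verts Q)"] assms(3) by (simp add: mult.commute)
    also have "\<dots> = card (\<Union>p\<in>P. path_verts p \<inter> verts Q)"
      using packing_finite[OF packP] disj[OF packP] by (subst card_UN_disjoint) simp_all
    also have "(\<Union>p\<in>P. path_verts p \<inter> verts Q) = verts Q \<inter> S" by (auto simp: verts_def)
    finally show ?thesis
      using card_Int_Diff[of "verts Q" S] finite_verts[OF assms(1)] card_verts[OF assms(1)] assms(2)
      by simp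
  qed
  finally show ?thesis by simp
qed

section \<open>Every suitable packing is assembled by the search\<close>

context
  fixes Q
  assumes Q: "packing G Q" and cQ: "card Q = k"
    and meets: "\<And>p. p \<in> P \<Longrightarrow> 2 \<le> card (path_verts p \<inter> verts Q)"
begin

lemma pos_eq:
  assumes "q \<in> Q" "q' \<in> Q" "x \<in> path_verts q - S" "y \<in> path_verts q' - S" "pos x = pos y"
  shows "x = y \<and> q = q'"
proof -
  have "x < n" "y < n" using assms is_P2_less[OF simple packing_is_P2[OF Q]] by auto
  then have "x = y" using inj_onD[OF pos_inj assms(5)] assms by auto
  then show ?thesis using assms packing_unique[OF Q assms(1,2)] by blast
qed

text \<open>Only \<open>q\<close> owns positions strictly after \<open>t'\<close> and up to
  \<open>t\<close>, so for every other path the same vertices have been passed at both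
  times.\<close>

lemma finished_other:
  assumes "t' \<le> t" "\<forall>q'\<in>Q. \<forall>x\<in>path_verts q' - S. t' < pos x \<longrightarrow> pos x \<le> t \<longrightarrow> q' = q"
  shows "q' \<in> Q \<Longrightarrow> q' \<noteq> q \<Longrightarrow> finished t q' \<longleftrightarrow> finished t' q'"
    and "q' \<in> Q \<Longrightarrow> q' \<noteq> q \<Longrightarrow> half t q' \<longleftrightarrow> half t' q'"
proof -
  have *: "pos x \<le> t \<longleftrightarrow> pos x \<le> t'" if "q' \<in> Q" "q' \<noteq> q" "x \<in> path_verts q' - S" for q' x
    using assms that by (meson le_trans not_le)
  show "q' \<in> Q \<Longrightarrow> q' \<noteq> q \<Longrightarrow> finished t q' \<longleftrightarrow> finished t' q'"
    unfolding finished_def using * by blast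
  show "q' \<in> Q \<Longrightarrow> q' \<noteq> q \<Longrightarrow> half t q' \<longleftrightarrow> half t' q'"
    using * by (cases q') auto
qed

text \<open>The common conclusion of all kinds of steps: only the effect of the move on the vertices
  of \<open>q\<close> has to be checked. Other paths keep their status, and validity follows from
  the weight bound at time \<open>t\<close>.\<close>

lemma reached_step:
  assumes q: "q \<in> Q" and f: "reach f" "\<forall>x<n. f x = owed Q t' x"
    "f (Suc n) = card {q\<in>Q. finished t' q}"
    and le: "t' \<le> t"
    and other: "\<forall>q'\<in>Q. \<forall>x\<in>path_verts q' - S. t' < pos x \<longrightarrow> pos x \<le> t \<longrightarrow> q' = q"
    and move: "move f f'" and f': "f' n \<le> t"
    "\<And>x. x < n \<Longrightarrow> f' x = (if x \<in> path_verts q \<inter> S then owed Q t x else f x)"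
    "f' (Suc n) = (if finished t q then Suc (f (Suc n)) else f (Suc n))"
    and nf: "\<not> finished t' q"
  shows "reached Q t"
proof -
  note oth = finished_other[OF le other]
  have owed: "owed Q t x = owed Q t' x" if "x \<notin> path_verts q" for x
    by (rule owed_cong) (use oth that in blast)
  have 1: "f' x = owed Q t x" if "x < n" for x
    using f'(2)[OF that] f(2) that owed[of x] by (auto simp: owed_0)
  have set: "{q\<in>Q. finished t q} = (if finished t q then insert q {q\<in>Q. finished t' q} else {q\<in>Q. finished t' q})"
    using oth q nf by auto
  have 2: "f' (Suc n) = card {q\<in>Q. finished t q}"
    unfolding set f'(3) f(3) using nf packing_finite[OF Q] by auto
  have "(\<Sum>v<n. f' v) = (\<Sum>v<n. owed Q t v)" by (rule sum.cong) (simp_all add: 1)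
  then have "valid f'" using owed_sum_le[OF Q cQ meets, of t] unfolding valid_def by simp
  then have "reach f'" using reach.Step f(1) move by blast
  then show ?thesis unfolding reached_def using f'(1) 1 2 by blast
qed

text \<open>If all outside vertices of \<open>q\<close> are passed between \<open>t'\<close> and
  \<open>t\<close>, none of its vertices has been touched at \<open>t'\<close>, and the path can be
  taken in one move.\<close>

lemma reached_whole:
  assumes q: "q \<in> Q" and r: "reached Q t'" and t: "t' < t" and x: "x \<in> path_verts q - S"
    and between: "\<And>x. x \<in> path_verts q - S \<Longrightarrow> t' < pos x \<and> pos x \<le> t"
    and other: "\<forall>q'\<in>Q. \<forall>x\<in>path_verts q' - S. t' < pos x \<longrightarrow> pos x \<le> t \<longrightarrow> q' = q"
  shows "reached Q t"
proof -
  obtain f where f: "reach f" "f n \<le> t'" "\<forall>x<n. f x = owed Q t' x"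
    "f (Suc n) = card {q\<in>Q. finished t' q}"
    using r unfolding reached_def by blast
  obtain u v w where uvw: "q = (u, v, w)" by (cases q)
  have fin: "finished t q" "\<not> finished t' q" using between x by (auto simp: finished_def not_le)
  have nhalf: "\<not> half t' q" using between[of u] between[of w] by (auto simp: uvw not_le)
  have P2: "is_P2 G q" using packing_is_P2[OF Q q] .
  have lt: "u < n" "v < n" "w < n" using is_P2_less[OF simple P2] by (auto simp: uvw)
  have av: "avail f z" if "z \<in> path_verts q" for z
  proof (cases "z \<in> S")
    case True
    then show ?thesis using f(3) S_less owed_eq[OF Q q that True, of t'] fin nhalf by (simp add: avail_def)
  next
    case False
    then show ?thesis using between[of z] that f(2) by (auto simp: avail_def)
  qed
  have move: "move f (take_path u v w f)"
    using P2 av by (intro move.Whole) (auto simp: uvw)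
  have z: "pos z = 0 \<longleftrightarrow> z \<in> S" if "z < n" for z using pos0 that by blast
  have ple: "pos z \<le> t" if "z \<in> path_verts q" for z using between[of z] that by (cases "z \<in> S") auto
  show ?thesis
  proof (rule reached_step[OF q f(1,3,4) less_imp_le[OF t] other move])
    show "take_path u v w f n \<le> t" using ple f(2) t by (simp add: take_path_apply[OF lt] uvw)
    show "take_path u v w f z = (if z \<in> path_verts q \<inter> S then owed Q t z else f z)" if "z < n" for z
      using that owed_eq[OF Q q, of z t] fin z[OF that] by (auto simp: take_path_apply[OF lt] uvw)
    show "take_path u v w f (Suc n) = (if finished t q then Suc (f (Suc n)) else f (Suc n))"
      using fin by (simp add: take_path_apply[OF lt])
  qed (use fin in auto)
qed

text \<open>By maximality of \<open>P\<close> no path lies completely outside \<open>S\<close>. Two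
  outside vertices are either the endpoints or joined by an edge, and in the second case their
  positions are consecutive.\<close>

lemma path_cases:
  assumes q: "q \<in> Q"
  obtains (inside) "path_verts q - S = {}"
    | (one) x where "path_verts q - S = {x}"
    | (ends) u v w where "q = (u, v, w)" "u \<notin> S" "v \<in> S" "w \<notin> S" "pos u \<noteq> pos w" "{v, u} \<in> edges G" "{v, w} \<in> edges G"
    | (edge) x y where "path_verts q - S = {x, y}" "pos y = Suc (pos x)" "fst (snd q) \<notin> S"
proof -
  obtain u v w where uvw: "q = (u, v, w)" by (cases q)
  have P2: "is_P2 G q" using packing_is_P2[OF Q q] .
  then have d: "u \<noteq> v" "v \<noteq> w" "u \<noteq> w" and e: "{u, v} \<in> edges G" "{v, w} \<in> edges G" by (auto simp: uvw)
  have "path_verts q \<inter> S \<noteq> {}" using maximal[OF P2] .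
  then consider "path_verts q - S = {}" | x where "path_verts q - S = {x}"
    | "u \<notin> S" "v \<in> S" "w \<notin> S" | "u \<notin> S" "v \<notin> S" "w \<in> S" | "u \<in> S" "v \<notin> S" "w \<notin> S"
    by (auto simp: uvw)
  then show ?thesis
  proof cases
    case 3
    have "pos u \<noteq> pos w" using pos_eq[OF q q, of u w] d 3 by (auto simp: uvw)
    then show ?thesis using ends uvw 3 e by (simp add: insert_commute)
  next
    case 4
    then have "path_verts q - S = {u, v}" by (auto simp: uvw)
    then show ?thesis using pos_adj[OF e(1) 4(1,2)] edge[of u v] edge[of v u] 4 by (auto simp: uvw)
  next
    case 5
    then have "path_verts q - S = {v, w}" by (auto simp: uvw)
    then show ?thesis using pos_adj[OF e(2) 5(2,3)] edge[of v w] edge[of w v] 5 by (auto simp: uvw)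
  qed (use inside one in auto)
qed

text \<open>Strong induction on the position. Ordinarily the step goes from \<open>t - 1\<close> to
  \<open>t\<close>; a path with an outside edge ending at \<open>t\<close> is taken at once from
  \<open>t - 2\<close>, as there is no state for the position between its vertices.\<close>

lemma reached_all: "\<forall>q\<in>Q. \<not> split_at t q \<Longrightarrow> reached Q t"
proof (induction t rule: less_induct)
  case (less t)
  have zero: "0 < pos x" if "q \<in> Q" "x \<in> path_verts q - S" for q x
    using R_pos is_P2_less[OF simple packing_is_P2[OF Q that(1)]] that by auto
  show ?case
  proof (cases "t = 0")
    case True
    \<comment> \<open>Positions of outside vertices are positive, so at time 0 nothing has been
      passed.\<close>
    have "\<not> finished 0 q \<and> \<not> half 0 q" if "q \<in> Q" for q
      using zero[OF that] by (cases q) (force simp: finished_def)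
    then have "owed Q 0 x = 0" "card {q\<in>Q. finished 0 q} = 0" for x
      by (auto simp: owed_def card_eq_0_iff)
    then show ?thesis unfolding True reached_def using reach.Start
      by (intro exI[of _ "\<lambda>_. 0"] conjI) simp_all
  next
    case t: False
    show ?thesis
    proof (cases "\<exists>q\<in>Q. \<exists>x\<in>path_verts q - S. pos x = t")
      \<comment> \<open>No path of \<open>Q\<close> owns position \<open>t\<close>, and nothing
        changes from \<open>t - 1\<close> to \<open>t\<close>.\<close>
      case False
      have le: "pos x \<le> t - 1 \<longleftrightarrow> pos x \<le> t" if "q \<in> Q" "x \<in> path_verts q - S" for q x
        using False that t by (metis One_nat_def Suc_pred le_SucE le_SucI neq0_conv)
      have *: "finished (t - 1) q = finished t q" "half (t - 1) q = half t q"
        "split_at (t - 1) q = split_at t q" if "q \<in> Q" for q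
      proof -
        show "finished (t - 1) q = finished t q" using le[OF that] unfolding finished_def by blast
        show "half (t - 1) q = half t q" using le[OF that] by (cases q) auto
        show "split_at (t - 1) q = split_at t q"
          unfolding split_at_def using le[OF that] by (metis not_le)
      qed
      have "reached Q (t - 1)" using less t * by simp
      moreover have "owed Q (t - 1) x = owed Q t x" for x
        by (rule owed_cong) (use * in auto)
      moreover have "{q\<in>Q. finished (t - 1) q} = {q\<in>Q. finished t q}"
        by (rule Collect_cong) (use *(1) in blast)
      ultimately obtain f where "reach f" "f n \<le> t - 1" "\<forall>x<n. f x = owed Q t x"
        "f (Suc n) = card {q\<in>Q. finished t q}"
        unfolding reached_def by auto
      then show ?thesis unfolding reached_def by (intro exI[of _ f]) simp
    next
      case True
      then obtain q x where q: "q \<in> Q" and x: "x \<in> path_verts q - S" and px: "pos x = t" by blast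
      have only: "q' = q \<and> y = x" if "q' \<in> Q" "y \<in> path_verts q' - S" "pos y = t" for q' y
        using pos_eq[OF that(1) q that(2) x] that px by simp
      have other: "\<forall>q'\<in>Q. \<forall>y\<in>path_verts q' - S. t - 1 < pos y \<longrightarrow> pos y \<le> t \<longrightarrow> q' = q"
        using only t by (metis One_nat_def Suc_pred le_antisym less_eq_Suc_le neq0_conv)
      \<comment> \<open>A path split at \<open>t - 1\<close> has an outside edge at the positions
        \<open>t - 1\<close> and \<open>t\<close>, and the owner of \<open>t\<close> is
        \<open>q\<close>.\<close>
      have next_split: "q' = q" if "q' \<in> Q" "split_at (t - 1) q'" for q'
        using that(1)
      proof (cases rule: path_cases)
        case (edge a b)
        with that t have "t = pos b" unfolding split_at_def by auto
        then show ?thesis using only[OF that(1), of b] edge by auto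
      qed (use that in \<open>auto simp: split_at_def\<close>)
      from q show ?thesis
      proof (cases rule: path_cases)
        case inside
        then show ?thesis using x by blast
      next
        case (one y)
        have "\<not> split_at (t - 1) q" unfolding split_at_def one using t x px by auto
        then have "reached Q (t - 1)" using less t next_split by (metis One_nat_def diff_Suc_less neq0_conv)
        then show ?thesis by (rule reached_whole[OF q _ _ x _ other]) (use x one px t in auto)
      next
        case (ends u v w)
        obtain y where xy: "{u, w} = {x, y}" "pos y \<noteq> t" using x ends px by auto
        have yR: "y \<in> path_verts q - S" using xy ends by (auto simp: doubleton_eq_iff)
        have edge: "{v, x} \<in> edges G" using ends xy by (auto simp: doubleton_eq_iff)
        have "\<not> split_at (t - 1) q" unfolding split_at_def using ends by simp
        then have "reached Q (t - 1)" using less t next_split by (metis One_nat_def diff_Suc_less neq0_conv)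
        then obtain f where f: "reach f" "f n \<le> t - 1" "\<forall>x<n. f x = owed Q (t - 1) x"
          "f (Suc n) = card {q\<in>Q. finished (t - 1) q}"
          unfolding reached_def by blast
        have vS: "v \<in> path_verts q" "v \<in> S" "v < n" using ends S_less by auto
        have pv: "path_verts q \<inter> S = {v}" "path_verts q - S = {x, y}" using ends xy by auto
        have fin: "finished t q \<longleftrightarrow> pos y < t" "\<not> finished (t - 1) q"
          unfolding finished_def pv using px xy(2) t by auto
        have half: "half t q \<longleftrightarrow> t < pos y" "half (t - 1) q \<longleftrightarrow> pos y < t"
          using ends xy px t by (auto simp: doubleton_eq_iff)
        have fv: "f v = (if pos y < t then 4 else 0)"
          using f(3) vS(3) owed_eq[OF Q q vS(1,2), of "t - 1"] fin(2) half(2) by simp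
        have ov: "owed Q t v = (if pos y < t then 1 else 4)"
          using owed_eq[OF Q q vS(1,2), of t] fin half xy(2) by simp
        note step = reached_step[OF q f(1,3,4) diff_le_self[of t 1] other]
        show ?thesis
        \<comment> \<open>If the other endpoint \<open>y\<close> has been passed, \<open>x\<close>
          completes the path; otherwise \<open>x\<close> is its first endpoint and opens the centre
          \<open>v\<close>.\<close>
        proof (cases "pos y < t")
          case True
          then have "f v = 4" using fv by simp
          then have move: "move f (f(v := 1, n := pos x, n + 1 := f (n + 1) + 1))"
            using edge f(2) px t by (intro move.Second) auto
          show ?thesis
            by (rule step[OF move])
              (use True pv vS px fin ov in auto)
        next
          case False
          then have "f v = 0" using fv by simp
          then have move: "move f (f(v := 4, n := pos x))"
            using edge f(2) px t vS by (intro move.First) auto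
          show ?thesis
            by (rule step[OF move])
              (use False pv vS px fin ov in auto)
        qed
      next
        case (edge a b)
        \<comment> \<open>If \<open>t\<close> were the position of the first vertex of the edge,
          \<open>q\<close> would be split at \<open>t\<close>.\<close>
        have "x = b"
        proof (rule ccontr)
          assume "x \<noteq> b"
          then have "x = a" using x edge by auto
          then have "split_at t q" unfolding split_at_def using edge px by auto
          then show False using less.prems q by blast
        qed
        then have pa: "pos a = t - 1" and a: "a \<in> path_verts q - S" using edge px by auto
        have "pos a > 0" using zero[OF q a] .
        then have t2: "t \<ge> 2" using pa by simp
        have only': "q' = q \<and> y = a" if "q' \<in> Q" "y \<in> path_verts q' - S" "pos y = t - 1" for q' y
          using pos_eq[OF that(1) q that(2) a] that pa by simp
        \<comment> \<open>A path split at \<open>t - 2\<close> owns position \<open>t - 1\<close>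
          and is therefore \<open>q\<close>, but both outside vertices of \<open>q\<close> lie after
          \<open>t - 2\<close>.\<close>
        have "\<not> split_at (t - 2) q'" if "q' \<in> Q" for q'
        proof
          assume s: "split_at (t - 2) q'"
          from that show False
          proof (cases rule: path_cases)
            case e': (edge c d)
            with s t2 have "pos d = t - 1" unfolding split_at_def by auto
            with only'[OF that, of d] e' have "q' = q" by auto
            then show False using s t2 pa px edge \<open>x = b\<close> unfolding split_at_def by auto
          qed (use s in \<open>auto simp: split_at_def\<close>)
        qed
        then have "reached Q (t - 2)" using less.IH[of "t - 2"] t2 by simp
        then show ?thesis
        proof (rule reached_whole[OF q _ _ x])
          show "t - 2 < pos y \<and> pos y \<le> t" if "y \<in> path_verts q - S" for y
            using that edge pa px t2 \<open>x = b\<close> by auto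
          have "q' = q" if "q' \<in> Q" "y \<in> path_verts q' - S" "t - 2 < pos y" "pos y \<le> t" for y q'
          proof -
            have "pos y = t \<or> pos y = t - 1" using that by linarith
            then show ?thesis using only[OF that(1,2)] only'[OF that(1,2)] by blast
          qed
          then show "\<forall>q'\<in>Q. \<forall>y\<in>path_verts q' - S. t - 2 < pos y \<longrightarrow> pos y \<le> t \<longrightarrow> q' = q" by blast
        qed (use t2 in simp)
      qed
    qed
  qed
qed

text \<open>After position \<open>n\<close> every path with an outside vertex is complete. The paths
  inside \<open>S\<close> are then inserted one by one; they may exceed the weight bound, but
  without the value 4 every state is valid.\<close>

lemma reach_full: "\<exists>f. reach f \<and> f (Suc n) = k"
proof -
  define Q0 where "Q0 = {q\<in>Q. path_verts q \<subseteq> S}"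
  have fQ: "finite Q" using packing_finite[OF Q] .
  have le: "pos x \<le> n" if "q \<in> Q" "x \<in> path_verts q" for q x
    using pos_le is_P2_less[OF simple packing_is_P2[OF Q that(1)] that(2)] by blast
  have fin: "finished n q \<longleftrightarrow> q \<notin> Q0" "\<not> half n q" "\<not> split_at n q" if "q \<in> Q" for q
    using le[OF that] that by (auto simp: finished_def Q0_def split_at_def not_less) (cases q; auto)
  have "reached Q n" using reached_all fin by blast
  then obtain f where f: "reach f" "\<And>x. x < n \<Longrightarrow> f x = owed Q n x" "f (Suc n) = card {q\<in>Q. finished n q}"
    unfolding reached_def by blast
  have "finite Q0" using fQ by (simp add: Q0_def)
  \<comment> \<open>Induction on the set \<open>A\<close> of inner paths already inserted; the exact
    values 0 and 1 show that the next path is still free.\<close>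
  have "\<exists>f. reach f \<and> (\<forall>x<n. f x = (if x \<in> S \<and> x \<in> verts (Q - Q0 \<union> A) then 1 else 0)) \<and>
      f (Suc n) = card (Q - Q0) + card A" if "A \<subseteq> Q0" for A
    using finite_subset[OF that \<open>finite Q0\<close>] that
  proof (induction A rule: finite_induct)
    case empty
    have "owed Q n x = (if x \<in> S \<and> x \<in> verts (Q - Q0) then 1 else 0)" for x
      unfolding owed_def verts_def using fin by auto
    moreover have "{q\<in>Q. finished n q} = Q - Q0" using fin by auto
    ultimately show ?case using f by (intro exI[of _ f]) simp
  next
    case (insert q A)
    then obtain g where g: "reach g" "\<And>x. x < n \<Longrightarrow> g x = (if x \<in> S \<and> x \<in> verts (Q - Q0 \<union> A) then 1 else 0)"
      "g (Suc n) = card (Q - Q0) + card A" by blast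
    have q: "q \<in> Q" "path_verts q \<subseteq> S" using insert by (auto simp: Q0_def)
    obtain u v w where uvw: "q = (u, v, w)" by (cases q)
    have P2: "is_P2 G q" using packing_is_P2[OF Q q(1)] .
    have lt: "u < n" "v < n" "w < n" using is_P2_less[OF simple P2] by (auto simp: uvw)
    have av: "avail g z" if "z \<in> path_verts q" for z
    proof -
      have "z \<notin> verts (Q - Q0 \<union> A)"
      proof
        assume "z \<in> verts (Q - Q0 \<union> A)"
        then obtain q' where "q' \<in> Q - Q0 \<union> A" "z \<in> path_verts q'" by (auto simp: verts_def)
        moreover from this have "q' \<in> Q" using insert.prems by (auto simp: Q0_def)
        ultimately have "q' = q" using packing_unique[OF Q _ q(1) _ that] by blast
        with \<open>q' \<in> Q - Q0 \<union> A\<close> show False using insert by blast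
      qed
      then show ?thesis using g(2) that q S_less by (auto simp: avail_def)
    qed
    have move: "move g (take_path u v w g)" using P2 av by (intro move.Whole) (auto simp: uvw)
    have S3: "u \<in> S" "v \<in> S" "w \<in> S" using q by (auto simp: uvw)
    have vals: "take_path u v w g x = (if x \<in> S \<and> x \<in> verts (Q - Q0 \<union> insert q A) then 1 else 0)" if "x < n" for x
      using that g(2)[OF that] S3 pos0[OF that] by (auto simp: take_path_apply[OF lt] verts_def uvw)
    then have "valid (take_path u v w g)" unfolding valid_def by auto
    then have "reach (take_path u v w g)" using reach.Step g(1) move by blast
    then show ?case using vals g(3) insert
      by (intro exI[of _ "take_path u v w g"]) (simp add: take_path_apply[OF lt])
  qed
  from this[of Q0] obtain f where "reach f" "f (Suc n) = card (Q - Q0) + card Q0" by blast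
  moreover have "card (Q - Q0) + card Q0 = card Q"
    using card_Diff_subset[of Q0 Q] card_mono[of Q Q0] fQ by (auto simp: Q0_def)
  ultimately show ?thesis using cQ by auto
qed

end

theorem has_P2_packing_iff_reach:
  "has_P2_packing G k \<longleftrightarrow> (\<exists>f. reach f \<and> k \<le> f (Suc n))"
proof
  assume "has_P2_packing G k"
  then obtain Q where Q: "packing G Q" "card Q = k" by (auto simp: has_P2_packing_iff)
  obtain Q' where "packing G Q'" "card Q' = k" "\<And>p. p \<in> P \<Longrightarrow> 2 \<le> card (path_verts p \<inter> verts Q')"
    using packing_overlap[OF packP Q(1)] small Q(2) by auto
  from reach_full[OF this] show "\<exists>f. reach f \<and> k \<le> f (Suc n)" by auto
next
  assume "\<exists>f. reach f \<and> k \<le> f (Suc n)"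
  then show "has_P2_packing G k"
    using sane_reach sane_count has_P2_packing_mono by blast
qed

end

section \<open>An intermediate language\<close>

text \<open>Variables and arrays are interleaved in the machine cells from a base address on, which is kept
  in cell 0; \<open>In i\<close> is the input cell \<open>i + 2\<close>, which is only read.\<close>

datatype var = Verts | Param | Dim | Base | Budget | Count | U | V | W | L | M | Temp | Code
  | Weight | Open | Head | Tail | Answer

datatype arr = Row | Mark | Pos | Cur | Queue | Seen

datatype loc = X var | Y arr nat | In nat

type_synonym state = "loc \<Rightarrow> nat"

datatype hexp = Lit nat | Var var | Arr arr hexp | Inp hexp | Plus hexp hexp | Minus hexp hexp

datatype hcom = HSkip | SetV var hexp | SetA arr hexp hexp | HSeq hcom hcom
  | HIf hexp hcom hcom | HWhile hexp hcom

fun hval :: "hexp \<Rightarrow> state \<Rightarrow> nat" where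
  "hval (Lit c) s = c"
| "hval (Var x) s = s (X x)"
| "hval (Arr a e) s = s (Y a (hval e s))"
| "hval (Inp e) s = s (In (hval e s))"
| "hval (Plus a b) s = hval a s + hval b s"
| "hval (Minus a b) s = hval a s - hval b s"

definition holds :: "hexp \<Rightarrow> state \<Rightarrow> bool" where
  "holds b s \<longleftrightarrow> hval b s \<noteq> 0"

text \<open>\<open>hrun m N c s t s'\<close>: \<open>c\<close> leads from \<open>s\<close> to \<open>s'\<close> in \<open>t\<close> steps without producing numbers above \<open>m\<close>
  or reading input cells from \<open>N\<close> on.\<close>

fun fits :: "nat \<Rightarrow> nat \<Rightarrow> hexp \<Rightarrow> state \<Rightarrow> bool" where
  "fits m N (Lit c) s \<longleftrightarrow> c \<le> m"
| "fits m N (Var x) s \<longleftrightarrow> True"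
| "fits m N (Arr a e) s \<longleftrightarrow> fits m N e s"
| "fits m N (Inp e) s \<longleftrightarrow> fits m N e s \<and> hval e s < N"
| "fits m N (Plus a b) s \<longleftrightarrow> fits m N a s \<and> fits m N b s \<and> hval a s + hval b s \<le> m"
| "fits m N (Minus a b) s \<longleftrightarrow> fits m N a s \<and> fits m N b s"

inductive hrun :: "nat \<Rightarrow> nat \<Rightarrow> hcom \<Rightarrow> state \<Rightarrow> nat \<Rightarrow> state \<Rightarrow> bool" for m N where
  HSkip: "hrun m N HSkip s 1 s"
| SetV: "fits m N e s \<Longrightarrow> hrun m N (SetV x e) s 1 (s(X x := hval e s))"
| SetA: "fits m N i s \<Longrightarrow> fits m N e s \<Longrightarrow> hrun m N (SetA a i e) s 1 (s(Y a (hval i s) := hval e s))"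
| HSeq: "hrun m N c1 s t1 s1 \<Longrightarrow> hrun m N c2 s1 t2 s2 \<Longrightarrow> hrun m N (HSeq c1 c2) s (t1 + t2) s2"
| IfTrue: "fits m N b s \<Longrightarrow> holds b s \<Longrightarrow> hrun m N c1 s t s1 \<Longrightarrow> hrun m N (HIf b c1 c2) s (t + 1) s1"
| IfFalse: "fits m N b s \<Longrightarrow> \<not> holds b s \<Longrightarrow> hrun m N c2 s t s1 \<Longrightarrow> hrun m N (HIf b c1 c2) s (t + 1) s1"
| WhileFalse: "fits m N b s \<Longrightarrow> \<not> holds b s \<Longrightarrow> hrun m N (HWhile b c) s 1 s"
| WhileTrue: "fits m N b s \<Longrightarrow> holds b s \<Longrightarrow> hrun m N c s t1 s1 \<Longrightarrow> hrun m N (HWhile b c) s1 t2 s2 \<Longrightarrow>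
    hrun m N (HWhile b c) s (1 + t1 + t2) s2"

section \<open>Memory layout and compilation\<close>

primrec var_index :: "var \<Rightarrow> nat" where
  "var_index Verts = 0" | "var_index Param = 1" | "var_index Dim = 2" | "var_index Base = 3"
| "var_index Budget = 4" | "var_index Count = 5" | "var_index U = 6" | "var_index V = 7"
| "var_index W = 8" | "var_index L = 9" | "var_index M = 10" | "var_index Temp = 11"
| "var_index Code = 12" | "var_index Weight = 13" | "var_index Open = 14" | "var_index Head = 15"
| "var_index Tail = 16" | "var_index Answer = 17"

primrec arr_index :: "arr \<Rightarrow> nat" where
  "arr_index Row = 1" | "arr_index Mark = 2" | "arr_index Pos = 3" | "arr_index Cur = 4"
| "arr_index Queue = 5" | "arr_index Seen = 6"

text \<open>Relative to the base, residue 0 modulo 8 belongs to the variables and the residues 1 to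
  6 to the arrays, so that six unbounded arrays coexist without overlap. The factor 8 is chosen
  because three doublings replace the multiplication.\<close>

fun address :: "nat \<Rightarrow> loc \<Rightarrow> nat" where
  "address B (X x) = B + 8 * var_index x"
| "address B (Y a i) = B + (arr_index a + 8 * i)"
| "address B (In i) = 2 + i"

definition times8 :: "aexp \<Rightarrow> aexp" where
  "times8 e = (let e2 = Add e e; e4 = Add e2 e2 in Add e4 e4)"

definition var_addr :: "var \<Rightarrow> aexp" where
  "var_addr x = Add (Cell (Num 0)) (Num (8 * var_index x))"

definition arr_addr :: "arr \<Rightarrow> aexp \<Rightarrow> aexp" where
  "arr_addr a e = Add (Cell (Num 0)) (Add (Num (arr_index a)) (times8 e))"

fun compile_exp :: "hexp \<Rightarrow> aexp" where
  "compile_exp (Lit c) = Num c"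
| "compile_exp (Var x) = Cell (var_addr x)"
| "compile_exp (Arr a e) = Cell (arr_addr a (compile_exp e))"
| "compile_exp (Inp e) = Cell (Add (Num 2) (compile_exp e))"
| "compile_exp (Plus a b) = Add (compile_exp a) (compile_exp b)"
| "compile_exp (Minus a b) = Sub (compile_exp a) (compile_exp b)"

fun compile :: "hcom \<Rightarrow> com" where
  "compile HSkip = Skip"
| "compile (SetV x e) = Store (var_addr x) (compile_exp e)"
| "compile (SetA a i e) = Store (arr_addr a (compile_exp i)) (compile_exp e)"
| "compile (HSeq c1 c2) = Seq (compile c1) (compile c2)"
| "compile (HIf b c1 c2) = Cond (compile_exp b) (compile c1) (compile c2)"
| "compile (HWhile b c) = While (compile_exp b) (compile c)"

text \<open>The bound \<open>m\<close> on all contents belongs to the relation because it controls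
  the length of every number accessed. \<open>N + 3 \<le> B\<close> keeps the input cells, whose
  last address is \<open>N + 1\<close>, apart from the variables.\<close>

definition represents :: "nat \<Rightarrow> nat \<Rightarrow> nat \<Rightarrow> state \<Rightarrow> mem \<Rightarrow> bool" where
  "represents B m N s \<sigma> \<longleftrightarrow> N + 3 \<le> B \<and> \<sigma> 0 = B \<and>
    (\<forall>x. \<sigma> (address B (X x)) = s (X x) \<and> s (X x) \<le> m) \<and>
    (\<forall>a i. \<sigma> (address B (Y a i)) = s (Y a i) \<and> s (Y a i) \<le> m) \<and>
    (\<forall>i<N. \<sigma> (address B (In i)) = s (In i) \<and> s (In i) \<le> m)"

text \<open>The number of lengths that \<open>acost\<close> charges for one evaluation; the values
  themselves are bounded separately.\<close>

fun exp_size :: "aexp \<Rightarrow> nat" where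
  "exp_size (Num n) = 1"
| "exp_size (Cell a) = exp_size a + 2"
| "exp_size (Add a b) = exp_size a + exp_size b + 2"
| "exp_size (Sub a b) = exp_size a + exp_size b + 2"

fun com_size :: "com \<Rightarrow> nat" where
  "com_size Skip = 1"
| "com_size (Store a b) = exp_size a + exp_size b + 2"
| "com_size (Seq c1 c2) = com_size c1 + com_size c2"
| "com_size (Cond b c1 c2) = exp_size b + 1 + com_size c1 + com_size c2"
| "com_size (While b c) = exp_size b + 1 + com_size c"

fun below :: "nat \<Rightarrow> aexp \<Rightarrow> mem \<Rightarrow> bool" where
  "below K (Num n) s \<longleftrightarrow> n \<le> K"
| "below K (Cell a) s \<longleftrightarrow> below K a s \<and> s (aval a s) \<le> K"
| "below K (Add a b) s \<longleftrightarrow> below K a s \<and> below K b s \<and> aval a s + aval b s \<le> K"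
| "below K (Sub a b) s \<longleftrightarrow> below K a s \<and> below K b s"

section \<open>Correctness and cost of compiled code\<close>

lemma len_mono: "a \<le> b \<Longrightarrow> len a \<le> len b"
  unfolding len_def by (intro max.mono floorlog_mono order_refl)

lemma len_pos: "1 \<le> len a"
  by (simp add: len_def)

lemma below_aval: "below K a s \<Longrightarrow> aval a s \<le> K"
  by (induction a) auto

lemma below_acost: "below K a s \<Longrightarrow> acost a s \<le> exp_size a * len K"
proof (induction a)
  case (Num n)
  then show ?case by (simp add: len_mono)
next
  case (Cell a)
  have "len (aval a s) \<le> len K" "len (s (aval a s)) \<le> len K"
    using Cell.prems below_aval by (auto intro: len_mono)
  then show ?case using Cell by (simp add: algebra_simps)
next
  case (Add a b)
  have "len (aval a s) \<le> len K" "len (aval b s) \<le> len K"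
    using Add.prems below_aval by (auto intro: len_mono)
  then show ?case using Add by (simp add: algebra_simps)
next
  case (Sub a b)
  have "len (aval a s) \<le> len K" "len (aval b s) \<le> len K"
    using Sub.prems below_aval by (auto intro: len_mono)
  then show ?case using Sub by (simp add: algebra_simps)
qed

lemma aval_times8 [simp]: "aval (times8 e) s = 8 * aval e s"
  by (simp add: times8_def Let_def)

lemma below_times8 [simp]: "below K (times8 e) s \<longleftrightarrow> below K e s \<and> 8 * aval e s \<le> K"
  by (auto simp: times8_def Let_def)

lemma var_index_inj: "var_index x = var_index y \<longleftrightarrow> x = y"
  by (cases x; cases y; simp)

lemma var_index_le: "var_index x \<le> 17"
  by (cases x) simp_all

lemma arr_index_inj: "arr_index a = arr_index b \<longleftrightarrow> a = b"
  by (cases a; cases b; simp)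

lemma arr_index_bounds: "1 \<le> arr_index a" "arr_index a \<le> 6"
  by (cases a; simp)+

text \<open>A bound for all addresses and intermediate values: a variable lies at most 8 * 17 = 136
  cells beyond the base, an array cell at most 6 + 8 m.\<close>

definition max_cell :: "nat \<Rightarrow> nat \<Rightarrow> nat" where
  "max_cell B m = B + 8 * m + 200"

context
  fixes B m N s \<sigma>
  assumes rep: "represents B m N s \<sigma>"
begin

lemma rep_base: "\<sigma> 0 = B" "N + 3 \<le> B"
  using rep by (auto simp: represents_def)

lemma compile_exp_correct:
  "fits m N e s \<Longrightarrow> aval (compile_exp e) \<sigma> = hval e s \<and> hval e s \<le> m \<and> below (max_cell B m) (compile_exp e) \<sigma>"
proof (induction e)
  case (Var x)
  have "\<sigma> (B + 8 * var_index x) = s (X x)" "s (X x) \<le> m" using rep by (auto simp: represents_def)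
  then show ?case using rep_base var_index_le[of x] by (simp add: max_cell_def var_addr_def)
next
  case (Arr a e)
  then have *: "aval (compile_exp e) \<sigma> = hval e s" "hval e s \<le> m" "below (max_cell B m) (compile_exp e) \<sigma>"
    by auto
  have "\<sigma> (B + (arr_index a + 8 * hval e s)) = s (Y a (hval e s))" "s (Y a (hval e s)) \<le> m"
    using rep by (auto simp: represents_def)
  then show ?case using * rep_base arr_index_bounds(2)[of a]
    by (simp add: max_cell_def arr_addr_def)
next
  case (Inp e)
  then have *: "aval (compile_exp e) \<sigma> = hval e s" "hval e s \<le> m" "hval e s < N"
    "below (max_cell B m) (compile_exp e) \<sigma>" by auto
  have "\<sigma> (Suc (Suc (hval e s))) = s (In (hval e s))" "s (In (hval e s)) \<le> m"
    using rep *(3) by (auto simp: represents_def)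
  then show ?case using * by (simp add: max_cell_def)
qed (auto simp: max_cell_def)

lemma var_addr_correct:
  "aval (var_addr x) \<sigma> = address B (X x)" "below (max_cell B m) (var_addr x) \<sigma>"
  using rep_base var_index_le[of x] by (simp_all add: max_cell_def var_addr_def)

lemma arr_addr_correct:
  assumes "fits m N e s"
  shows "aval (arr_addr a (compile_exp e)) \<sigma> = address B (Y a (hval e s))"
    "below (max_cell B m) (arr_addr a (compile_exp e)) \<sigma>"
  using compile_exp_correct[OF assms] rep_base arr_index_bounds(2)[of a]
  by (simp_all add: max_cell_def arr_addr_def)

lemma represents_SetV:
  assumes "v \<le> m"
  shows "represents B m N (s(X x := v)) (\<sigma>(address B (X x) := v))"
proof -
  have "address B (Y a i) \<noteq> address B (X x)" for a i
    using arr_index_bounds[of a] by simp presburger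
  moreover have "address B (In i) \<noteq> address B (X x)" if "i < N" for i
    using that rep_base by simp
  moreover have "address B (X y) = address B (X x) \<longleftrightarrow> y = x" for y
    by (simp add: var_index_inj)
  ultimately show ?thesis using rep assms unfolding represents_def by auto
qed

lemma represents_SetA:
  assumes "v \<le> m"
  shows "represents B m N (s(Y a i := v)) (\<sigma>(address B (Y a i) := v))"
proof -
  have "address B (X x) \<noteq> address B (Y a i)" for x
    using arr_index_bounds[of a] by simp presburger
  moreover have "address B (In j) \<noteq> address B (Y a i)" if "j < N" for j
    using that rep_base by simp
  moreover have "address B (Y b j) = address B (Y a i) \<longleftrightarrow> b = a \<and> j = i" for b j
  proof -
    have "arr_index b + 8 * j = arr_index a + 8 * i \<longleftrightarrow> arr_index b = arr_index a \<and> j = i"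
      using arr_index_bounds[of a] arr_index_bounds[of b] by presburger
    then show ?thesis by (simp add: arr_index_inj)
  qed
  ultimately show ?thesis using rep assms unfolding represents_def by auto
qed

lemma guard_cost:
  assumes "fits m N b s"
  shows "acost (compile_exp b) \<sigma> + len (aval (compile_exp b) \<sigma>) \<le> (exp_size (compile_exp b) + 1) * len (max_cell B m)"
proof -
  have "below (max_cell B m) (compile_exp b) \<sigma>" using compile_exp_correct[OF assms] by simp
  from below_acost[OF this] len_mono[OF below_aval[OF this]] show ?thesis by simp
qed

end

lemma store_cost:
  assumes "below K a \<sigma>" "below K b \<sigma>"
  shows "acost a \<sigma> + acost b \<sigma> + len (aval a \<sigma>) + len (aval b \<sigma>) \<le> com_size (Store a b) * len K"
  using below_acost[OF assms(1)] below_acost[OF assms(2)]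
    len_mono[OF below_aval[OF assms(1)]] len_mono[OF below_aval[OF assms(2)]]
  by (simp add: algebra_simps)

text \<open>Each step of the intermediate program evaluates a bounded number of expressions
  occurring in the text, so the size of the whole text, times the largest length, pays for it.
  Repetition in loops is already counted by \<open>t\<close>.\<close>

theorem compile_correct:
  assumes "hrun m N c s t s'" "represents B m N s \<sigma>"
  shows "\<exists>t' \<sigma>'. exec (compile c) \<sigma> t' \<sigma>' \<and> represents B m N s' \<sigma>' \<and>
    t' \<le> t * (com_size (compile c) * len (max_cell B m))"
  using assms
proof (induction arbitrary: \<sigma> rule: hrun.induct)
  case (HSkip s)
  then show ?case using exec.Skip[of \<sigma>] len_pos by fastforce
next
  case (SetV e s x)
  have e: "aval (compile_exp e) \<sigma> = hval e s" "hval e s \<le> m" "below (max_cell B m) (compile_exp e) \<sigma>"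
    using compile_exp_correct[OF SetV.prems SetV.hyps] by auto
  note x = var_addr_correct[OF SetV.prems, of x]
  have "exec (compile (SetV x e)) \<sigma> (acost (var_addr x) \<sigma> + acost (compile_exp e) \<sigma> +
      len (aval (var_addr x) \<sigma>) + len (aval (compile_exp e) \<sigma>)) (\<sigma>(address B (X x) := hval e s))"
    using exec.Store[of "var_addr x" "compile_exp e" \<sigma>] x(1) e(1) by simp
  moreover have "compile (SetV x e) = Store (var_addr x) (compile_exp e)" by simp
  ultimately show ?case
    using store_cost[OF x(2) e(3)] represents_SetV[OF SetV.prems e(2), of x] by (metis mult_1)
next
  case (SetA i s e a)
  have e: "aval (compile_exp e) \<sigma> = hval e s" "hval e s \<le> m" "below (max_cell B m) (compile_exp e) \<sigma>"
    using compile_exp_correct[OF SetA.prems SetA.hyps(2)] by auto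
  note x = arr_addr_correct[OF SetA.prems SetA.hyps(1), of a]
  have "exec (compile (SetA a i e)) \<sigma> (acost (arr_addr a (compile_exp i)) \<sigma> + acost (compile_exp e) \<sigma> +
      len (aval (arr_addr a (compile_exp i)) \<sigma>) + len (aval (compile_exp e) \<sigma>))
      (\<sigma>(address B (Y a (hval i s)) := hval e s))"
    using exec.Store[of "arr_addr a (compile_exp i)" "compile_exp e" \<sigma>] x(1) e(1) by simp
  moreover have "compile (SetA a i e) = Store (arr_addr a (compile_exp i)) (compile_exp e)" by simp
  ultimately show ?case
    using store_cost[OF x(2) e(3)] represents_SetA[OF SetA.prems e(2), of a "hval i s"] by (metis mult_1)
next
  case (HSeq c1 s t1 s1 c2 t2 s2)
  obtain u1 \<sigma>1 where 1: "exec (compile c1) \<sigma> u1 \<sigma>1" "represents B m N s1 \<sigma>1"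
    "u1 \<le> t1 * (com_size (compile c1) * len (max_cell B m))" using HSeq by blast
  obtain u2 \<sigma>2 where 2: "exec (compile c2) \<sigma>1 u2 \<sigma>2" "represents B m N s2 \<sigma>2"
    "u2 \<le> t2 * (com_size (compile c2) * len (max_cell B m))" using HSeq 1 by blast
  show ?case using exec.Seq[OF 1(1) 2(1)] 2(2) 1(3) 2(3)
    by (intro exI[of _ "u1 + u2"] exI[of _ \<sigma>2]) (simp add: algebra_simps)
next
  case (IfTrue b s c1 t s1 c2)
  note b = compile_exp_correct[OF IfTrue.prems IfTrue.hyps(1)]
  obtain u \<sigma>1 where 1: "exec (compile c1) \<sigma> u \<sigma>1" "represents B m N s1 \<sigma>1"
    "u \<le> t * (com_size (compile c1) * len (max_cell B m))" using IfTrue by blast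
  have "aval (compile_exp b) \<sigma> \<noteq> 0" using b IfTrue.hyps(2) by (simp add: holds_def)
  from exec.CondTrue[OF this 1(1)] 1(2,3) guard_cost[OF IfTrue.prems IfTrue.hyps(1)]
  show ?case
    by (intro exI[of _ \<sigma>1] exI[of _ "acost (compile_exp b) \<sigma> + len (aval (compile_exp b) \<sigma>) + u"])
      (simp add: algebra_simps)
next
  case (IfFalse b s c2 t s1 c1)
  note b = compile_exp_correct[OF IfFalse.prems IfFalse.hyps(1)]
  obtain u \<sigma>1 where 1: "exec (compile c2) \<sigma> u \<sigma>1" "represents B m N s1 \<sigma>1"
    "u \<le> t * (com_size (compile c2) * len (max_cell B m))" using IfFalse by blast
  have "aval (compile_exp b) \<sigma> = 0" using b IfFalse.hyps(2) by (simp add: holds_def)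
  from exec.CondFalse[OF this 1(1)] 1(2,3) guard_cost[OF IfFalse.prems IfFalse.hyps(1)]
  show ?case
    by (intro exI[of _ \<sigma>1] exI[of _ "acost (compile_exp b) \<sigma> + len (aval (compile_exp b) \<sigma>) + u"])
      (simp add: algebra_simps)
next
  case (WhileFalse b s c)
  have "aval (compile_exp b) \<sigma> = 0"
    using compile_exp_correct[OF WhileFalse.prems WhileFalse.hyps(1)] WhileFalse.hyps(2) by (simp add: holds_def)
  from exec.WhileFalse[OF this] WhileFalse.prems guard_cost[OF WhileFalse.prems WhileFalse.hyps(1)]
  show ?case
    by (intro exI[of _ \<sigma>] exI[of _ "acost (compile_exp b) \<sigma> + len (aval (compile_exp b) \<sigma>)"])
      (simp add: algebra_simps)
next
  case (WhileTrue b s c t1 s1 t2 s2)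
  obtain u1 \<sigma>1 where 1: "exec (compile c) \<sigma> u1 \<sigma>1" "represents B m N s1 \<sigma>1"
    "u1 \<le> t1 * (com_size (compile c) * len (max_cell B m))" using WhileTrue by blast
  obtain u2 \<sigma>2 where 2: "exec (compile (HWhile b c)) \<sigma>1 u2 \<sigma>2" "represents B m N s2 \<sigma>2"
    "u2 \<le> t2 * (com_size (compile (HWhile b c)) * len (max_cell B m))" using WhileTrue 1 by blast
  have nz: "aval (compile_exp b) \<sigma> \<noteq> 0"
    using compile_exp_correct[OF WhileTrue.prems WhileTrue.hyps(1)] WhileTrue.hyps(2) by (simp add: holds_def)
  have "acost (compile_exp b) \<sigma> + len (aval (compile_exp b) \<sigma>) + u1 + u2 \<le>
     (1 + t1 + t2) * (com_size (compile (HWhile b c)) * len (max_cell B m))"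
    using guard_cost[OF WhileTrue.prems WhileTrue.hyps(1)] 1(3) 2(3) by (simp add: algebra_simps)
  then show ?case using exec.WhileTrue[OF nz 1(1)] 2(1,2) by auto
qed

subsection \<open>Program logic\<close>

text \<open>Total correctness with a time bound. The initial state is an argument and not described
  by a precondition, so postconditions can refer to it directly.\<close>

definition ht :: "nat \<Rightarrow> nat \<Rightarrow> hcom \<Rightarrow> state \<Rightarrow> nat \<Rightarrow> (state \<Rightarrow> bool) \<Rightarrow> bool" where
  "ht m N c s T Q \<longleftrightarrow> (\<exists>t s'. hrun m N c s t s' \<and> t \<le> T \<and> Q s')"

lemma ht_conseq:
  assumes "ht m N c s T P" "T \<le> T'" "\<And>s'. P s' \<Longrightarrow> Q s'"
  shows "ht m N c s T' Q"
  using assms unfolding ht_def by (meson le_trans)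

lemma ht_Seq:
  assumes "ht m N c1 s T1 P" "\<And>s'. P s' \<Longrightarrow> ht m N c2 s' T2 Q" "T1 + T2 \<le> T"
  shows "ht m N (HSeq c1 c2) s T Q"
proof -
  obtain t1 s1 where 1: "hrun m N c1 s t1 s1" "t1 \<le> T1" "P s1" using assms(1) by (auto simp: ht_def)
  obtain t2 s2 where 2: "hrun m N c2 s1 t2 s2" "t2 \<le> T2" "Q s2" using assms(2)[OF 1(3)] by (auto simp: ht_def)
  show ?thesis unfolding ht_def using hrun.HSeq[OF 1(1) 2(1)] 1 2 assms(3)
    by (intro exI[of _ "t1 + t2"] exI[of _ s2]) simp
qed

lemma ht_If:
  assumes "fits m N b s" "holds b s \<Longrightarrow> ht m N c1 s T Q" "\<not> holds b s \<Longrightarrow> ht m N c2 s T Q" "T + 1 \<le> T'"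
  shows "ht m N (HIf b c1 c2) s T' Q"
proof (cases "holds b s")
  case True
  then obtain t s' where "hrun m N c1 s t s'" "t \<le> T" "Q s'" using assms(2) by (auto simp: ht_def)
  then show ?thesis unfolding ht_def using hrun.IfTrue[OF assms(1) True] assms(4)
    by (intro exI[of _ "t + 1"] exI[of _ s']) simp
next
  case False
  then obtain t s' where "hrun m N c2 s t s'" "t \<le> T" "Q s'" using assms(3) by (auto simp: ht_def)
  then show ?thesis unfolding ht_def using hrun.IfFalse[OF assms(1) False] assms(4)
    by (intro exI[of _ "t + 1"] exI[of _ s']) simp
qed

text \<open>The invariant is indexed by the number of completed rounds. Since this index is below
  \<open>k\<close> whenever the guard holds, \<open>k\<close> yields termination and the time bound
  together; every test of the guard costs 1.\<close>

lemma ht_While: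
  assumes "I (0::nat) s"
    and "\<And>i s. I i s \<Longrightarrow> fits m N b s"
    and "\<And>i s. I i s \<Longrightarrow> holds b s \<Longrightarrow> i < k \<and> ht m N c s T (I (Suc i))"
    and "\<And>i s. I i s \<Longrightarrow> \<not> holds b s \<Longrightarrow> Q s"
  shows "ht m N (HWhile b c) s (1 + k * (T + 1)) Q"
proof -
  \<comment> \<open>Induction on the number of rounds left; when it is 0, the guard must be
    false.\<close>
  have "ht m N (HWhile b c) s (1 + d * (T + 1)) Q" if "I i s" "k - i = d" for i s d
    using that
  proof (induction d arbitrary: i s)
    case 0
    then have "\<not> holds b s" using assms(3)[of i s] by auto
    then show ?case unfolding ht_def using 0 assms(2,4) hrun.WhileFalse[of m N b s c]
      by (intro exI[of _ 1] exI[of _ s]) auto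
  next
    case (Suc d)
    show ?case
    proof (cases "holds b s")
      case True
      obtain t1 s1 where 1: "hrun m N c s t1 s1" "t1 \<le> T" "I (Suc i) s1"
        using assms(3)[OF Suc.prems(1) True] by (auto simp: ht_def)
      obtain t2 s2 where 2: "hrun m N (HWhile b c) s1 t2 s2" "t2 \<le> 1 + d * (T + 1)" "Q s2"
        using Suc.IH[OF 1(3)] Suc.prems(2) unfolding ht_def by (metis diff_Suc_1 diff_Suc_eq_diff_pred diff_commute)
      show ?thesis unfolding ht_def
        using hrun.WhileTrue[OF assms(2)[OF Suc.prems(1)] True 1(1) 2(1)] 1 2
        by (intro exI[of _ "1 + t1 + t2"] exI[of _ s2]) simp
    next
      case False
      then show ?thesis unfolding ht_def using Suc.prems assms(2,4) hrun.WhileFalse[of m N b s c]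
        by (intro exI[of _ 1] exI[of _ s]) auto
    qed
  qed
  from this[OF assms(1), of k] show ?thesis by simp
qed

text \<open>Weakest preconditions for code without loops. A loop gets the precondition
  \<open>False\<close> and is left to \<open>ht_While\<close>.\<close>

fun wps :: "nat \<Rightarrow> nat \<Rightarrow> hcom \<Rightarrow> (state \<Rightarrow> bool) \<Rightarrow> state \<Rightarrow> bool" where
  "wps m N HSkip Q s \<longleftrightarrow> Q s"
| "wps m N (SetV x e) Q s \<longleftrightarrow> fits m N e s \<and> Q (s(X x := hval e s))"
| "wps m N (SetA a i e) Q s \<longleftrightarrow> fits m N i s \<and> fits m N e s \<and> Q (s(Y a (hval i s) := hval e s))"
| "wps m N (HSeq c1 c2) Q s \<longleftrightarrow> wps m N c1 (wps m N c2 Q) s"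
| "wps m N (HIf b c1 c2) Q s \<longleftrightarrow> fits m N b s \<and> (if holds b s then wps m N c1 Q s else wps m N c2 Q s)"
| "wps m N (HWhile b c) Q s \<longleftrightarrow> False"

fun step_size :: "hcom \<Rightarrow> nat" where
  "step_size HSkip = 1"
| "step_size (SetV x e) = 1"
| "step_size (SetA a i e) = 1"
| "step_size (HSeq c1 c2) = step_size c1 + step_size c2"
| "step_size (HIf b c1 c2) = step_size c1 + step_size c2 + 1"
| "step_size (HWhile b c) = 0"

lemma ht_wps: "wps m N c Q s \<Longrightarrow> step_size c \<le> T \<Longrightarrow> ht m N c s T Q"
proof (induction c arbitrary: Q s T)
  case HSkip
  then show ?case unfolding ht_def using hrun.HSkip by (intro exI[of _ 1] exI[of _ s]) auto
next
  case (SetV x e)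
  then show ?case unfolding ht_def using hrun.SetV[of m N e s x] by fastforce
next
  case (SetA a i e)
  then show ?case unfolding ht_def using hrun.SetA[of m N i s e a] by fastforce
next
  case (HSeq c1 c2)
  show ?case
  proof (rule ht_Seq)
    show "ht m N c1 s (step_size c1) (wps m N c2 Q)" using HSeq by simp
    show "ht m N c2 s' (step_size c2) Q" if "wps m N c2 Q s'" for s' using that HSeq by simp
    show "step_size c1 + step_size c2 \<le> T" using HSeq by simp
  qed
next
  case (HIf b c1 c2)
  show ?case
  proof (rule ht_If)
    show "ht m N c1 s (step_size c1 + step_size c2) Q" if "holds b s" using that HIf by simp
    show "ht m N c2 s (step_size c1 + step_size c2) Q" if "\<not> holds b s" using that HIf by simp
  qed (use HIf in auto)
qed simp

text \<open>Logic by truncated subtraction: \<open>1 - a\<close> is nonzero exactly for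
  \<open>a = 0\<close>. A double negation normalises to 0 or 1, which makes the subtraction in the
  conjunction work.\<close>

definition hnot :: "hexp \<Rightarrow> hexp" where "hnot a = Minus (Lit 1) a"
definition hand :: "hexp \<Rightarrow> hexp \<Rightarrow> hexp" (infixr "&&" 65) where "a && b = Minus (hnot (hnot a)) (hnot b)"
definition hor :: "hexp \<Rightarrow> hexp \<Rightarrow> hexp" where "hor a b = hnot (hnot a && hnot b)"
definition hle :: "hexp \<Rightarrow> hexp \<Rightarrow> hexp" where "hle a b = hnot (Minus a b)"
definition hlt :: "hexp \<Rightarrow> hexp \<Rightarrow> hexp" where "hlt a b = Minus b a"
definition heq :: "hexp \<Rightarrow> hexp \<Rightarrow> hexp" where "heq a b = (hle a b && hle b a)"

lemma holds_simps [simp]: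
  "holds (hnot a) s \<longleftrightarrow> \<not> holds a s"
  "holds (a && b) s \<longleftrightarrow> holds a s \<and> holds b s"
  "holds (hor a b) s \<longleftrightarrow> holds a s \<or> holds b s"
  "holds (hle a b) s \<longleftrightarrow> hval a s \<le> hval b s"
  "holds (hlt a b) s \<longleftrightarrow> hval a s < hval b s"
  "holds (heq a b) s \<longleftrightarrow> hval a s = hval b s"
  "holds (Inp a) s \<longleftrightarrow> s (In (hval a s)) \<noteq> 0"
  by (auto simp: holds_def hnot_def hand_def hor_def hle_def hlt_def heq_def)

lemma fits_simps [simp]:
  "1 \<le> m \<Longrightarrow> fits m N (hnot a) s \<longleftrightarrow> fits m N a s"
  "1 \<le> m \<Longrightarrow> fits m N (a && b) s \<longleftrightarrow> fits m N a s \<and> fits m N b s"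
  "1 \<le> m \<Longrightarrow> fits m N (hor a b) s \<longleftrightarrow> fits m N a s \<and> fits m N b s"
  "1 \<le> m \<Longrightarrow> fits m N (hle a b) s \<longleftrightarrow> fits m N a s \<and> fits m N b s"
  "fits m N (hlt a b) s \<longleftrightarrow> fits m N a s \<and> fits m N b s"
  "1 \<le> m \<Longrightarrow> fits m N (heq a b) s \<longleftrightarrow> fits m N a s \<and> fits m N b s"
  by (auto simp: hnot_def hand_def hor_def hle_def hlt_def heq_def)

section \<open>Counting loops\<close>

definition For :: "var \<Rightarrow> hexp \<Rightarrow> hcom \<Rightarrow> hcom" where
  "For x e c = HSeq (SetV x (Lit 0)) (HWhile (hlt (Var x) e) (HSeq c (SetV x (Plus (Var x) (Lit 1)))))"

text \<open>The invariant for the next round is required of the memory with the counter already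
  increased, so that it may itself speak about memory frames containing the counter. The two extra
  units per round pay for guard and increment.\<close>

lemma ht_For:
  assumes init: "I 0 (s(X x := 0))"
    and body: "\<And>i s. i < k \<Longrightarrow> I i s \<Longrightarrow> s (X x) = i \<Longrightarrow>
      ht m N c s T (\<lambda>s'. s' (X x) = i \<and> I (Suc i) (s'(X x := Suc i)))"
    and e: "\<And>i s. I i s \<Longrightarrow> fits m N e s \<and> hval e s = k"
    and post: "\<And>s. I k s \<Longrightarrow> Q s"
    and m: "k \<le> m" "1 \<le> m" and time: "2 + k * (T + 2) \<le> T'"
  shows "ht m N (For x e c) s T' Q"
  unfolding For_def
proof (rule ht_Seq)
  let ?J = "\<lambda>i s. s (X x) = i \<and> i \<le> k \<and> I i s"
  show "ht m N (SetV x (Lit 0)) s 1 (?J 0)" using init by (intro ht_wps) simp_all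
  show "ht m N (HWhile (hlt (Var x) e) (HSeq c (SetV x (Plus (Var x) (Lit 1))))) s' (1 + k * (T + 1 + 1)) Q"
    if "?J 0 s'" for s'
  proof (rule ht_While[where I = ?J])
    show "?J 0 s'" by fact
  next
    fix i s assume J: "?J i s"
    show "fits m N (hlt (Var x) e) s" using J e[of i s] by simp
    show "Q s" if "\<not> holds (hlt (Var x) e) s" using that J e post by (metis holds_simps(5) hval.simps(2) le_neq_implies_less)
    show "i < k \<and> ht m N (HSeq c (SetV x (Plus (Var x) (Lit 1)))) s (T + 1) (?J (Suc i))"
      if "holds (hlt (Var x) e) s"
    proof
      show i: "i < k" using that J e[of i s] by auto
      show "ht m N (HSeq c (SetV x (Plus (Var x) (Lit 1)))) s (T + 1) (?J (Suc i))"
      proof (rule ht_Seq)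
        show "ht m N c s T (\<lambda>s'. s' (X x) = i \<and> I (Suc i) (s'(X x := Suc i)))" using body i J by simp
        show "ht m N (SetV x (Plus (Var x) (Lit 1))) s' 1 (?J (Suc i))"
          if "s' (X x) = i \<and> I (Suc i) (s'(X x := Suc i))" for s'
          using that i m by (intro ht_wps) simp_all
      qed simp
    qed
  qed
qed (use time in simp)

text \<open>The invariant \<open>J q\<close> speaks about an object \<open>q\<close> that only grows during the loop, while the
  round \<open>i\<close> achieves the goal \<open>G i\<close> forever.\<close>

lemma ht_For_grow:
  assumes init: "J q0 s"
    and indep: "\<And>q s v. J q s \<Longrightarrow> J q (s(X x := v))"
    and body: "\<And>i q s. i < k \<Longrightarrow> J q s \<Longrightarrow> s (X x) = i \<Longrightarrow>
      ht m N c s T (\<lambda>s'. s' (X x) = i \<and> (\<exists>q'. le q q' \<and> J q' s' \<and> G i q'))"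
    and e: "\<And>q s. J q s \<Longrightarrow> fits m N e s \<and> hval e s = k"
    and le: "reflp le" "transp le" "\<And>i q q'. G i q \<Longrightarrow> le q q' \<Longrightarrow> G i q'"
    and post: "\<And>q s. le q0 q \<Longrightarrow> J q s \<Longrightarrow> \<forall>i<k. G i q \<Longrightarrow> Q s"
    and m: "k \<le> m" "1 \<le> m" and time: "2 + k * (T + 2) \<le> T'"
  shows "ht m N (For x e c) s T' Q"
proof (rule ht_For[where I = "\<lambda>i s. \<exists>q. le q0 q \<and> J q s \<and> (\<forall>i'<i. G i' q)"])
  show "\<exists>q. le q0 q \<and> J q (s(X x := 0)) \<and> (\<forall>i'<0. G i' q)"
    using init indep le(1) by (auto simp: reflp_def)
next
  fix i s assume i: "i < k" "s (X x) = i" and "\<exists>q. le q0 q \<and> J q s \<and> (\<forall>i'<i. G i' q)"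
  then obtain q where q: "le q0 q" "J q s" "\<forall>i'<i. G i' q" by blast
  show "ht m N c s T (\<lambda>s'. s' (X x) = i \<and> (\<exists>q. le q0 q \<and> J q (s'(X x := Suc i)) \<and> (\<forall>i'<Suc i. G i' q)))"
  proof (rule ht_conseq[OF body[OF i(1) q(2) i(2)] order_refl])
    fix s' assume "s' (X x) = i \<and> (\<exists>q'. le q q' \<and> J q' s' \<and> G i q')"
    then obtain q' where q': "s' (X x) = i" "le q q'" "J q' s'" "G i q'" by blast
    have "G i' q'" if "i' < Suc i" for i'
      using that q' q(3) le(3)[of i' q q'] by (cases "i' = i") auto
    moreover have "le q0 q'" using transpD[OF le(2) q(1) q'(2)] .
    ultimately show "s' (X x) = i \<and> (\<exists>q. le q0 q \<and> J q (s'(X x := Suc i)) \<and> (\<forall>i'<Suc i. G i' q))"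
      using q' indep by blast
  qed
qed (use e post m time in auto)

section \<open>The search program\<close>

text \<open>\<open>Row\<close> holds the multiples of the number of vertices, computed once, so that
  matrix entries are found without multiplication.\<close>

definition adj :: "hexp \<Rightarrow> hexp \<Rightarrow> hexp" where
  "adj x y = Inp (Plus (Arr Row x) y)"

definition load :: hcom where
  "load = For L (Var Dim) (SetA Cur (Var L) (Arr Queue (Plus (Var Head) (Var L))))"

text \<open>Horner's rule, where the inner loop multiplies by the base through repeated
  addition.\<close>

definition encode :: hcom where
  "encode = HSeq (SetV Code (Lit 0)) (For L (Var Dim)
     (HSeq (SetV Temp (Lit 0)) (HSeq (For M (Var Base) (SetV Temp (Plus (Var Temp) (Var Code))))
       (SetV Code (Plus (Var Temp) (Arr Cur (Var L)))))))"

definition weigh :: hcom where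
  "weigh = HSeq (SetV Weight (Lit 0)) (HSeq (SetV Open (Lit 0)) (For L (Var Verts)
     (HSeq (SetV Weight (Plus (Var Weight) (Arr Cur (Var L))))
       (HIf (heq (Arr Cur (Var L)) (Lit 4)) (SetV Open (Lit 1)) HSkip))))"

definition store :: hcom where
  "store = For L (Var Dim) (SetA Queue (Plus (Var Tail) (Var L)) (Arr Cur (Var L)))"

definition cur_count :: hexp where
  "cur_count = Arr Cur (Plus (Var Verts) (Lit 1))"

definition fresh :: hexp where
  "fresh = (hor (hle (Var Weight) (Var Budget)) (heq (Var Open) (Lit 0)) && heq (Arr Seen (Var Code)) (Lit 0))"

definition enter :: hcom where
  "enter = HSeq (SetA Seen (Var Code) (Lit 1)) (HSeq (SetV Tail (Plus (Var Tail) (Var Dim)))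
     (HIf (hle (Var Param) cur_count) (SetV Answer (Lit 1)) HSkip))"

definition push :: hcom where
  "push = HSeq encode (HSeq weigh (HIf fresh (HSeq store enter) HSkip))"

definition available :: "var \<Rightarrow> hexp" where
  "available x = hor (heq (Arr Pos (Var x)) (Lit 0) && heq (Arr Cur (Var x)) (Lit 0))
     (hlt (Arr Cur (Var Verts)) (Arr Pos (Var x)))"

definition grab :: "var \<Rightarrow> hcom" where
  "grab x = HIf (heq (Arr Pos (Var x)) (Lit 0)) (SetA Cur (Var x) (Lit 1))
     (HIf (hlt (Arr Cur (Var Verts)) (Arr Pos (Var x))) (SetA Cur (Var Verts) (Arr Pos (Var x))) HSkip)"

definition incr_count :: hcom where
  "incr_count = SetA Cur (Plus (Var Verts) (Lit 1)) (Plus cur_count (Lit 1))"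

text \<open>Every attempt reloads the state under expansion, since the preceding attempt may have
  overwritten \<open>Cur\<close>.\<close>

definition attempt :: "hexp \<Rightarrow> hcom \<Rightarrow> hcom" where
  "attempt g c = HSeq load (HIf g (HSeq c push) HSkip)"

definition whole :: hcom where
  "whole = attempt (adj (Var U) (Var V) && adj (Var V) (Var W) && hnot (heq (Var U) (Var W)) &&
       available U && available V && available W)
     (HSeq (grab U) (HSeq (grab V) (HSeq (grab W) incr_count)))"

definition first_half :: hcom where
  "first_half = attempt (adj (Var U) (Var W) && heq (Arr Pos (Var U)) (Lit 0) &&
       heq (Arr Cur (Var U)) (Lit 0) && hlt (Arr Cur (Var Verts)) (Arr Pos (Var W)))
     (HSeq (SetA Cur (Var U) (Lit 4)) (SetA Cur (Var Verts) (Arr Pos (Var W))))"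

definition second_half :: hcom where
  "second_half = attempt (adj (Var U) (Var W) && heq (Arr Cur (Var U)) (Lit 4) &&
       hlt (Arr Cur (Var Verts)) (Arr Pos (Var W)))
     (HSeq (SetA Cur (Var U) (Lit 1)) (HSeq (SetA Cur (Var Verts) (Arr Pos (Var W))) incr_count))"

definition expand :: hcom where
  "expand = For U (Var Verts) (For V (Var Verts) (For W (Var Verts)
     (HSeq whole (HSeq first_half second_half))))"

definition explore :: hcom where
  "explore = HWhile (hlt (Var Head) (Var Tail)) (HSeq expand (SetV Head (Plus (Var Head) (Var Dim))))"

section \<open>Memory frames and nested loops\<close>

definition frame :: "loc set \<Rightarrow> state \<Rightarrow> state \<Rightarrow> bool" where
  "frame A s s' \<longleftrightarrow> (\<forall>l. l \<notin> A \<longrightarrow> s' l = s l)"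

lemma frame_refl [simp]: "frame A s s"
  by (simp add: frame_def)

lemma frame_trans: "frame A s s1 \<Longrightarrow> frame A' s1 s2 \<Longrightarrow> A \<subseteq> B \<Longrightarrow> A' \<subseteq> B \<Longrightarrow> frame B s s2"
  unfolding frame_def by (metis subsetD)

lemma frame_upd [simp]: "l \<in> A \<Longrightarrow> frame A s (s'(l := v)) \<longleftrightarrow> frame A s s'"
  by (auto simp: frame_def)

definition keeps :: "state \<Rightarrow> state \<Rightarrow> bool" where
  "keeps s s' \<longleftrightarrow> (\<forall>x\<in>{U, V, W}. s' (X x) = s (X x))"

lemma keeps_trans: "keeps s s1 \<Longrightarrow> keeps s1 s2 \<Longrightarrow> keeps s s2"
  by (simp add: keeps_def)

text \<open>Each level of nesting raises the exponent by 1 and adds 4 to the constant.\<close>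

lemma loop_time:
  fixes n b :: nat
  assumes "n \<le> b" "1 \<le> b"
  shows "2 + n * (c * b ^ e + 2) \<le> (c + 4) * b ^ Suc e"
proof -
  have "n * (c * b ^ e + 2) \<le> b * (c * b ^ e + 2)" using assms(1) by (rule mult_le_mono1)
  moreover have "b \<le> b ^ Suc e" using assms(2) by simp
  moreover have "1 \<le> b ^ Suc e" using assms(2) by simp
  moreover have "b * (c * b ^ e + 2) = c * b ^ Suc e + 2 * b" "(c + 4) * b ^ Suc e = c * b ^ Suc e + 4 * b ^ Suc e"
    by (simp_all add: algebra_simps)
  ultimately show ?thesis by linarith
qed

lemma ht_For2:
  assumes init: "J q0 s" and xy: "x \<noteq> y"
    and indep: "\<And>z q s v. z \<in> {x, y} \<Longrightarrow> J q s \<Longrightarrow> J q (s(X z := v))"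
    and body: "\<And>i j q s. i < k \<Longrightarrow> j < k \<Longrightarrow> J q s \<Longrightarrow> s (X x) = i \<Longrightarrow> s (X y) = j \<Longrightarrow>
      ht m N c s (t * b ^ r) (\<lambda>s'. s' (X x) = i \<and> s' (X y) = j \<and> (\<exists>q'. le q q' \<and> J q' s' \<and> G i j q'))"
    and e: "\<And>q s. J q s \<Longrightarrow> fits m N e s \<and> hval e s = k"
    and le: "reflp le" "transp le" "\<And>i j q q'. G i j q \<Longrightarrow> le q q' \<Longrightarrow> G i j q'"
    and post: "\<And>q s. le q0 q \<Longrightarrow> J q s \<Longrightarrow> \<forall>i<k. \<forall>j<k. G i j q \<Longrightarrow> Q s"
    and m: "k \<le> m" "1 \<le> m" and b: "k \<le> b" "1 \<le> b" and time: "(t + 8) * b ^ (r + 2) \<le> T"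
  shows "ht m N (For x e (For y e c)) s T Q"
proof (rule ht_For_grow[where le = le and k = k and T = "(t + 4) * b ^ Suc r" and J = J and ?q0.0 = q0
      and G = "\<lambda>i q. \<forall>j<k. G i j q"])
  fix i q s assume i: "i < k" "J q s" "s (X x) = i"
  show "ht m N (For y e c) s ((t + 4) * b ^ Suc r)
    (\<lambda>s'. s' (X x) = i \<and> (\<exists>q'. le q q' \<and> J q' s' \<and> (\<forall>j<k. G i j q')))"
  \<comment> \<open>The inner loop must preserve the outer counter, so its invariant fixes that
    value.\<close>
  proof (rule ht_For_grow[where le = le and k = k and T = "t * b ^ r" and ?q0.0 = q and G = "G i"
        and J = "\<lambda>q s. J q s \<and> s (X x) = i"])
    fix j q s assume "j < k" "J q s \<and> s (X x) = i" "s (X y) = j"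
    then show "ht m N c s (t * b ^ r)
      (\<lambda>s'. s' (X y) = j \<and> (\<exists>q'. le q q' \<and> (J q' s' \<and> s' (X x) = i) \<and> G i j q'))"
      using i(1) by (intro ht_conseq[OF body[of i j q s] order_refl]) auto
  next
    show "2 + k * (t * b ^ r + 2) \<le> (t + 4) * b ^ Suc r" by (rule loop_time[OF b])
    show "G i j q'" if "G i j q" "le q q'" for j q q' using le(3) that by blast
    show "fits m N e s \<and> hval e s = k" if "J q s \<and> s (X x) = i" for q s using e that by blast
  qed (use i indep xy le(1,2) m in auto)
next
  have "2 + k * ((t + 4) * b ^ Suc r + 2) \<le> (t + 4 + 4) * b ^ Suc (Suc r)" by (rule loop_time[OF b])
  then show "2 + k * ((t + 4) * b ^ Suc r + 2) \<le> T" using time by (simp add: add.assoc)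
  show "\<forall>j<k. G i j q'" if "\<forall>j<k. G i j q" "le q q'" for i q q' using le(3) that by blast
  show "fits m N e s \<and> hval e s = k" if "J q s" for q s using e that by blast
qed (use init indep le(1,2) post m in auto)

lemma ht_For3:
  assumes init: "J q0 s" and xyz: "distinct [x, y, z]"
    and indep: "\<And>w q s v. w \<in> {x, y, z} \<Longrightarrow> J q s \<Longrightarrow> J q (s(X w := v))"
    and body: "\<And>i j l q s. i < k \<Longrightarrow> j < k \<Longrightarrow> l < k \<Longrightarrow> J q s \<Longrightarrow> s (X x) = i \<Longrightarrow> s (X y) = j \<Longrightarrow> s (X z) = l \<Longrightarrow>
      ht m N c s (t * b ^ r) (\<lambda>s'. s' (X x) = i \<and> s' (X y) = j \<and> s' (X z) = l \<and>
        (\<exists>q'. le q q' \<and> J q' s' \<and> G i j l q'))"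
    and e: "\<And>q s. J q s \<Longrightarrow> fits m N e s \<and> hval e s = k"
    and le: "reflp le" "transp le" "\<And>i j l q q'. G i j l q \<Longrightarrow> le q q' \<Longrightarrow> G i j l q'"
    and post: "\<And>q s. le q0 q \<Longrightarrow> J q s \<Longrightarrow> \<forall>i<k. \<forall>j<k. \<forall>l<k. G i j l q \<Longrightarrow> Q s"
    and m: "k \<le> m" "1 \<le> m" and b: "k \<le> b" "1 \<le> b" and time: "(t + 12) * b ^ (r + 3) \<le> T"
  shows "ht m N (For x e (For y e (For z e c))) s T Q"
proof (rule ht_For_grow[where le = le and k = k and T = "(t + 8) * b ^ (r + 2)" and J = J and ?q0.0 = q0
      and G = "\<lambda>i q. \<forall>j<k. \<forall>l<k. G i j l q"])
  fix i q s assume i: "i < k" "J q s" "s (X x) = i"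
  show "ht m N (For y e (For z e c)) s ((t + 8) * b ^ (r + 2))
    (\<lambda>s'. s' (X x) = i \<and> (\<exists>q'. le q q' \<and> J q' s' \<and> (\<forall>j<k. \<forall>l<k. G i j l q')))"
  proof (rule ht_For2[where le = le and k = k and t = t and b = b and r = r and ?q0.0 = q and G = "G i"
        and J = "\<lambda>q s. J q s \<and> s (X x) = i"])
    fix j l q s assume "j < k" "l < k" "J q s \<and> s (X x) = i" "s (X y) = j" "s (X z) = l"
    then show "ht m N c s (t * b ^ r) (\<lambda>s'. s' (X y) = j \<and> s' (X z) = l \<and>
      (\<exists>q'. le q q' \<and> (J q' s' \<and> s' (X x) = i) \<and> G i j l q'))"
      using i(1) by (intro ht_conseq[OF body[of i j l q s] order_refl]) auto
  next
    show "G i j l q'" if "G i j l q" "le q q'" for j l q q' using le(3) that by blast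
    show "fits m N e s \<and> hval e s = k" if "J q s \<and> s (X x) = i" for q s using e that by blast
  qed (use i indep xyz le(1,2) m b in auto)
next
  have "2 + k * ((t + 8) * b ^ (r + 2) + 2) \<le> (t + 8 + 4) * b ^ Suc (r + 2)" by (rule loop_time[OF b])
  then show "2 + k * ((t + 8) * b ^ (r + 2) + 2) \<le> T" using time by (simp add: add.assoc numeral_3_eq_3)
  show "\<forall>j<k. \<forall>l<k. G i j l q'" if "\<forall>j<k. \<forall>l<k. G i j l q" "le q q'" for i q q'
    using le(3) that by blast
  show "fits m N e s \<and> hval e s = k" if "J q s" for q s using e that by blast
qed (use init indep le(1,2) post m in auto)

lemma index_less: "u < n \<Longrightarrow> v < n \<Longrightarrow> u * n + v < n * (n::nat)"
proof -
  assume "u < n" "v < n"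
  then have "u * n + v < Suc u * n" by simp
  also have "\<dots> \<le> n * n" using \<open>u < n\<close> by (intro mult_le_mono1) simp
  finally show ?thesis .
qed

lemma adj_correct:
  assumes "s (Y Row u) = u * n" "s (In (u * n + v)) = (if {u, v} \<in> E then 1 else 0)" "s (X x) = u" "s (X y) = v"
    "u < n" "v < n" "n * n \<le> m"
  shows "fits m (n * n) (adj (Var x) (Var y)) s" "holds (adj (Var x) (Var y)) s \<longleftrightarrow> {u, v} \<in> E"
  using assms index_less[of u n v] by (auto simp: adj_def)

section \<open>Encoding states by numbers\<close>

fun horner :: "nat \<Rightarrow> (nat \<Rightarrow> nat) \<Rightarrow> nat \<Rightarrow> nat" where
  "horner b f 0 = 0"
| "horner b f (Suc l) = horner b f l * b + f l"

lemma horner_less: "(\<And>l. l < d \<Longrightarrow> f l < b) \<Longrightarrow> horner b f d < b ^ d"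
proof (induction d)
  case (Suc d)
  then have "horner b f d + 1 \<le> b ^ d" "f d < b" by (simp_all add: Suc_le_eq)
  then have "(horner b f d + 1) * b \<le> b ^ d * b" by (intro mult_right_mono) auto
  with \<open>f d < b\<close> show ?case by (simp add: algebra_simps)
qed simp

lemma horner_inj:
  assumes "horner b f d = horner b g d" "\<And>l. l < d \<Longrightarrow> f l < b \<and> g l < b" "l < d"
  shows "f l = g l"
  using assms
proof (induction d)
  case (Suc d)
  have "(horner b f d * b + f d) mod b = (horner b g d * b + g d) mod b"
    "(horner b f d * b + f d) div b = (horner b g d * b + g d) div b" using Suc.prems(1) by simp_all
  moreover have "f d < b" "g d < b" using Suc.prems(2) by auto
  ultimately have "f d = g d" "horner b f d = horner b g d" by simp_all
  then show ?case using Suc by (cases "l = d") auto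
qed simp

context path_search
begin

text \<open>The base exceeds all digits of a sane state: 4, and the two counters, which are at most
  \<open>n\<close>. There are \<open>n + 2\<close> digits.\<close>

definition b where "b = n + 5"
definition d where "d = n + 2"
abbreviation "code f \<equiv> horner b f d"

lemma b_bounds: "n + 5 = b" "5 \<le> b" "1 \<le> b" "d \<le> b" "n \<le> b" "5 * b \<le> b ^ 2"
proof -
  show *: "n + 5 = b" "5 \<le> b" "1 \<le> b" "d \<le> b" "n \<le> b" by (simp_all add: b_def d_def)
  show "5 * b \<le> b ^ 2" unfolding power2_eq_square by (rule mult_le_mono1[OF *(2)])
qed

lemma d_eq: "d = Suc (Suc n)" "n < d" "Suc n < d" "l < n \<Longrightarrow> l < d"
  by (simp_all add: d_def)

lemma sane_digit: "sane f \<Longrightarrow> l < d \<Longrightarrow> f l < b"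
proof -
  assume f: "sane f" "l < d"
  have "l < n \<Longrightarrow> f l \<in> {0, 1, 4}" "f n \<le> n" using f unfolding sane_def by blast+
  moreover have "f (Suc n) \<le> n" using sane_count_le[OF f(1)] .
  moreover have "l < n \<or> l = n \<or> l = Suc n" using f(2) by (auto simp: d_def)
  ultimately show ?thesis by (auto simp: b_def)
qed

lemma code_less: "sane f \<Longrightarrow> code f < b ^ d"
  using horner_less[of d f b] sane_digit by simp

lemma code_inj: "sane f \<Longrightarrow> sane g \<Longrightarrow> code f = code g \<Longrightarrow> f = g"
proof
  fix l assume *: "sane f" "sane g" "code f = code g"
  show "f l = g l"
  proof (cases "l < d")
    case True
    then show ?thesis using horner_inj[OF *(3)] * sane_digit by blast
  next
    case False
    then show ?thesis using *(1,2) unfolding sane_def by (simp add: d_eq)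
  qed
qed

text \<open>A crude bound that serves to limit the length of queue addresses; the running time rests
  on the finer count \<open>valid_count\<close>.\<close>

lemma card_valid_le: "card {f. sane f \<and> valid f} \<le> b ^ d"
proof -
  have "inj_on (\<lambda>f. code f) {f. sane f \<and> valid f}" using code_inj by (auto simp: inj_on_def)
  then have "card {f. sane f \<and> valid f} \<le> card {..<b ^ d}"
    by (rule card_inj_on_le) (use code_less in auto)
  then show ?thesis by simp
qed

lemma reach_valid: "reach f \<Longrightarrow> valid f"
  by (induction rule: reach.induct) (auto simp: valid_def)

end

text \<open>\<open>m\<close> has to accommodate the codes, which are indices of \<open>Seen\<close>,
  and the end of a queue that holds every valid state and has room for one more.\<close>

locale search_run = path_search +
  fixes m :: nat
  assumes m_code: "(nverts G + 5) ^ (nverts G + 2) \<le> m"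
    and m_queue: "(card {f. sane f \<and> valid f} + 1) * (nverts G + 2) \<le> m"
begin

abbreviation "hoare \<equiv> ht m (n * n)"

lemma m_power: "b ^ d \<le> m" "(card {f. sane f \<and> valid f} + 1) * d \<le> m"
  using m_code m_queue by (simp_all add: b_def d_def)

lemma m_bounds: "b * b \<le> m" "b \<le> m" "n * n \<le> m" "5 \<le> m" "1 \<le> m" "n \<le> m" "n * n + n \<le> m" "d \<le> m"
proof -
  have "b ^ 2 \<le> b ^ d" by (rule power_increasing) (simp_all add: b_def d_def)
  then show *: "b * b \<le> m" using m_power(1) by (simp add: power2_eq_square)
  have "n * n + n \<le> b * b" "b \<le> b * b" by (simp_all add: b_def algebra_simps)
  with * b_bounds show "b \<le> m" "n * n \<le> m" "5 \<le> m" "1 \<le> m" "n \<le> m" "n * n + n \<le> m" "d \<le> m"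
    by linarith+
qed

lemma m_Suc: "Suc n \<le> m"
  using m_bounds(2) b_bounds(1) by linarith

section \<open>The invariant of the worklist\<close>

definition env :: "state \<Rightarrow> bool" where
  "env s \<longleftrightarrow> s (X Verts) = n \<and> s (X Param) = k \<and> s (X Dim) = d \<and> s (X Base) = b \<and>
     s (X Budget) = 6 * k - 4 * card P \<and> (\<forall>u<n. s (Y Row u) = u * n) \<and> (\<forall>u<n. s (Y Pos u) = pos u) \<and>
     (\<forall>u<n. \<forall>v<n. s (In (u * n + v)) = (if {u, v} \<in> edges G then 1 else 0))"

definition cur_is :: "(nat \<Rightarrow> nat) \<Rightarrow> state \<Rightarrow> bool" where
  "cur_is f s \<longleftrightarrow> (\<forall>l<d. s (Y Cur l) = f l)"

text \<open>\<open>qs\<close> contains all states ever discovered, in order of discovery. Nothing is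
  removed; \<open>h\<close> merely counts those already expanded. Hence \<open>Seen\<close> can
  describe exactly the codes of \<open>qs\<close>.\<close>

definition worklist :: "nat \<Rightarrow> (nat \<Rightarrow> nat) list \<Rightarrow> state \<Rightarrow> bool" where
  "worklist h qs s \<longleftrightarrow> env s \<and> s (X Head) = h * d \<and> s (X Tail) = length qs * d \<and>
     (\<forall>i<length qs. \<forall>l<d. s (Y Queue (i * d + l)) = (qs ! i) l) \<and> distinct qs \<and> (\<forall>f\<in>set qs. reach f) \<and>
     (\<forall>c. s (Y Seen c) \<noteq> 0 \<longleftrightarrow> (\<exists>f\<in>set qs. code f = c)) \<and>
     s (X Answer) = (if \<exists>f\<in>set qs. k \<le> f (Suc n) then 1 else 0)"

definition scratch :: "loc set" where
  "scratch = {X L, X M, X Temp, X Code, X Weight, X Open} \<union> range (Y Cur)"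

lemma worklist_cong: "frame scratch s s' \<Longrightarrow> worklist h qs s \<Longrightarrow> worklist h qs s'"
proof -
  assume s': "frame scratch s s'" and wl: "worklist h qs s"
  have "x \<notin> {L, M, Temp, Code, Weight, Open} \<Longrightarrow> s' (X x) = s (X x)" "a \<noteq> Cur \<Longrightarrow> s' (Y a i) = s (Y a i)"
    "s' (In i) = s (In i)" for x a i
    using s' by (auto simp: frame_def scratch_def)
  with wl show ?thesis unfolding worklist_def env_def by simp
qed

lemma worklist_env: "worklist h qs s \<Longrightarrow> env s"
  by (simp add: worklist_def)

text \<open>The entries are distinct, sane and valid. This bounds the number of rounds as well as
  all queue addresses.\<close>

lemma worklist_length:
  assumes "worklist h qs s"
  shows "length qs \<le> card {f. sane f \<and> valid f}"
proof -
  have "set qs \<subseteq> {f. sane f \<and> valid f}" "distinct qs"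
    using assms sane_reach reach_valid by (auto simp: worklist_def)
  then show ?thesis using card_mono[OF valid_count(1), of "set qs"] distinct_card[of qs] by simp
qed

lemma worklist_bound:
  assumes "worklist h qs s"
  shows "(length qs + 1) * d \<le> m"
  using worklist_length[OF assms] m_power(2) by (meson add_le_mono1 le_trans mult_le_mono1)

section \<open>Loading, encoding and storing a state\<close>

lemma load_correct:
  assumes "worklist h qs s" "h < length qs"
  shows "hoare load s (7 * b) (\<lambda>s'. frame scratch s s' \<and> cur_is (qs ! h) s')"
  unfolding load_def
proof (rule ht_For[where k = d and T = 1 and
      I = "\<lambda>i s'. frame scratch s s' \<and> (\<forall>l<i. s' (Y Cur l) = (qs ! h) l)"])
  fix i s' assume i: "i < d" "s' (X L) = i" and I: "frame scratch s s' \<and> (\<forall>l<i. s' (Y Cur l) = (qs ! h) l)"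
  then have "worklist h qs s'" using worklist_cong assms by blast
  then have *: "s' (X Head) = h * d" "s' (Y Queue (h * d + i)) = (qs ! h) i"
    using i assms(2) unfolding worklist_def by blast+
  have "h * d + i \<le> Suc h * d" using i by simp
  also have "\<dots> \<le> (length qs + 1) * d" using assms(2) by (intro mult_le_mono1) simp
  also have "\<dots> \<le> m" by (rule worklist_bound[OF assms(1)])
  finally have "h * d + i \<le> m" .
  then show "hoare (SetA Cur (Var L) (Arr Queue (Plus (Var Head) (Var L)))) s' 1
      (\<lambda>s'. s' (X L) = i \<and> frame scratch s (s'(X L := Suc i)) \<and> (\<forall>l<Suc i. (s'(X L := Suc i)) (Y Cur l) = (qs ! h) l))"
    using I * i by (intro ht_wps) (auto simp: less_Suc_eq scratch_def)
next
  fix i s' assume "frame scratch s s' \<and> (\<forall>l<i. s' (Y Cur l) = (qs ! h) l)"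
  then have "worklist h qs s'" using worklist_cong assms by blast
  then show "fits m (n * n) (Var Dim) s' \<and> hval (Var Dim) s' = d" by (simp add: worklist_def env_def)
next
  show "2 + d * (1 + 2) \<le> 7 * b" using b_bounds(2,4) by simp
  show "d \<le> m" by (rule m_bounds)
  show "1 \<le> m" by (rule m_bounds)
  show "frame scratch s (s(X L := 0)) \<and> (\<forall>l<0. (s(X L := 0)) (Y Cur l) = (qs ! h) l)"
    by (simp add: scratch_def)
next
  fix s' assume "frame scratch s s' \<and> (\<forall>l<d. s' (Y Cur l) = (qs ! h) l)"
  then show "frame scratch s s' \<and> cur_is (qs ! h) s'" by (simp add: cur_is_def)
qed

lemma encode_correct:
  assumes "env s" "cur_is f s" "sane f"
  shows "hoare encode s (14 * b ^ 2) (\<lambda>s'. frame scratch s s' \<and> cur_is f s' \<and> s' (X Code) = code f)"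
  unfolding encode_def
proof (rule ht_Seq)
  let ?A = "{X L, X M, X Temp, X Code}"
  have less: "horner b f l < b ^ l" if "l \<le> d" for l
    using that sane_digit[OF assms(3)] by (intro horner_less) simp
  have small: "horner b f l \<le> m" if "l \<le> d" for l
    by (rule less_imp_le[OF less_le_trans[OF less[OF that] le_trans[OF power_increasing[OF that b_bounds(3)] m_power(1)]]])
  show "hoare (SetV Code (Lit 0)) s 1 (\<lambda>s'. frame ?A s s' \<and> s' (X Code) = 0)"
    by (intro ht_wps) simp_all
  have sA: "?A \<subseteq> scratch" by (auto simp: scratch_def)
  have envA: "s' (X Dim) = d \<and> s' (X Base) = b \<and> cur_is f s'" if "frame ?A s s'" for s'
    using that assms by (auto simp: frame_def env_def cur_is_def)
  let ?I = "\<lambda>i s'. frame ?A s s' \<and> s' (X Code) = horner b f i"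
  show "hoare (For L (Var Dim) (HSeq (SetV Temp (Lit 0)) (HSeq (For M (Var Base) (SetV Temp (Plus (Var Temp) (Var Code))))
       (SetV Code (Plus (Var Temp) (Arr Cur (Var L))))))) s1 (13 * b ^ 2)
     (\<lambda>s'. frame scratch s s' \<and> cur_is f s' \<and> s' (X Code) = code f)"
    if "frame ?A s s1 \<and> s1 (X Code) = 0" for s1
  proof (rule ht_For[where k = d and T = "9 * b ^ 1" and I = ?I])
    fix i s' assume i: "i < d" "s' (X L) = i" and I: "?I i s'"
    \<comment> \<open>The value after the next round is again a number with at most \<open>d\<close>
      digits, and it bounds all partial sums of the inner loop.\<close>
    have last: "horner b f i * b + f i \<le> m" using small[of "Suc i"] i by simp
    show "hoare (HSeq (SetV Temp (Lit 0)) (HSeq (For M (Var Base) (SetV Temp (Plus (Var Temp) (Var Code))))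
       (SetV Code (Plus (Var Temp) (Arr Cur (Var L)))))) s' (9 * b ^ 1)
      (\<lambda>s'. s' (X L) = i \<and> ?I (Suc i) (s'(X L := Suc i)))"
    proof (rule ht_Seq)
      show "hoare (SetV Temp (Lit 0)) s' 1 (\<lambda>s'. ?I i s' \<and> s' (X L) = i \<and> s' (X Temp) = 0)"
        using I i by (intro ht_wps) simp_all
      fix s2 assume s2: "?I i s2 \<and> s2 (X L) = i \<and> s2 (X Temp) = 0"
      \<comment> \<open>After \<open>j\<close> rounds \<open>Temp\<close> is \<open>j\<close> times
        the old code.\<close>
      let ?J = "\<lambda>j s'. ?I i s' \<and> s' (X L) = i \<and> s' (X Temp) = j * horner b f i \<and> j \<le> b"
      show "hoare (HSeq (For M (Var Base) (SetV Temp (Plus (Var Temp) (Var Code))))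
        (SetV Code (Plus (Var Temp) (Arr Cur (Var L))))) s2 (5 * b ^ 1 + 1)
        (\<lambda>s'. s' (X L) = i \<and> ?I (Suc i) (s'(X L := Suc i)))"
      proof (rule ht_Seq)
        show "hoare (For M (Var Base) (SetV Temp (Plus (Var Temp) (Var Code)))) s2 (5 * b) (?J b)"
        proof (rule ht_For[where I = ?J and k = b and T = 1])
          fix j s3 assume j: "j < b" and J: "?J j s3"
          have "Suc j * horner b f i \<le> b * horner b f i" using j by (intro mult_le_mono1) simp
          then have "Suc j * horner b f i \<le> m" using last by (simp add: mult.commute)
          then show "hoare (SetV Temp (Plus (Var Temp) (Var Code))) s3 1
            (\<lambda>s'. s' (X M) = j \<and> ?J (Suc j) (s'(X M := Suc j)))" if "s3 (X M) = j"
            using J j that by (intro ht_wps) (auto simp: algebra_simps)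
        next
          show "2 + b * (1 + 2) \<le> 5 * b" using b_bounds(2) by simp
        qed (use s2 envA m_bounds(2,5) in auto)
        show "hoare (SetV Code (Plus (Var Temp) (Arr Cur (Var L)))) s3 1
          (\<lambda>s'. s' (X L) = i \<and> ?I (Suc i) (s'(X L := Suc i)))" if "?J b s3" for s3
          using that envA[of s3] last i
          by (intro ht_wps) (auto simp: cur_is_def mult.commute add.commute)
      qed simp
    next
      show "1 + (5 * b ^ 1 + 1) \<le> 9 * b ^ 1" using b_bounds(2) by simp
    qed
  next
    show "2 + d * (9 * b ^ 1 + 2) \<le> 13 * b ^ 2" using loop_time[OF b_bounds(4,3), of 9 1] by (simp add: power2_eq_square)
    show "frame scratch s s' \<and> cur_is f s' \<and> s' (X Code) = code f" if "?I d s'" for s'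
      using that envA frame_trans[OF _ frame_refl sA sA] by blast
  qed (use that envA m_bounds(5,8) in auto)
  show "1 + 13 * b ^ 2 \<le> 14 * b ^ 2" using b_bounds by linarith
qed

lemma weigh_correct:
  assumes "env s" "cur_is f s" "sane f"
  shows "hoare weigh s (10 * b) (\<lambda>s'. frame {X L, X Weight, X Open} s s' \<and>
    s' (X Weight) = (\<Sum>v<n. f v) \<and> (s' (X Open) = 0 \<longleftrightarrow> (\<forall>v<n. f v \<noteq> 4)))"
  unfolding weigh_def
proof (rule ht_Seq)
  let ?A = "{X L, X Weight, X Open}"
  let ?I = "\<lambda>i s'. frame ?A s s' \<and> s' (X Weight) = (\<Sum>v<i. f v) \<and> (s' (X Open) = 0 \<longleftrightarrow> (\<forall>v<i. f v \<noteq> 4))"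
  have sum: "(\<Sum>v<i. f v) \<le> m" if "i \<le> n" for i
  proof -
    have "(\<Sum>v<i. f v) \<le> (\<Sum>v<i. b)"
    proof (rule sum_mono)
      show "f v \<le> b" if "v \<in> {..<i}" for v
        using sane_digit[OF assms(3), of v] that \<open>i \<le> n\<close> by (simp add: d_def)
    qed
    also have "\<dots> \<le> n * b" using that by simp
    also have "n * b \<le> b * b" using b_bounds(5) by (rule mult_le_mono1)
    finally show ?thesis using m_bounds(1) by linarith
  qed
  have envA: "s' (X Verts) = n \<and> cur_is f s'" if "frame ?A s s'" for s'
    using that assms by (auto simp: frame_def env_def cur_is_def)
  show "hoare (SetV Weight (Lit 0)) s 1 (\<lambda>s'. frame ?A s s' \<and> s' (X Weight) = 0)"
    by (intro ht_wps) simp_all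
  show "hoare (HSeq (SetV Open (Lit 0)) (For L (Var Verts)
     (HSeq (SetV Weight (Plus (Var Weight) (Arr Cur (Var L))))
       (HIf (heq (Arr Cur (Var L)) (Lit 4)) (SetV Open (Lit 1)) HSkip)))) s1 (1 + (2 + n * (4 + 2))) (?I n)"
    if s1: "frame ?A s s1 \<and> s1 (X Weight) = 0" for s1
  proof (rule ht_Seq)
    show "hoare (SetV Open (Lit 0)) s1 1 (\<lambda>s'. ?I 0 s')"
      using s1 by (intro ht_wps) simp_all
    show "hoare (For L (Var Verts) (HSeq (SetV Weight (Plus (Var Weight) (Arr Cur (Var L))))
       (HIf (heq (Arr Cur (Var L)) (Lit 4)) (SetV Open (Lit 1)) HSkip))) s2 (2 + n * (4 + 2)) (?I n)" if "?I 0 s2" for s2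
    proof (rule ht_For[where I = ?I and k = n and T = 4])
      fix i s' assume i: "i < n" "s' (X L) = i" and I: "?I i s'"
      have "s' (Y Cur i) = f i" using envA[of s'] I i by (simp add: cur_is_def d_eq)
      moreover have "(\<Sum>v<i. f v) + f i \<le> m" using sum[of "Suc i"] i by simp
      ultimately show "hoare (HSeq (SetV Weight (Plus (Var Weight) (Arr Cur (Var L))))
         (HIf (heq (Arr Cur (Var L)) (Lit 4)) (SetV Open (Lit 1)) HSkip)) s' 4
         (\<lambda>s'. s' (X L) = i \<and> ?I (Suc i) (s'(X L := Suc i)))"
        using I i m_bounds by (intro ht_wps) (auto simp: less_Suc_eq)
    qed (use that envA m_bounds(5,6) in auto)
  qed simp
next
  show "1 + (1 + (2 + n * (4 + 2))) \<le> 10 * b" using b_bounds(1,2) by simp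
qed

lemma store_correct:
  assumes "worklist h qs s" "cur_is f s"
  shows "hoare store s (7 * b) (\<lambda>s'. frame ({X L} \<union> {Y Queue i | i. i \<ge> length qs * d}) s s' \<and>
    (\<forall>l<d. s' (Y Queue (length qs * d + l)) = f l))"
  unfolding store_def
proof (rule ht_For[where k = d and T = 1 and I = "\<lambda>i s'.
      frame ({X L} \<union> {Y Queue i | i. i \<ge> length qs * d}) s s' \<and> (\<forall>l<i. s' (Y Queue (length qs * d + l)) = f l)"])
  have s: "s (X Tail) = length qs * d" "s (X Dim) = d" using assms by (auto simp: worklist_def env_def)
  let ?A = "{X L} \<union> {Y Queue i | i. i \<ge> length qs * d}"
  have fr: "s' (X Tail) = length qs * d \<and> s' (X Dim) = d \<and> cur_is f s'" if "frame ?A s s'" for s'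
    using that s assms(2) by (auto simp: frame_def cur_is_def)
  fix i s' assume i: "i < d" "s' (X L) = i"
    and I: "frame ?A s s' \<and> (\<forall>l<i. s' (Y Queue (length qs * d + l)) = f l)"
  have "length qs * d + i \<le> m" using worklist_bound[OF assms(1)] i by simp
  then show "hoare (SetA Queue (Plus (Var Tail) (Var L)) (Arr Cur (Var L))) s' 1 (\<lambda>s'. s' (X L) = i \<and>
    frame ?A s (s'(X L := Suc i)) \<and> (\<forall>l<Suc i. (s'(X L := Suc i)) (Y Queue (length qs * d + l)) = f l))"
    using I i fr[of s'] by (intro ht_wps) (auto simp: less_Suc_eq cur_is_def)
next
  fix i s' assume "frame ({X L} \<union> {Y Queue i | i. i \<ge> length qs * d}) s s' \<and> (\<forall>l<i. s' (Y Queue (length qs * d + l)) = f l)"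
  then show "fits m (n * n) (Var Dim) s' \<and> hval (Var Dim) s' = d"
    using assms(1) by (auto simp: frame_def worklist_def env_def)
next
  show "2 + d * (1 + 2) \<le> 7 * b" using b_bounds(2,4) by simp
qed (use m_bounds(5,8) in auto)

lemma keeps_scratch: "frame scratch s s' \<Longrightarrow> keeps s s'"
  by (auto simp: keeps_def frame_def scratch_def)

text \<open>A valid state is in the list afterwards in either case: it has just been appended, or
  the table shows that it was there before.\<close>

lemma push_correct:
  assumes wl: "worklist h qs s" and f: "cur_is f s" "reach g" "move g f"
  shows "hoare push s (60 * b ^ 2) (\<lambda>s'. keeps s s' \<and>
    (\<exists>qs'. prefix qs qs' \<and> worklist h qs' s' \<and> (valid f \<longrightarrow> f \<in> set qs')))"
    (is "hoare _ _ _ ?R")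
  unfolding push_def
proof (rule ht_Seq)
  \<comment> \<open>Moves preserve saneness without validity; hence the code is also bounded for
    states that are about to be pruned.\<close>
  have sane: "sane f" using f sane_move sane_reach by blast
  show "hoare encode s (14 * b ^ 2) (\<lambda>s'. frame scratch s s' \<and> cur_is f s' \<and> s' (X Code) = code f)"
    by (rule encode_correct[OF worklist_env[OF wl] f(1) sane])
  fix s1 assume s1: "frame scratch s s1 \<and> cur_is f s1 \<and> s1 (X Code) = code f"
  then have wl1: "worklist h qs s1" using worklist_cong wl by blast
  show "hoare (HSeq weigh
     (HIf fresh
       (HSeq store enter)
       HSkip)) s1 (46 * b ^ 2) ?R"
  proof (rule ht_Seq)
    show "hoare weigh s1 (10 * b) (\<lambda>s'. frame {X L, X Weight, X Open} s1 s' \<and>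
      s' (X Weight) = (\<Sum>v<n. f v) \<and> (s' (X Open) = 0 \<longleftrightarrow> (\<forall>v<n. f v \<noteq> 4)))"
      using s1 by (intro weigh_correct[OF worklist_env[OF wl1] _ sane]) simp
    fix s2 assume s2: "frame {X L, X Weight, X Open} s1 s2 \<and>
      s2 (X Weight) = (\<Sum>v<n. f v) \<and> (s2 (X Open) = 0 \<longleftrightarrow> (\<forall>v<n. f v \<noteq> 4))"
    have fr2: "frame scratch s1 s2" using s2 by (auto simp: frame_def scratch_def)
    then have wl2: "worklist h qs s2" using wl1 worklist_cong by blast
    have cur2: "cur_is f s2" "s2 (X Code) = code f" using s1 s2 by (auto simp: frame_def cur_is_def)
    have keeps2: "keeps s s2" using keeps_trans keeps_scratch s1 fr2 by blast
    \<comment> \<open>Sane states with equal codes are equal, so the table admits no false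
      positives.\<close>
    have seen: "s2 (Y Seen (code f)) = 0 \<longleftrightarrow> f \<notin> set qs"
    proof -
      have "(\<exists>f'\<in>set qs. code f' = code f) \<longleftrightarrow> f \<in> set qs"
        using wl code_inj[OF sane_reach sane] unfolding worklist_def by blast
      then show ?thesis using wl2 unfolding worklist_def by blast
    qed
    have g: "holds fresh s2 \<longleftrightarrow> valid f \<and> f \<notin> set qs"
      using s2 wl2 seen cur2 by (simp add: fresh_def valid_def worklist_def env_def)
    show "hoare (HIf fresh (HSeq store enter) HSkip) s2 (7 * b + 6)
      ?R"
    proof (rule ht_If)
      show "fits m (n * n) fresh s2" using m_bounds(5) by (simp add: fresh_def)
      assume ng: "\<not> holds fresh s2"
      then have "valid f \<longrightarrow> f \<in> set qs" using g by blast
      then show "hoare HSkip s2 (7 * b + 5) ?R"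
        using keeps2 wl2 by (intro ht_wps) (simp, blast, simp)
    next
      assume "holds fresh s2"
      then have vf: "valid f" "f \<notin> set qs" using g by auto
      have rf: "reach f" using reach.Step f vf by blast
      show "hoare (HSeq store enter) s2 (7 * b + 5)
        ?R"
      proof (rule ht_Seq)
        let ?A = "{X L} \<union> {Y Queue i | i. i \<ge> length qs * d}"
        show "hoare store s2 (7 * b) (\<lambda>s'. frame ?A s2 s' \<and> (\<forall>l<d. s' (Y Queue (length qs * d + l)) = f l))"
          by (rule store_correct[OF wl2 cur2(1)])
        fix s3 assume s3: "frame ?A s2 s3 \<and> (\<forall>l<d. s3 (Y Queue (length qs * d + l)) = f l)"
        have same: "s3 l = s2 l" if "l \<notin> ?A" for l using s3 that by (simp add: frame_def)
        have tail: "s3 (X Tail) = length qs * d" and dim: "s3 (X Dim) = d" "s3 (X Verts) = n" "s3 (X Param) = k"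
          and cde: "s3 (X Code) = code f" and cnt: "s3 (Y Cur (Suc n)) = f (Suc n)"
          using wl2 cur2 by (auto simp: same worklist_def env_def cur_is_def d_eq)
        \<comment> \<open>\<open>s5\<close> is the memory that \<open>enter\<close> produces, given
          explicitly for the loop-free rule.\<close>
        define s4 where "s4 = s3(Y Seen (code f) := 1, X Tail := length qs * d + d)"
        define s5 where "s5 = (if k \<le> f (Suc n) then s4(X Answer := 1) else s4)"
        have s5: "s5 (X Answer) = (if k \<le> f (Suc n) then 1 else s2 (X Answer))"
          "s5 (X Tail) = length qs * d + d" "s5 (Y Queue i) = s3 (Y Queue i)"
          "s5 (Y Seen c) = (if c = code f then 1 else s2 (Y Seen c))"
          "x \<notin> {Tail, Answer, L} \<Longrightarrow> s5 (X x) = s2 (X x)" "a \<notin> {Seen, Queue} \<Longrightarrow> s5 (Y a i) = s2 (Y a i)"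
          "s5 (In i) = s2 (In i)" for i c x a
          by (auto simp: s5_def s4_def same)
        have old: "s3 (Y Queue (i * d + l)) = (qs ! i) l" if "i < length qs" "l < d" for i l
        proof -
          have "i * d + l < Suc i * d" using that(2) by simp
          also have "\<dots> \<le> length qs * d" using that(1) by (intro mult_le_mono1) simp
          finally show ?thesis using wl2 that by (auto simp: same worklist_def)
        qed
        have env5: "env s5" using worklist_env[OF wl2] by (simp add: env_def s5)
        have wl5: "worklist h (qs @ [f]) s5"
          unfolding worklist_def
        proof (intro conjI env5)
          show "s5 (X Head) = h * d" using wl2 by (simp add: s5 worklist_def)
          show "\<forall>i<length (qs @ [f]). \<forall>l<d. s5 (Y Queue (i * d + l)) = ((qs @ [f]) ! i) l"
            using old s3 by (auto simp: s5 nth_append less_Suc_eq)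
          show "\<forall>c. s5 (Y Seen c) \<noteq> 0 \<longleftrightarrow> (\<exists>f\<in>set (qs @ [f]). code f = c)"
            using wl2 by (auto simp: s5 worklist_def)
          show "s5 (X Answer) = (if \<exists>f\<in>set (qs @ [f]). k \<le> f (Suc n) then 1 else 0)"
            using wl2 by (auto simp: s5(1) worklist_def)
        qed (use wl2 vf rf in \<open>auto simp: s5 worklist_def\<close>)
        have keeps5: "keeps s s5" using keeps2 by (simp add: keeps_def s5)
        have "length qs * d + d \<le> m" using worklist_bound[OF wl2] by (simp add: algebra_simps)
        then show "hoare enter s3 5
         ?R"
        proof (intro ht_wps)
          assume le: "length qs * d + d \<le> m"
          have "keeps s s5 \<and> (\<exists>qs'. prefix qs qs' \<and> worklist h qs' s5 \<and> (valid f \<longrightarrow> f \<in> set qs'))"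
            using keeps5 wl5 by (intro conjI exI[of _ "qs @ [f]"]) auto
          then show "wps m (n * n) enter
            ?R s3"
            using le m_bounds m_Suc tail dim cde cnt by (simp add: enter_def cur_count_def s5_def s4_def split: if_splits)
        qed (simp add: enter_def)
      qed simp
    qed simp
  next
    show "10 * b + (7 * b + 6) \<le> 46 * b ^ 2" using b_bounds by linarith
  qed
qed simp

text \<open>\<open>gd\<close> is the mathematical side condition of a move and \<open>g\<close> the
  test for it. All three kinds of move are instances.\<close>

lemma attempt_correct:
  assumes wl: "worklist h qs s" "h < length qs"
    and g: "\<And>s'. env s' \<Longrightarrow> keeps s s' \<Longrightarrow> cur_is (qs ! h) s' \<Longrightarrow> fits m (n * n) g s' \<and> (holds g s' \<longleftrightarrow> gd)"
    and c: "\<And>s'. gd \<Longrightarrow> env s' \<Longrightarrow> keeps s s' \<Longrightarrow> cur_is (qs ! h) s' \<Longrightarrow>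
      wps m (n * n) c (\<lambda>s''. frame (range (Y Cur)) s' s'' \<and> cur_is f s'') s'"
    and f: "gd \<Longrightarrow> move (qs ! h) f" and t: "step_size c \<le> 20"
  shows "hoare (attempt g c) s (100 * b ^ 2) (\<lambda>s'. keeps s s' \<and>
    (\<exists>qs'. prefix qs qs' \<and> worklist h qs' s' \<and> (gd \<and> valid f \<longrightarrow> f \<in> set qs')))"
    (is "hoare _ _ _ ?R")
  unfolding attempt_def
proof (rule ht_Seq[OF load_correct[OF wl]])
  fix s1 assume s1: "frame scratch s s1 \<and> cur_is (qs ! h) s1"
  then have wl1: "worklist h qs s1" and k1: "keeps s s1" using worklist_cong keeps_scratch wl by blast+
  note g1 = g[OF worklist_env[OF wl1] k1 conjunct2[OF s1]]
  show "hoare (HIf g (HSeq c push) HSkip) s1 (81 * b ^ 2) ?R"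
  proof (rule ht_If)
    show "fits m (n * n) g s1" using g1 by simp
    show "hoare HSkip s1 (20 + 60 * b ^ 2) ?R" if "\<not> holds g s1"
      using that g1 k1 wl1 by (intro ht_wps) (simp, blast, simp)
    assume "holds g s1"
    then have gd: gd using g1 by simp
    have reach: "reach (qs ! h)" using wl unfolding worklist_def by simp
    show "hoare (HSeq c push) s1 (20 + 60 * b ^ 2) ?R"
    proof (rule ht_Seq[OF ht_wps[OF c[OF gd worklist_env[OF wl1] k1 conjunct2[OF s1]] t]])
      fix s2 assume s2: "frame (range (Y Cur)) s1 s2 \<and> cur_is f s2"
      then have fr: "frame scratch s1 s2" by (auto simp: frame_def scratch_def)
      then have wl2: "worklist h qs s2" and k2: "keeps s s2"
        using worklist_cong wl1 keeps_trans keeps_scratch[OF fr] k1 by blast+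
      show "hoare push s2 (60 * b ^ 2) ?R"
        by (rule ht_conseq[OF push_correct[OF wl2 conjunct2[OF s2] reach f[OF gd]] order_refl])
          (use k2 keeps_trans in blast)
    qed simp
  next
    show "20 + 60 * b ^ 2 + 1 \<le> 81 * b ^ 2" using b_bounds by linarith
  qed
next
  show "7 * b + 81 * b ^ 2 \<le> 100 * b ^ 2" using b_bounds by linarith
qed

section \<open>The three kinds of move in the program\<close>

lemma adj_guard:
  assumes "env s" "s (X x) = u" "s (X y) = v" "u < n" "v < n"
  shows "fits m (n * n) (adj (Var x) (Var y)) s" "holds (adj (Var x) (Var y)) s \<longleftrightarrow> {u, v} \<in> edges G"
  using assms adj_correct[of s u n v "edges G" x y m] m_bounds(3) by (simp_all add: env_def)

lemma available_guard:
  assumes "env s" "cur_is f s" "s (X x) = u" "u < n"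
  shows "fits m (n * n) (available x) s" "holds (available x) s \<longleftrightarrow> avail f u"
  using assms m_bounds(5) by (auto simp: available_def avail_def env_def cur_is_def d_eq)

lemma wps_grab:
  assumes "env s" "cur_is f s" "s (X x) = u" "u < n"
    and Q: "\<And>s'. frame (range (Y Cur)) s s' \<Longrightarrow> cur_is (take_vertex u f) s' \<Longrightarrow> Q s'"
  shows "wps m (n * n) (grab x) Q s"
proof -
  have s: "s (Y Pos u) = pos u" "s (X Verts) = n" "s (Y Cur n) = f n"
    using assms by (auto simp: env_def cur_is_def d_eq)
  have 1: "Q (s(Y Cur u := Suc 0))" if "pos u = 0"
    using that assms(2) by (intro Q) (auto simp: take_vertex_def cur_is_def)
  have 2: "Q (s(Y Cur n := pos u))" if "pos u \<noteq> 0" "f n < pos u"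
    using that assms(2) by (intro Q) (auto simp: take_vertex_def cur_is_def)
  have 3: "Q s" if "pos u \<noteq> 0" "\<not> f n < pos u"
    using that assms(2) by (intro Q) (auto simp: take_vertex_def cur_is_def max_def)
  show ?thesis using 1 2 3 assms(3) s m_bounds(5) by (simp add: grab_def)
qed

lemma env_Cur: "frame (range (Y Cur)) s s' \<Longrightarrow> env s \<Longrightarrow> env s' \<and> s' (X x) = s (X x)"
proof -
  assume s': "frame (range (Y Cur)) s s'" and e: "env s"
  have "s' (X x) = s (X x)" "a \<noteq> Cur \<Longrightarrow> s' (Y a i) = s (Y a i)" "s' (In i) = s (In i)" for x a i
    using s' by (auto simp: frame_def)
  with e show ?thesis unfolding env_def by simp
qed

lemma wps_incr_count:
  assumes "env s" "cur_is f s" "f (Suc n) \<le> n"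
    and Q: "\<And>s'. frame (range (Y Cur)) s s' \<Longrightarrow> cur_is (f(n + 1 := f (n + 1) + 1)) s' \<Longrightarrow> Q s'"
  shows "wps m (n * n) incr_count Q s"
proof -
  have s: "s (X Verts) = n" "s (Y Cur (Suc n)) = f (Suc n)" using assms by (auto simp: env_def cur_is_def d_eq)
  have "Q (s(Y Cur (Suc n) := Suc (f (Suc n))))"
    using assms(2) by (intro Q) (auto simp: cur_is_def)
  then show ?thesis using s m_Suc m_bounds(5) assms(3) by (simp add: incr_count_def cur_count_def)
qed

text \<open>All moves are indexed by the same triples, so that one triple loop covers them; for the
  two half moves the middle index is arbitrary.\<close>

definition choice :: "nat \<Rightarrow> nat \<Rightarrow> nat \<Rightarrow> (nat \<Rightarrow> nat) \<Rightarrow> (nat \<Rightarrow> nat) \<Rightarrow> bool" where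
  "choice u v w g f \<longleftrightarrow>
     {u, v} \<in> edges G \<and> {v, w} \<in> edges G \<and> u \<noteq> w \<and> avail g u \<and> avail g v \<and> avail g w \<and> f = take_path u v w g \<or>
     {u, w} \<in> edges G \<and> pos u = 0 \<and> g u = 0 \<and> g n < pos w \<and> f = g(u := 4, n := pos w) \<or>
     {u, w} \<in> edges G \<and> g u = 4 \<and> g n < pos w \<and> f = g(u := 1, n := pos w, n + 1 := g (n + 1) + 1)"

lemma move_choice: "move g f \<Longrightarrow> \<exists>u<n. \<exists>v<n. \<exists>w<n. choice u v w g f"
proof (induction rule: move.induct)
  case (Whole x y z f)
  then show ?case using edge_less[OF simple] unfolding choice_def by blast
next
  case (First x z f)
  then show ?case using edge_less[OF simple First(1)] unfolding choice_def by blast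
next
  case (Second x z f)
  then show ?case using edge_less[OF simple Second(1)] unfolding choice_def by blast
qed

definition expanding :: "nat \<Rightarrow> (nat \<Rightarrow> nat) \<Rightarrow> (nat \<Rightarrow> nat) list \<Rightarrow> state \<Rightarrow> bool" where
  "expanding h g qs s \<longleftrightarrow> worklist h qs s \<and> h < length qs \<and> qs ! h = g"

lemma expanding_prefix: "expanding h g qs s \<Longrightarrow> prefix qs qs' \<Longrightarrow> worklist h qs' s' \<Longrightarrow> expanding h g qs' s'"
  by (auto simp: expanding_def prefix_def nth_append)

lemma expanding_count: "expanding h g qs s \<Longrightarrow> reach g \<and> g (Suc n) \<le> n"
  unfolding expanding_def worklist_def using sane_reach sane_count_le by (metis nth_mem)

lemma whole_correct:
  assumes ex: "expanding h g qs s" and uvw: "s (X U) = u" "s (X V) = v" "s (X W) = w" "u < n" "v < n" "w < n"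
  defines "c \<equiv> {u, v} \<in> edges G \<and> {v, w} \<in> edges G \<and> u \<noteq> w \<and> avail g u \<and> avail g v \<and> avail g w"
  shows "hoare whole s (100 * b ^ 2) (\<lambda>s'. keeps s s' \<and> (\<exists>qs'. prefix qs qs' \<and> worklist h qs' s' \<and>
    (c \<and> valid (take_path u v w g) \<longrightarrow> take_path u v w g \<in> set qs')))"
  unfolding whole_def
proof (rule attempt_correct)
  let ?g = "adj (Var U) (Var V) && adj (Var V) (Var W) && hnot (heq (Var U) (Var W)) &&
       available U && available V && available W"
  show "worklist h qs s" "h < length qs" using ex by (auto simp: expanding_def)
  have g: "qs ! h = g" using ex by (simp add: expanding_def)
  fix s' assume s': "env s'" "keeps s s'" "cur_is (qs ! h) s'"
  have x: "s' (X U) = u" "s' (X V) = v" "s' (X W) = w" using s'(2) uvw by (auto simp: keeps_def)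
  have cur: "cur_is g s'" using s' g by simp
  show "fits m (n * n) ?g s' \<and>
      (holds ?g s' \<longleftrightarrow> c)"
    using adj_guard[OF s'(1) x(1,2)] adj_guard[OF s'(1) x(2,3)] available_guard[OF s'(1) cur x(1)]
      available_guard[OF s'(1) cur x(2)] available_guard[OF s'(1) cur x(3)] uvw m_bounds(5) x
    by (simp add: c_def)
  show "wps m (n * n) (HSeq (grab U) (HSeq (grab V) (HSeq (grab W) incr_count)))
    (\<lambda>s''. frame (range (Y Cur)) s' s'' \<and> cur_is (take_path u v w g) s'') s'" if c
    unfolding wps.simps
  proof (rule wps_grab[OF s'(1) cur x(1) uvw(4)])
    fix s1 assume s1: "frame (range (Y Cur)) s' s1" "cur_is (take_vertex u g) s1"
    have e1: "env s1" "s1 (X V) = v" "s1 (X W) = w" using env_Cur[OF s1(1) s'(1)] x by simp_all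
    show "wps m (n * n) (grab V) (wps m (n * n) (grab W) (wps m (n * n) incr_count
      (\<lambda>s''. frame (range (Y Cur)) s' s'' \<and> cur_is (take_path u v w g) s''))) s1"
    proof (rule wps_grab[OF _ s1(2) _ uvw(5)])
      fix s2 assume s2: "frame (range (Y Cur)) s1 s2" "cur_is (take_vertex v (take_vertex u g)) s2"
      have e2: "env s2" "s2 (X W) = w" using env_Cur[OF s2(1) e1(1)] e1(3) by simp_all
      show "wps m (n * n) (grab W) (wps m (n * n) incr_count
        (\<lambda>s''. frame (range (Y Cur)) s' s'' \<and> cur_is (take_path u v w g) s'')) s2"
      proof (rule wps_grab[OF _ s2(2) _ uvw(6)])
        fix s3 assume s3: "frame (range (Y Cur)) s2 s3" "cur_is (take_vertex w (take_vertex v (take_vertex u g))) s3"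
        have e3: "env s3" using env_Cur[OF s3(1) e2(1)] by blast
        show "wps m (n * n) incr_count (\<lambda>s''. frame (range (Y Cur)) s' s'' \<and> cur_is (take_path u v w g) s'') s3"
        proof (rule wps_incr_count[OF e3 s3(2)])
          show "take_vertex w (take_vertex v (take_vertex u g)) (Suc n) \<le> n"
            using expanding_count[OF ex] uvw by (simp add: take_vertex_def)
          fix s4 assume s4: "frame (range (Y Cur)) s3 s4" "cur_is ((take_vertex w (take_vertex v (take_vertex u g)))
            (n + 1 := take_vertex w (take_vertex v (take_vertex u g)) (n + 1) + 1)) s4"
          have "take_vertex w (take_vertex v (take_vertex u g)) (n + 1) = g (n + 1)"
            using uvw by (simp add: take_vertex_def)
          then have "cur_is (take_path u v w g) s4" using s4(2) by (simp only: take_path_def)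
          moreover have "frame (range (Y Cur)) s' s4"
            using s1(1) s2(1) s3(1) s4(1) by (simp add: frame_def)
          ultimately show "frame (range (Y Cur)) s' s4 \<and> cur_is (take_path u v w g) s4" by simp
        qed
      qed (use e2 in simp_all)
    qed (use e1 in simp_all)
  qed
next
  have "qs ! h = g" using ex by (simp add: expanding_def)
  then show "move (qs ! h) (take_path u v w g)" if c using that move.Whole[of u v w g] by (simp add: c_def)
qed (simp add: grab_def incr_count_def)

lemma half_guard:
  assumes "env s" "cur_is g s" "s (X U) = u" "s (X W) = w" "u < n" "w < n" "i \<le> 5"
  shows "fits m (n * n) (heq (Arr Cur (Var U)) (Lit i)) s" "holds (heq (Arr Cur (Var U)) (Lit i)) s \<longleftrightarrow> g u = i"
    "fits m (n * n) (hlt (Arr Cur (Var Verts)) (Arr Pos (Var W))) s"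
    "holds (hlt (Arr Cur (Var Verts)) (Arr Pos (Var W))) s \<longleftrightarrow> g n < pos w"
    "fits m (n * n) (heq (Arr Pos (Var U)) (Lit 0)) s" "holds (heq (Arr Pos (Var U)) (Lit 0)) s \<longleftrightarrow> pos u = 0"
  using assms m_bounds(4,5) by (auto simp: env_def cur_is_def d_eq)

lemma first_half_correct:
  assumes ex: "expanding h g qs s" and uvw: "s (X U) = u" "s (X W) = w" "u < n" "w < n"
  defines "c \<equiv> {u, w} \<in> edges G \<and> pos u = 0 \<and> g u = 0 \<and> g n < pos w" and "f \<equiv> g(u := 4, n := pos w)"
  shows "hoare first_half s (100 * b ^ 2) (\<lambda>s'. keeps s s' \<and> (\<exists>qs'. prefix qs qs' \<and> worklist h qs' s' \<and>
    (c \<and> valid f \<longrightarrow> f \<in> set qs')))"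
  unfolding first_half_def
proof (rule attempt_correct)
  let ?g = "adj (Var U) (Var W) && heq (Arr Pos (Var U)) (Lit 0) &&
       heq (Arr Cur (Var U)) (Lit 0) && hlt (Arr Cur (Var Verts)) (Arr Pos (Var W))"
  show "worklist h qs s" "h < length qs" using ex by (auto simp: expanding_def)
  have g: "qs ! h = g" using ex by (simp add: expanding_def)
  fix s' assume s': "env s'" "keeps s s'" "cur_is (qs ! h) s'"
  have x: "s' (X U) = u" "s' (X W) = w" using s'(2) uvw by (auto simp: keeps_def)
  have cur: "cur_is g s'" using s' g by simp
  show "fits m (n * n) ?g s' \<and>
    (holds ?g s' \<longleftrightarrow> c)"
    using adj_guard[OF s'(1) x] half_guard[OF s'(1) cur x uvw(3,4), of 0] uvw m_bounds(5)
    by (simp only: fits_simps holds_simps(2) c_def)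
  show "wps m (n * n) (HSeq (SetA Cur (Var U) (Lit 4)) (SetA Cur (Var Verts) (Arr Pos (Var W))))
    (\<lambda>s''. frame (range (Y Cur)) s' s'' \<and> cur_is f s'') s'" if c
  proof -
    have "s' (X Verts) = n" "s' (Y Pos w) = pos w" using s'(1) uvw by (auto simp: env_def)
    then show ?thesis using x cur uvw m_bounds(4) by (auto simp: f_def cur_is_def)
  qed
next
  have "qs ! h = g" using ex by (simp add: expanding_def)
  then show "move (qs ! h) f" if c using that move.First[of u w g] by (simp add: c_def f_def)
qed simp

lemma second_half_correct:
  assumes ex: "expanding h g qs s" and uvw: "s (X U) = u" "s (X W) = w" "u < n" "w < n"
  defines "c \<equiv> {u, w} \<in> edges G \<and> g u = 4 \<and> g n < pos w"
    and "f \<equiv> g(u := 1, n := pos w, n + 1 := g (n + 1) + 1)"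
  shows "hoare second_half s (100 * b ^ 2) (\<lambda>s'. keeps s s' \<and> (\<exists>qs'. prefix qs qs' \<and> worklist h qs' s' \<and>
    (c \<and> valid f \<longrightarrow> f \<in> set qs')))"
  unfolding second_half_def
proof (rule attempt_correct)
  let ?g = "adj (Var U) (Var W) && heq (Arr Cur (Var U)) (Lit 4) &&
       hlt (Arr Cur (Var Verts)) (Arr Pos (Var W))"
  show "worklist h qs s" "h < length qs" using ex by (auto simp: expanding_def)
  have g: "qs ! h = g" using ex by (simp add: expanding_def)
  fix s' assume s': "env s'" "keeps s s'" "cur_is (qs ! h) s'"
  have x: "s' (X U) = u" "s' (X W) = w" using s'(2) uvw by (auto simp: keeps_def)
  have cur: "cur_is g s'" using s' g by simp
  show "fits m (n * n) ?g s' \<and>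
    (holds ?g s' \<longleftrightarrow> c)"
    using adj_guard[OF s'(1) x] half_guard[OF s'(1) cur x uvw(3,4), of 4] uvw m_bounds(5)
    by (simp only: fits_simps holds_simps(2) c_def)
  show "wps m (n * n) (HSeq (SetA Cur (Var U) (Lit 1)) (HSeq (SetA Cur (Var Verts) (Arr Pos (Var W))) incr_count))
    (\<lambda>s''. frame (range (Y Cur)) s' s'' \<and> cur_is f s'') s'" if c
  proof -
    have s: "s' (X Verts) = n" "s' (Y Pos w) = pos w" using s'(1) uvw by (auto simp: env_def)
    let ?s = "s'(Y Cur u := 1, Y Cur n := pos w)"
    have fr: "frame (range (Y Cur)) s' ?s" by simp
    have "wps m (n * n) incr_count (\<lambda>s''. frame (range (Y Cur)) s' s'' \<and> cur_is f s'') ?s"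
    proof (rule wps_incr_count)
      show "env ?s" using env_Cur[OF fr s'(1)] by simp
      show "cur_is (g(u := 1, n := pos w)) ?s" using cur by (auto simp: cur_is_def)
      show "(g(u := 1, n := pos w)) (Suc n) \<le> n" using expanding_count[OF ex] uvw by auto
      fix s'' assume s'': "frame (range (Y Cur)) ?s s''" "cur_is ((g(u := 1, n := pos w))
        (n + 1 := (g(u := 1, n := pos w)) (n + 1) + 1)) s''"
      then show "frame (range (Y Cur)) s' s'' \<and> cur_is f s''"
        using frame_trans[OF fr s''(1)] uvw by (auto simp: f_def)
    qed
    then show ?thesis using x s m_bounds(5) by (simp add: uvw)
  qed
next
  have "qs ! h = g" using ex by (simp add: expanding_def)
  then show "move (qs ! h) f" if c using that move.Second[of u w g] by (simp add: c_def f_def)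
qed (simp add: incr_count_def)

section \<open>Closing the worklist under moves\<close>

definition closed_at :: "(nat \<Rightarrow> nat) \<Rightarrow> nat \<Rightarrow> nat \<Rightarrow> nat \<Rightarrow> (nat \<Rightarrow> nat) list \<Rightarrow> bool" where
  "closed_at g u v w qs \<longleftrightarrow> (\<forall>f. choice u v w g f \<and> valid f \<longrightarrow> f \<in> set qs)"

lemma attempts_correct:
  assumes ex: "expanding h g qs s" and uvw: "s (X U) = u" "s (X V) = v" "s (X W) = w" "u < n" "v < n" "w < n"
  shows "hoare (HSeq whole (HSeq first_half second_half)) s (300 * b ^ 2) (\<lambda>s'. keeps s s' \<and>
    (\<exists>qs'. prefix qs qs' \<and> expanding h g qs' s' \<and> closed_at g u v w qs'))"
    (is "hoare _ _ _ ?R")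
proof (rule ht_Seq[OF whole_correct[OF ex uvw]])
  let ?c1 = "{u, v} \<in> edges G \<and> {v, w} \<in> edges G \<and> u \<noteq> w \<and> avail g u \<and> avail g v \<and> avail g w"
  let ?f1 = "take_path u v w g"
  fix s1 assume "keeps s s1 \<and> (\<exists>qs'. prefix qs qs' \<and> worklist h qs' s1 \<and> (?c1 \<and> valid ?f1 \<longrightarrow> ?f1 \<in> set qs'))"
  then obtain q1 where 1: "keeps s s1" "prefix qs q1" "worklist h q1 s1" "?c1 \<and> valid ?f1 \<longrightarrow> ?f1 \<in> set q1"
    by blast
  have ex1: "expanding h g q1 s1" using expanding_prefix[OF ex 1(2,3)] .
  have x1: "s1 (X U) = u" "s1 (X W) = w" using 1(1) uvw by (auto simp: keeps_def)
  show "hoare (HSeq first_half second_half) s1 (200 * b ^ 2) ?R"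
  proof (rule ht_Seq[OF first_half_correct[OF ex1 x1 uvw(4,6)]])
    let ?c2 = "{u, w} \<in> edges G \<and> pos u = 0 \<and> g u = 0 \<and> g n < pos w" and ?f2 = "g(u := 4, n := pos w)"
    fix s2 assume "keeps s1 s2 \<and> (\<exists>qs'. prefix q1 qs' \<and> worklist h qs' s2 \<and> (?c2 \<and> valid ?f2 \<longrightarrow> ?f2 \<in> set qs'))"
    then obtain q2 where 2: "keeps s1 s2" "prefix q1 q2" "worklist h q2 s2" "?c2 \<and> valid ?f2 \<longrightarrow> ?f2 \<in> set q2"
      by blast
    have ex2: "expanding h g q2 s2" using expanding_prefix[OF ex1 2(2,3)] .
    have x2: "s2 (X U) = u" "s2 (X W) = w" using 2(1) x1 by (auto simp: keeps_def)
    show "hoare second_half s2 (100 * b ^ 2) ?R"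
    proof (rule ht_conseq[OF second_half_correct[OF ex2 x2 uvw(4,6)] order_refl])
      let ?c3 = "{u, w} \<in> edges G \<and> g u = 4 \<and> g n < pos w"
      let ?f3 = "g(u := 1, n := pos w, n + 1 := g (n + 1) + 1)"
      fix s3 assume "keeps s2 s3 \<and> (\<exists>qs'. prefix q2 qs' \<and> worklist h qs' s3 \<and> (?c3 \<and> valid ?f3 \<longrightarrow> ?f3 \<in> set qs'))"
      then obtain q3 where 3: "keeps s2 s3" "prefix q2 q3" "worklist h q3 s3" "?c3 \<and> valid ?f3 \<longrightarrow> ?f3 \<in> set q3"
        by blast
      have "set q1 \<subseteq> set q2" "set q2 \<subseteq> set q3" using 2(2) 3(2) by (simp_all add: set_mono_prefix)
      then have "closed_at g u v w q3" unfolding closed_at_def choice_def using 1(4) 2(4) 3(4) by blast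
      moreover have "prefix qs q3" using 1(2) 2(2) 3(2) by (meson prefix_order.trans)
      moreover have "expanding h g q3 s3" using expanding_prefix[OF ex2 3(2,3)] .
      moreover have "keeps s s3" using keeps_trans 1(1) 2(1) 3(1) by blast
      ultimately show "keeps s s3 \<and> (\<exists>qs'. prefix qs qs' \<and> expanding h g qs' s3 \<and> closed_at g u v w qs')" by blast
    qed
  qed simp
qed simp

lemma expanding_upd:
  assumes x: "x \<in> {U, V, W}" and ex: "expanding h g qs s"
  shows "expanding h g qs (s(X x := i))"
proof -
  have "y \<notin> {U, V, W} \<Longrightarrow> (s(X x := i)) (X y) = s (X y)" "(s(X x := i)) (Y a j) = s (Y a j)"
    "(s(X x := i)) (In j) = s (In j)" for y a j
    using x by auto
  with ex show ?thesis unfolding expanding_def worklist_def env_def by simp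
qed

lemma expanding_Verts: "expanding h g qs s \<Longrightarrow> s (X Verts) = n"
  by (simp add: expanding_def worklist_def env_def)

lemma closed_at_mono: "closed_at g u v w qs \<Longrightarrow> prefix qs qs' \<Longrightarrow> closed_at g u v w qs'"
  unfolding closed_at_def using set_mono_prefix by blast

lemma prefix_order_props: "reflp prefix" "transp prefix"
  by (auto simp: reflp_def transp_def)

text \<open>The list may grow during the loops while the goals for earlier triples persist. The time
  is (300 + 3 * 4) b^(2 + 3), one level for each of the three loops.\<close>

lemma expand_correct:
  assumes "expanding h g qs s"
  shows "hoare expand s (312 * b ^ 5) (\<lambda>s'. \<exists>qs'. prefix qs qs' \<and> expanding h g qs' s' \<and>
    (\<forall>f. move g f \<and> valid f \<longrightarrow> f \<in> set qs'))"
  unfolding expand_def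
proof (rule ht_For3[where le = prefix and k = n and b = b and t = 300 and r = 2 and ?q0.0 = qs
      and J = "expanding h g" and G = "closed_at g"])
  fix u v w qs s
  assume "u < n" "v < n" "w < n" "expanding h g qs s" "s (X U) = u" "s (X V) = v" "s (X W) = w"
  then show "hoare (HSeq whole (HSeq first_half second_half)) s (300 * b ^ 2) (\<lambda>s'. s' (X U) = u \<and>
      s' (X V) = v \<and> s' (X W) = w \<and> (\<exists>qs'. prefix qs qs' \<and> expanding h g qs' s' \<and> closed_at g u v w qs'))"
    by (intro ht_conseq[OF attempts_correct[where u = u and v = v and w = w] order_refl]) (auto simp: keeps_def)
next
  show "fits m (n * n) (Var Verts) s \<and> hval (Var Verts) s = n" if "expanding h g q s" for q s
    using expanding_Verts[OF that] by simp
  show "closed_at g u v w q'" if "closed_at g u v w q" "prefix q q'" for u v w q q'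
    using that by (rule closed_at_mono)
  fix qs' s' assume "prefix qs qs'" "expanding h g qs' s'" "\<forall>u<n. \<forall>v<n. \<forall>w<n. closed_at g u v w qs'"
  then show "\<exists>qs'. prefix qs qs' \<and> expanding h g qs' s' \<and> (\<forall>f. move g f \<and> valid f \<longrightarrow> f \<in> set qs')"
    using move_choice unfolding closed_at_def by blast
qed (use assms expanding_upd prefix_order_props m_bounds(5,6) b_bounds(3,5) in auto)

text \<open>The first \<open>i\<close> entries have all their valid successors in the list. At
  \<open>i = length qs\<close> this is closure under valid moves.\<close>

definition explored :: "nat \<Rightarrow> state \<Rightarrow> bool" where
  "explored i s \<longleftrightarrow> (\<exists>qs. worklist i qs s \<and> i \<le> length qs \<and> (\<lambda>_. 0) \<in> set qs \<and>
     (\<forall>j<i. \<forall>f. move (qs ! j) f \<and> valid f \<longrightarrow> f \<in> set qs))"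

theorem explore_correct:
  assumes "worklist 0 [\<lambda>_. 0] s"
  shows "hoare explore s (1 + card {f. sane f \<and> valid f} * (313 * b ^ 5 + 1))
    (\<lambda>s'. s' (X Answer) = (if has_P2_packing G k then 1 else 0))"
  unfolding explore_def
proof (rule ht_While[where I = "explored"])
  show "explored 0 s"
    using assms unfolding explored_def by (intro exI[of _ "[\<lambda>_. 0]"]) simp
next
  fix i s assume "explored i s"
  then obtain qs where wl: "worklist i qs s" and le: "i \<le> length qs" and start: "(\<lambda>_. 0) \<in> set qs"
    and closed: "\<forall>j<i. \<forall>f. move (qs ! j) f \<and> valid f \<longrightarrow> f \<in> set qs"
    unfolding explored_def by blast
  have ht: "s (X Head) = i * d" "s (X Tail) = length qs * d" using wl by (auto simp: worklist_def)
  have g: "holds (hlt (Var Head) (Var Tail)) s \<longleftrightarrow> i < length qs" using ht d_eq(2) by simp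
  show "fits m (n * n) (hlt (Var Head) (Var Tail)) s" by simp
  {
    assume "holds (hlt (Var Head) (Var Tail)) s"
    then have i: "i < length qs" using g by simp
    show "i < card {f. sane f \<and> valid f} \<and> hoare (HSeq expand (SetV Head (Plus (Var Head) (Var Dim)))) s (313 * b ^ 5)
      (explored (Suc i))"
    proof
      show "i < card {f. sane f \<and> valid f}" using i worklist_length[OF wl] by simp
      have "expanding i (qs ! i) qs s" using wl i by (simp add: expanding_def)
      then show "hoare (HSeq expand (SetV Head (Plus (Var Head) (Var Dim)))) s (313 * b ^ 5)
        (explored (Suc i))"
      proof (rule ht_Seq[OF expand_correct])
        fix s1 assume "\<exists>qs'. prefix qs qs' \<and> expanding i (qs ! i) qs' s1 \<and>
          (\<forall>f. move (qs ! i) f \<and> valid f \<longrightarrow> f \<in> set qs')"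
        then obtain q where q: "prefix qs q" "expanding i (qs ! i) q s1"
          "\<forall>f. move (qs ! i) f \<and> valid f \<longrightarrow> f \<in> set q" by blast
        have wl1: "worklist i q s1" and il: "i < length q" using q(2) by (auto simp: expanding_def)
        have nth: "q ! j = qs ! j" if "j \<le> i" for j using q(1) that i by (auto simp: prefix_def nth_append)
        have sub: "set qs \<subseteq> set q" using set_mono_prefix[OF q(1)] .
        have "move (q ! j) f \<and> valid f \<longrightarrow> f \<in> set q" if "j < Suc i" for j f
        proof (cases "j = i")
          case False
          then have "j < i" using that by simp
          then show ?thesis using closed sub nth[of j] by auto
        qed (use q(3) nth in simp)
        moreover have "worklist (Suc i) q (s1(X Head := i * d + d))"
          using wl1 by (simp add: worklist_def env_def add.commute)
        moreover have "(\<lambda>_. 0) \<in> set q" "Suc i \<le> length q" using start sub il by auto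
        ultimately have I: "explored (Suc i) (s1(X Head := i * d + d))"
          unfolding explored_def by blast
        have "i * d + d = Suc i * d" by simp
        also have "\<dots> \<le> (length q + 1) * d" using il by (intro mult_le_mono1) simp
        also have "\<dots> \<le> m" by (rule worklist_bound[OF wl1])
        finally have "i * d + d \<le> m" .
        moreover have "s1 (X Head) = i * d" "s1 (X Dim) = d" using wl1 by (auto simp: worklist_def env_def)
        ultimately show "hoare (SetV Head (Plus (Var Head) (Var Dim))) s1 1
          (explored (Suc i))"
          using I by (intro ht_wps) simp_all
      next
        have "1 \<le> b ^ 5" using b_bounds(3) by simp
        then show "312 * b ^ 5 + 1 \<le> 313 * b ^ 5" by linarith
      qed
    qed
  next
    assume "\<not> holds (hlt (Var Head) (Var Tail)) s"
    then have i: "i = length qs" using g le by simp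
    \<comment> \<open>The list contains the initial state and is now closed, hence it contains all
      reachable states.\<close>
    have "f \<in> set qs" if "reach f" for f
      using that
    proof (induction rule: reach.induct)
      case Start
      then show ?case by (rule start)
    next
      case (Step f f')
      then obtain j where "j < i" "qs ! j = f" using i by (auto simp: in_set_conv_nth)
      then show ?case using closed Step by blast
    qed
    then have "(\<exists>f\<in>set qs. k \<le> f (Suc n)) \<longleftrightarrow> has_P2_packing G k"
      using wl unfolding has_P2_packing_iff_reach worklist_def by blast
    then show "s (X Answer) = (if has_P2_packing G k then 1 else 0)"
      using wl by (simp add: worklist_def)
  }
qed

end

section \<open>Greedy packing and numbering\<close>

definition fill_rows :: hcom where
  "fill_rows = For U (Var Verts) (HSeq (SetA Row (Var U) (Var Temp)) (SetV Temp (Plus (Var Temp) (Var Verts))))"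

definition unmarked :: "var \<Rightarrow> hexp" where
  "unmarked x = heq (Arr Mark (Var x)) (Lit 0)"

definition unnumbered :: "var \<Rightarrow> hexp" where
  "unnumbered x = unmarked x && heq (Arr Pos (Var x)) (Lit 0)"

definition greedy_step :: hcom where
  "greedy_step = HIf (adj (Var U) (Var V) && adj (Var V) (Var W) && hnot (heq (Var U) (Var W)) &&
       unmarked U && unmarked V && unmarked W)
     (HSeq (SetA Mark (Var U) (Lit 1)) (HSeq (SetA Mark (Var V) (Lit 1)) (HSeq (SetA Mark (Var W) (Lit 1))
       (SetV Count (Plus (Var Count) (Lit 1)))))) HSkip"

definition greedy :: hcom where
  "greedy = For U (Var Verts) (For V (Var Verts) (For W (Var Verts) greedy_step))"

definition number :: "var \<Rightarrow> hcom" where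
  "number x = HSeq (SetV Temp (Plus (Var Temp) (Lit 1))) (SetA Pos (Var x) (Var Temp))"

definition number_pairs :: hcom where
  "number_pairs = For U (Var Verts) (For V (Var Verts)
     (HIf (adj (Var U) (Var V) && unnumbered U && unnumbered V) (HSeq (number U) (number V)) HSkip))"

definition number_rest :: hcom where
  "number_rest = For U (Var Verts) (HIf (unnumbered U) (number U) HSkip)"

definition sixfold :: "hexp \<Rightarrow> hexp" where
  "sixfold x = (let t = Plus x (Plus x x) in Plus t t)"

definition fourfold :: "hexp \<Rightarrow> hexp" where
  "fourfold x = (let t = Plus x x in Plus t t)"

text \<open>The initial search state is constantly 0 and has code 0. Its queue entry is therefore
  already present in the untouched memory, and only its length and its mark have to be
  entered.\<close>

definition start_search :: hcom where
  "start_search = HSeq (SetV Budget (Minus (sixfold (Var Param)) (fourfold (Var Count))))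
     (HSeq (SetV Tail (Var Dim)) (SetA Seen (Lit 0) (Lit 1)))"

definition decide :: hcom where
  "decide = HIf (hle (Var Param) (Var Count)) (SetV Answer (Lit 1)) (HSeq start_search explore)"

definition number_all :: hcom where
  "number_all = HSeq (SetV Temp (Lit 0)) (HSeq number_pairs number_rest)"

definition set_dims :: hcom where
  "set_dims = HSeq (SetV Dim (Plus (Var Verts) (Lit 2))) (SetV Base (Plus (Var Verts) (Lit 5)))"

definition program :: hcom where
  "program = HSeq fill_rows (HSeq set_dims (HSeq greedy (HSeq number_all decide)))"

definition start_state :: "ugraph \<Rightarrow> nat \<Rightarrow> state" where
  "start_state G k l = (case l of X x \<Rightarrow> if x = Verts then nverts G else if x = Param then k else 0
     | Y a i \<Rightarrow> 0
     | In i \<Rightarrow> if i < nverts G * nverts G \<and> {i div nverts G, i mod nverts G} \<in> edges G then 1 else 0)"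

section \<open>Numbering the vertices outside a packing\<close>

lemma subset_order_props: "reflp (\<subseteq>)" "transp (\<subseteq>)"
  by (auto simp: reflp_def transp_def)

text \<open>Extension of partial functions, with 0 for undefined.\<close>

definition extends :: "(nat \<Rightarrow> nat) \<Rightarrow> (nat \<Rightarrow> nat) \<Rightarrow> bool" where
  "extends p p' \<longleftrightarrow> (\<forall>v. p v \<noteq> 0 \<longrightarrow> p' v = p v)"

lemma extends_order_props: "reflp extends" "transp extends"
  by (auto simp: reflp_def transp_def extends_def)

definition numbered :: "(nat \<Rightarrow> nat) \<Rightarrow> nat set" where
  "numbered p = {v. p v \<noteq> 0}"

text \<open>A partial numbering that treats components as a whole: outside neighbours of a numbered
  vertex are numbered, too, with an adjacent number. As no number exceeds the count of numbered
  vertices, the next number is free.\<close>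

definition numbering :: "ugraph \<Rightarrow> nat set \<Rightarrow> (nat \<Rightarrow> nat) \<Rightarrow> bool" where
  "numbering G S p \<longleftrightarrow> numbered p \<subseteq> {..<nverts G} - S \<and> inj_on p (numbered p) \<and>
     (\<forall>v. p v \<le> card (numbered p)) \<and>
     (\<forall>u v. {u, v} \<in> edges G \<longrightarrow> u \<notin> S \<longrightarrow> v \<notin> S \<longrightarrow> p u \<noteq> 0 \<longrightarrow>
        p v \<noteq> 0 \<and> (p u = Suc (p v) \<or> p v = Suc (p u)))"

lemma numbering_finite: "numbering G S p \<Longrightarrow> finite (numbered p)"
  unfolding numbering_def by (meson finite_Diff finite_lessThan finite_subset)

lemma numbering_card: "numbering G S p \<Longrightarrow> card (numbered p) \<le> nverts G"
  unfolding numbering_def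
  by (metis card_lessThan card_mono finite_lessThan Diff_subset subset_trans)

text \<open>Outside neighbours are unique, so an edge outside \<open>S\<close> is a complete
  component and may receive the next two numbers.\<close>

lemma numbering_pair:
  assumes p: "numbering G S p" and simple: "simple_graph G"
    and unique: "\<forall>x y z. {x, y} \<in> edges G \<longrightarrow> {x, z} \<in> edges G \<longrightarrow> x \<notin> S \<longrightarrow> y \<notin> S \<longrightarrow> z \<notin> S \<longrightarrow> y = z"
    and uv: "{u, v} \<in> edges G" "u \<notin> S" "v \<notin> S" "p u = 0" "p v = 0"
  defines "c \<equiv> card (numbered p)"
  shows "numbering G S (p(u := Suc c, v := Suc (Suc c)))" "card (numbered (p(u := Suc c, v := Suc (Suc c)))) = Suc (Suc c)"
    "extends p (p(u := Suc c, v := Suc (Suc c)))"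
proof -
  let ?p = "p(u := Suc c, v := Suc (Suc c))"
  have ne: "u \<noteq> v" and lt: "u < nverts G" "v < nverts G" using edge_less[OF simple uv(1)] by auto
  have num: "numbered ?p = insert u (insert v (numbered p))" using ne by (auto simp: numbered_def)
  show card: "card (numbered ?p) = Suc (Suc c)"
  proof -
    have "u \<notin> numbered p" "v \<notin> numbered p" using uv by (simp_all add: numbered_def)
    then show ?thesis unfolding num using ne numbering_finite[OF p] by (simp add: c_def)
  qed
  show "extends p ?p" using uv by (auto simp: extends_def)
  have le: "p w \<le> c" for w using p by (simp add: numbering_def c_def)
  have inj: "inj_on ?p (numbered ?p)"
  proof (rule inj_onI)
    fix x y assume "x \<in> numbered ?p" "y \<in> numbered ?p" "?p x = ?p y"
    moreover have "inj_on p (numbered p)" using p by (simp add: numbering_def)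
    ultimately show "x = y" using le[of x] le[of y] unfolding num
      by (auto simp: inj_on_def split: if_splits)
  qed
  have adj: "?p y \<noteq> 0 \<and> (?p x = Suc (?p y) \<or> ?p y = Suc (?p x))"
    if xy: "{x, y} \<in> edges G" "x \<notin> S" "y \<notin> S" "?p x \<noteq> 0" for x y
  proof -
    consider "x = u" | "x = v" | "x \<noteq> u" "x \<noteq> v" by blast
    then show ?thesis
    proof cases
      case 1
      then have "y = v" using unique xy uv by blast
      then show ?thesis using 1 ne by simp
    next
      case 2
      then have "y = u" using unique xy uv by (metis insert_commute)
      then show ?thesis using 2 ne by simp
    next
      case 3
      then have "p y \<noteq> 0 \<and> (p x = Suc (p y) \<or> p y = Suc (p x))"
        using p xy unfolding numbering_def by auto
      moreover from this have "y \<noteq> u" "y \<noteq> v" using uv by auto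
      ultimately show ?thesis using 3 by simp
    qed
  qed
  have "numbered ?p \<subseteq> {..<nverts G} - S" using p lt uv unfolding num numbering_def by auto
  moreover have "?p w \<le> card (numbered ?p)" for w using le[of w] card by simp
  ultimately show "numbering G S ?p" using inj adj unfolding numbering_def by blast
qed

lemma numbering_single:
  assumes p: "numbering G S p" and u: "u < nverts G" "u \<notin> S" "p u = 0"
    and isolated: "\<And>v. {u, v} \<in> edges G \<Longrightarrow> v \<in> S"
  defines "c \<equiv> card (numbered p)"
  shows "numbering G S (p(u := Suc c))" "card (numbered (p(u := Suc c))) = Suc c" "extends p (p(u := Suc c))"
proof -
  let ?p = "p(u := Suc c)"
  have num: "numbered ?p = insert u (numbered p)" by (auto simp: numbered_def)
  show card: "card (numbered ?p) = Suc c"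
  proof -
    have "u \<notin> numbered p" using u by (simp add: numbered_def)
    then show ?thesis unfolding num using numbering_finite[OF p] by (simp add: c_def)
  qed
  show "extends p ?p" using u by (auto simp: extends_def)
  have le: "p w \<le> c" for w using p by (simp add: numbering_def c_def)
  have inj: "inj_on ?p (numbered ?p)"
  proof (rule inj_onI)
    fix x y assume "x \<in> numbered ?p" "y \<in> numbered ?p" "?p x = ?p y"
    moreover have "inj_on p (numbered p)" using p by (simp add: numbering_def)
    ultimately show "x = y" using le[of x] le[of y] unfolding num
      by (auto simp: inj_on_def split: if_splits)
  qed
  have adj: "?p y \<noteq> 0 \<and> (?p x = Suc (?p y) \<or> ?p y = Suc (?p x))"
    if xy: "{x, y} \<in> edges G" "x \<notin> S" "y \<notin> S" "?p x \<noteq> 0" for x y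
  proof -
    have "x \<noteq> u" "y \<noteq> u" using isolated[of y] isolated[of x] xy by (auto simp: insert_commute)
    then show ?thesis using p xy unfolding numbering_def by auto
  qed
  have "numbered ?p \<subseteq> {..<nverts G} - S" using p u unfolding num numbering_def by auto
  moreover have "?p w \<le> card (numbered ?p)" for w using le[of w] card by simp
  ultimately show "numbering G S ?p" using inj adj unfolding numbering_def by blast
qed

text \<open>\<open>K\<close> hides how the states are counted. The assumption ranges over all
  \<open>P\<close> and \<open>pos\<close> because the program determines these only at run
  time.\<close>

locale graph_input =
  fixes G :: ugraph and k m K :: nat
  assumes simple: "simple_graph G"
    and m_large: "((nverts G + 5) ^ (nverts G + 2) + 1) * (nverts G + 2) \<le> m"
    and m_param: "6 * k \<le> m"
    and few_states: "\<And>P pos. path_search G P pos k \<Longrightarrow>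
      card {f. path_search.sane G P pos f \<and> path_search.valid G P k f} \<le> K"
begin

abbreviation "n \<equiv> nverts G"
abbreviation "b \<equiv> n + 5"
abbreviation "hoare \<equiv> ht m (n * n)"

section \<open>The greedy phase\<close>

lemma m_bounds: "n * n \<le> m" "b \<le> m" "1 \<le> m" "n \<le> m" "n * n + n \<le> m"
proof -
  have "b ^ 2 \<le> b ^ (n + 2)" by (rule power_increasing) auto
  also have "\<dots> \<le> (b ^ (n + 2) + 1) * (n + 2)" by simp
  finally have "b * b \<le> m" using m_large by (simp only: power2_eq_square)
  moreover have "n * n + n \<le> b * b" "b \<le> b * b" by (simp_all add: algebra_simps)
  ultimately show "n * n \<le> m" "b \<le> m" "1 \<le> m" "n \<le> m" "n * n + n \<le> m" by linarith+
qed

definition graph_env :: "state \<Rightarrow> bool" where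
  "graph_env s \<longleftrightarrow> s (X Verts) = n \<and> s (X Param) = k \<and> s (X Dim) = n + 2 \<and> s (X Base) = b \<and>
     (\<forall>u<n. s (Y Row u) = u * n) \<and>
     (\<forall>u<n. \<forall>v<n. s (In (u * n + v)) = (if {u, v} \<in> edges G then 1 else 0)) \<and>
     s (X Head) = 0 \<and> s (X Answer) = 0 \<and> (\<forall>i. s (Y Queue i) = 0) \<and> (\<forall>i. s (Y Seen i) = 0)"

lemma fill_rows_correct:
  "hoare fill_rows (start_state G k) (6 * b) (\<lambda>s. (\<forall>u<n. s (Y Row u) = u * n) \<and>
    frame ({X U, X Temp} \<union> range (Y Row)) (start_state G k) s)"
  unfolding fill_rows_def
proof (rule ht_For[where k = n and T = 2 and I = "\<lambda>i s. (\<forall>u<i. s (Y Row u) = u * n) \<and> s (X Temp) = i * n \<and> i \<le> n \<and>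
    frame ({X U, X Temp} \<union> range (Y Row)) (start_state G k) s"])
  let ?A = "{X U, X Temp} \<union> range (Y Row)"
  have v: "s (X Verts) = n" if "frame ?A (start_state G k) s" for s
    using that by (auto simp: frame_def start_state_def)
  fix i s assume i: "i < n" "s (X U) = i" and I: "(\<forall>u<i. s (Y Row u) = u * n) \<and> s (X Temp) = i * n \<and> i \<le> n \<and>
    frame ?A (start_state G k) s"
  have "i * n + n = Suc i * n" by simp
  also have "\<dots> \<le> n * n" using i by (intro mult_le_mono1) simp
  finally have "i * n + n \<le> m" using m_bounds(1) by linarith
  then show "hoare (HSeq (SetA Row (Var U) (Var Temp)) (SetV Temp (Plus (Var Temp) (Var Verts)))) s 2
    (\<lambda>s'. s' (X U) = i \<and> (\<forall>u<Suc i. (s'(X U := Suc i)) (Y Row u) = u * n) \<and> (s'(X U := Suc i)) (X Temp) = Suc i * n \<and>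
      Suc i \<le> n \<and> frame ?A (start_state G k) (s'(X U := Suc i)))"
    using I i v by (intro ht_wps) (auto simp: less_Suc_eq)
next
  fix i s assume "(\<forall>u<i. s (Y Row u) = u * n) \<and> s (X Temp) = i * n \<and> i \<le> n \<and>
    frame ({X U, X Temp} \<union> range (Y Row)) (start_state G k) s"
  then show "fits m (n * n) (Var Verts) s \<and> hval (Var Verts) s = n"
    by (auto simp: frame_def start_state_def)
qed (use m_bounds(3,4) in \<open>auto simp: start_state_def\<close>)

lemma graph_adj:
  assumes "graph_env s" "s (X x) = u" "s (X y) = v" "u < n" "v < n"
  shows "fits m (n * n) (adj (Var x) (Var y)) s" "holds (adj (Var x) (Var y)) s \<longleftrightarrow> {u, v} \<in> edges G"
  using assms adj_correct[of s u n v "edges G" x y m] m_bounds(1) by (simp_all add: graph_env_def)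

lemma graph_env_cong:
  assumes "frame ({X U, X V, X W, X Count, X Temp} \<union> range (Y Mark) \<union> range (Y Pos)) s s'" "graph_env s"
  shows "graph_env s'"
proof -
  have "x \<notin> {U, V, W, Count, Temp} \<Longrightarrow> s' (X x) = s (X x)"
    "a \<notin> {Mark, Pos} \<Longrightarrow> s' (Y a i) = s (Y a i)" "s' (In i) = s (In i)" for x a i
    using assms(1) by (auto simp: frame_def)
  with assms(2) show ?thesis unfolding graph_env_def by simp
qed

definition marks :: "(nat \<times> nat \<times> nat) set \<Rightarrow> state \<Rightarrow> bool" where
  "marks P s \<longleftrightarrow> graph_env s \<and> packing G P \<and> (\<forall>v<n. s (Y Mark v) = (if v \<in> verts P then 1 else 0)) \<and>
     s (X Count) = card P"

definition greedy_inv :: "(nat \<times> nat \<times> nat) set \<Rightarrow> state \<Rightarrow> bool" where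
  "greedy_inv P s \<longleftrightarrow> marks P s \<and> (\<forall>v. s (Y Pos v) = 0)"

lemma marks_cong:
  assumes "frame ({X U, X V, X W, X Temp} \<union> range (Y Pos)) s s'" "marks P s"
  shows "marks P s'"
proof -
  have "graph_env s'" using graph_env_cong[of s s'] assms by (auto simp: marks_def frame_def)
  moreover have "s' (X Count) = s (X Count)" "s' (Y Mark v) = s (Y Mark v)" for v
    using assms(1) by (auto simp: frame_def)
  ultimately show ?thesis using assms(2) by (simp add: marks_def)
qed

lemma greedy_inv_upd: "x \<in> {U, V, W} \<Longrightarrow> greedy_inv P s \<Longrightarrow> greedy_inv P (s(X x := i))"
  using marks_cong[of s "s(X x := i)" P] by (auto simp: greedy_inv_def)

lemma unmarked_correct:
  assumes "marks P s" "s (X x) = u" "u < n"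
  shows "fits m (n * n) (unmarked x) s" "holds (unmarked x) s \<longleftrightarrow> u \<notin> verts P"
  using assms m_bounds(3) by (auto simp: marks_def unmarked_def)

definition blocked :: "nat \<Rightarrow> nat \<Rightarrow> nat \<Rightarrow> (nat \<times> nat \<times> nat) set \<Rightarrow> bool" where
  "blocked u v w P \<longleftrightarrow> (is_P2 G (u, v, w) \<longrightarrow> path_verts (u, v, w) \<inter> verts P \<noteq> {})"

lemma blocked_mono: "blocked u v w P \<Longrightarrow> P \<subseteq> P' \<Longrightarrow> blocked u v w P'"
  unfolding blocked_def verts_def by blast

lemma greedy_step_correct:
  assumes inv: "greedy_inv P s" and uvw: "s (X U) = u" "s (X V) = v" "s (X W) = w" "u < n" "v < n" "w < n"
  shows "hoare greedy_step s (8 * b ^ 0) (\<lambda>s'. keeps s s' \<and> (\<exists>P'. P \<subseteq> P' \<and> greedy_inv P' s' \<and> blocked u v w P'))"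
proof (rule ht_wps)
  have m: "marks P s" and env: "graph_env s" using inv by (auto simp: greedy_inv_def marks_def)
  let ?g = "{u, v} \<in> edges G \<and> {v, w} \<in> edges G \<and> u \<noteq> w \<and> u \<notin> verts P \<and> v \<notin> verts P \<and> w \<notin> verts P"
  let ?Q = "\<lambda>s'. keeps s s' \<and> (\<exists>P'. P \<subseteq> P' \<and> greedy_inv P' s' \<and> blocked u v w P')"
  let ?s = "s(Y Mark u := 1, Y Mark v := 1, Y Mark w := 1, X Count := card P + 1)"
  have no: "?Q s" if "\<not> ?g"
  proof -
    have "blocked u v w P" using that by (auto simp: blocked_def)
    then show ?thesis using inv by (auto simp: keeps_def)
  qed
  have yes: "?Q ?s" if g: ?g
  proof -
    have P2: "is_P2 G (u, v, w)" using g edge_less[OF simple] by auto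
    have PP: "packing G P" using m by (simp add: marks_def)
    have new: "packing G (insert (u, v, w) P)" "(u, v, w) \<notin> P"
      using packing_insert[OF PP P2] g by auto
    have "graph_env ?s" using graph_env_cong[OF _ env, of ?s] by simp
    moreover have "?s (Y Mark x) = (if x \<in> verts (insert (u, v, w) P) then 1 else 0)" if "x < n" for x
      using m that by (auto simp: marks_def verts_def)
    moreover have "?s (X Count) = card (insert (u, v, w) P)" using new packing_finite[OF PP] by simp
    ultimately have "marks (insert (u, v, w) P) ?s" using new unfolding marks_def by blast
    then have "greedy_inv (insert (u, v, w) P) ?s" using inv by (simp add: greedy_inv_def)
    moreover have "blocked u v w (insert (u, v, w) P)" by (auto simp: blocked_def verts_def)
    moreover have "keeps s ?s" by (simp add: keeps_def)
    ultimately show ?thesis by blast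
  qed
  have "card P + 1 \<le> m"
    using card_packing_le[OF simple, of P] m m_bounds(2) by (simp add: marks_def)
  then show "wps m (n * n) greedy_step ?Q s"
    using no yes m_bounds(3) uvw m graph_adj[OF env uvw(1,2,4,5)] graph_adj[OF env uvw(2,3,5,6)]
      unmarked_correct[OF m uvw(1,4)] unmarked_correct[OF m uvw(2,5)] unmarked_correct[OF m uvw(3,6)]
    by (simp add: greedy_step_def marks_def)
qed (simp add: greedy_step_def)

lemma greedy_inv_Verts: "greedy_inv P s \<Longrightarrow> s (X Verts) = n"
  by (simp add: greedy_inv_def marks_def graph_env_def)

lemma b_bounds: "n \<le> b" "1 \<le> b"
  by simp_all

text \<open>A triple that is blocked stays blocked when the packing grows; this is why a single pass
  over all triples gives a maximal packing.\<close>

lemma greedy_correct: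
  assumes "greedy_inv P s"
  shows "hoare greedy s (20 * b ^ 3) (\<lambda>s'. \<exists>P'. greedy_inv P' s' \<and>
    (\<forall>p. is_P2 G p \<longrightarrow> path_verts p \<inter> verts P' \<noteq> {}))"
  unfolding greedy_def
proof (rule ht_For3[where le = "(\<subseteq>)" and k = n and b = b and t = 8 and r = 0 and ?q0.0 = P
      and J = greedy_inv and G = blocked])
  fix u v w P s
  assume "u < n" "v < n" "w < n" "greedy_inv P s" "s (X U) = u" "s (X V) = v" "s (X W) = w"
  then show "hoare greedy_step s (8 * b ^ 0) (\<lambda>s'. s' (X U) = u \<and> s' (X V) = v \<and> s' (X W) = w \<and>
      (\<exists>P'. P \<subseteq> P' \<and> greedy_inv P' s' \<and> blocked u v w P'))"
    by (intro ht_conseq[OF greedy_step_correct[where u = u and v = v and w = w] order_refl]) (auto simp: keeps_def)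
next
  show "fits m (n * n) (Var Verts) s \<and> hval (Var Verts) s = n" if "greedy_inv P s" for P s
    using greedy_inv_Verts[OF that] by simp
  show "blocked u v w P'" if "blocked u v w P" "P \<subseteq> P'" for u v w P P'
    using that by (rule blocked_mono)
  fix P' s' assume *: "greedy_inv P' s'" "\<forall>u<n. \<forall>v<n. \<forall>w<n. blocked u v w P'"
  have "path_verts p \<inter> verts P' \<noteq> {}" if "is_P2 G p" for p
  proof -
    obtain u v w where p: "p = (u, v, w)" by (cases p)
    then have "u < n" "v < n" "w < n" using is_P2_less[OF simple that] by auto
    then show ?thesis using * that unfolding blocked_def p by blast
  qed
  then show "\<exists>P'. greedy_inv P' s' \<and> (\<forall>p. is_P2 G p \<longrightarrow> path_verts p \<inter> verts P' \<noteq> {})" using * by blast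
qed (use assms greedy_inv_upd subset_order_props m_bounds(3,4) in auto)

section \<open>Numbering relative to a maximal packing\<close>

context
  fixes P
  assumes maximal: "\<forall>p. is_P2 G p \<longrightarrow> path_verts p \<inter> verts P \<noteq> {}"
begin

text \<open>Two outside neighbours of an outside vertex would form a path disjoint from the
  packing.\<close>

lemma unique_neighbour:
  "\<forall>x y z. {x, y} \<in> edges G \<longrightarrow> {x, z} \<in> edges G \<longrightarrow> x \<notin> verts P \<longrightarrow> y \<notin> verts P \<longrightarrow> z \<notin> verts P \<longrightarrow> y = z"
proof (intro allI impI, rule ccontr)
  fix x y z
  assume *: "{x, y} \<in> edges G" "{x, z} \<in> edges G" "x \<notin> verts P" "y \<notin> verts P" "z \<notin> verts P" "y \<noteq> z"
  then have "is_P2 G (y, x, z)" using edge_less[OF simple] by (auto simp: insert_commute)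
  then have "path_verts (y, x, z) \<inter> verts P \<noteq> {}" using maximal by blast
  then show False using * by simp
qed

definition number_inv :: "(nat \<Rightarrow> nat) \<Rightarrow> state \<Rightarrow> bool" where
  "number_inv p s \<longleftrightarrow> marks P s \<and> numbering G (verts P) p \<and> (\<forall>v<n. s (Y Pos v) = p v) \<and>
     s (X Temp) = card (numbered p)"

lemma number_inv_upd: "x \<in> {U, V, W} \<Longrightarrow> number_inv p s \<Longrightarrow> number_inv p (s(X x := i))"
  using marks_cong[of s "s(X x := i)" P] by (auto simp: number_inv_def)

lemma number_inv_Verts: "number_inv p s \<Longrightarrow> s (X Verts) = n"
  by (simp add: number_inv_def marks_def graph_env_def)

lemma unnumbered_correct:
  assumes "number_inv p s" "s (X x) = u" "u < n"
  shows "fits m (n * n) (unnumbered x) s" "holds (unnumbered x) s \<longleftrightarrow> u \<notin> verts P \<and> p u = 0"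
  using assms unmarked_correct[of P s x u] m_bounds(3) by (auto simp: number_inv_def unnumbered_def)

definition pair_done :: "nat \<Rightarrow> nat \<Rightarrow> (nat \<Rightarrow> nat) \<Rightarrow> bool" where
  "pair_done u v p \<longleftrightarrow> ({u, v} \<in> edges G \<longrightarrow> u \<notin> verts P \<longrightarrow> v \<notin> verts P \<longrightarrow> p u \<noteq> 0)"

lemma pair_done_mono: "pair_done u v p \<Longrightarrow> extends p p' \<Longrightarrow> pair_done u v p'"
  unfolding pair_done_def extends_def by metis

lemma number_pair_correct:
  assumes inv: "number_inv p s" and uv: "s (X U) = u" "s (X V) = v" "u < n" "v < n"
  shows "hoare (HIf (adj (Var U) (Var V) && unnumbered U && unnumbered V) (HSeq (number U) (number V)) HSkip) s
    (8 * b ^ 0) (\<lambda>s'. keeps s s' \<and> (\<exists>p'. extends p p' \<and> number_inv p' s' \<and> pair_done u v p'))"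
    (is "hoare ?c s _ ?Q")
proof (rule ht_wps)
  have m: "marks P s" and env: "graph_env s" and num: "numbering G (verts P) p"
    and s: "\<forall>v<n. s (Y Pos v) = p v" "s (X Temp) = card (numbered p)"
    using inv by (auto simp: number_inv_def marks_def)
  define c where "c = card (numbered p)"
  let ?g = "{u, v} \<in> edges G \<and> u \<notin> verts P \<and> v \<notin> verts P \<and> p u = 0 \<and> p v = 0"
  let ?s = "s(Y Pos u := Suc c, X Temp := Suc (Suc c), Y Pos v := Suc (Suc c))"
  have no: "?Q s" if ng: "\<not> ?g"
  proof -
    have "pair_done u v p"
      unfolding pair_done_def
    proof (intro impI)
      assume *: "{u, v} \<in> edges G" "u \<notin> verts P" "v \<notin> verts P"
      \<comment> \<open>The test failed although the edge lies outside the packing, so one end has a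
        number; the numbering condition carries this over to the other end.\<close>
      then have "p u \<noteq> 0 \<or> p v \<noteq> 0" using ng by auto
      moreover have "p u \<noteq> 0" if "p v \<noteq> 0"
        using num * that unfolding numbering_def by (metis insert_commute)
      ultimately show "p u \<noteq> 0" by blast
    qed
    then show ?thesis using inv extends_order_props(1) by (auto simp: keeps_def reflp_def)
  qed
  have yes: "?Q ?s" if g: ?g
  proof -
    let ?p = "p(u := Suc c, v := Suc (Suc c))"
    note new = numbering_pair[OF num simple unique_neighbour, of u v, folded c_def]
    have "marks P ?s" using marks_cong[OF _ m, of ?s] by simp
    then have "number_inv ?p ?s" using new g s by (simp add: number_inv_def)
    moreover have "pair_done u v ?p" by (simp add: pair_done_def)
    moreover have "keeps s ?s" by (simp add: keeps_def)
    ultimately show ?thesis using new(3) g by (intro conjI exI[of _ ?p]) auto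
  qed
  have le: "c + 2 \<le> m" if ?g
    using numbering_pair(1,2)[OF num simple unique_neighbour, of u v] numbering_card that m_bounds(4)
    unfolding c_def[symmetric] by (metis add_2_eq_Suc' le_trans)
  have ne: "u \<noteq> v" if ?g using that edge_less[OF simple] by blast
  have upd: "s(X Temp := Suc c, Y Pos u := Suc c, X Temp := Suc (Suc c), Y Pos v := Suc (Suc c)) = ?s"
    by (simp add: fun_upd_twist)
  note guards = graph_adj[OF env uv(1,2,3,4)] unnumbered_correct[OF inv uv(1,3)] unnumbered_correct[OF inv uv(2,4)]
  show "wps m (n * n) ?c ?Q s"
  proof (cases ?g)
    case True
    then show ?thesis using yes[OF True] le[OF True] ne[OF True] upd guards m_bounds(3) uv s(2)
      by (simp add: number_def c_def[symmetric])
  next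
    case False
    then show ?thesis using no[OF False] guards m_bounds(3) by auto
  qed
qed (simp add: number_def)

lemma number_rest_step:
  assumes inv: "number_inv p s" and u: "s (X U) = u" "u < n" and pairs: "\<forall>v<n. pair_done u v p"
  shows "hoare (HIf (unnumbered U) (number U) HSkip) s
    (8 * b ^ 0) (\<lambda>s'. keeps s s' \<and> (\<exists>p'. extends p p' \<and> number_inv p' s' \<and> (u \<notin> verts P \<longrightarrow> p' u \<noteq> 0)))"
    (is "hoare ?c s _ ?Q")
proof (rule ht_wps)
  have m: "marks P s" and num: "numbering G (verts P) p"
    and s: "\<forall>v<n. s (Y Pos v) = p v" "s (X Temp) = card (numbered p)"
    using inv by (auto simp: number_inv_def marks_def)
  define c where "c = card (numbered p)"
  let ?g = "u \<notin> verts P \<and> p u = 0"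
  let ?s = "s(X Temp := Suc c, Y Pos u := Suc c)"
  have no: "?Q s" if "\<not> ?g"
    using that inv extends_order_props(1) by (auto simp: keeps_def reflp_def)
  \<comment> \<open>After the pass over all pairs both ends of every outside edge are numbered, so a
    vertex still without number is isolated outside the packing.\<close>
  have iso: "v \<in> verts P" if ?g "{u, v} \<in> edges G" for v
    using pairs that edge_less[OF simple that(2)] unfolding pair_done_def by blast
  have yes: "?Q ?s" if g: ?g
  proof -
    let ?p = "p(u := Suc c)"
    note new = numbering_single[OF num u(2), folded c_def]
    have "marks P ?s" using marks_cong[OF _ m, of ?s] by simp
    then have "number_inv ?p ?s" using new g s iso by (simp add: number_inv_def)
    moreover have "keeps s ?s" by (simp add: keeps_def)
    ultimately show ?thesis using new(3) g iso by (intro conjI exI[of _ ?p]) auto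
  qed
  have "c + 1 \<le> m" using numbering_card[OF num] m_bounds(2) by (simp add: c_def)
  then show "wps m (n * n) ?c ?Q s"
    using no yes m_bounds(3) u s(2) unnumbered_correct[OF inv u]
    by (simp add: number_def c_def[symmetric])
qed (simp add: number_def)

lemma number_pairs_correct:
  assumes "number_inv p s"
  shows "hoare number_pairs s (16 * b ^ 2) (\<lambda>s'. \<exists>p'. number_inv p' s' \<and> (\<forall>u<n. \<forall>v<n. pair_done u v p'))"
  unfolding number_pairs_def
proof (rule ht_For2[where le = extends and k = n and b = b and t = 8 and r = 0 and ?q0.0 = p
      and J = number_inv and G = pair_done])
  fix u v p s assume "u < n" "v < n" "number_inv p s" "s (X U) = u" "s (X V) = v"
  then show "hoare (HIf (adj (Var U) (Var V) && unnumbered U && unnumbered V) (HSeq (number U) (number V)) HSkip) s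
      (8 * b ^ 0) (\<lambda>s'. s' (X U) = u \<and> s' (X V) = v \<and> (\<exists>p'. extends p p' \<and> number_inv p' s' \<and> pair_done u v p'))"
    by (intro ht_conseq[OF number_pair_correct[where u = u and v = v] order_refl]) (auto simp: keeps_def)
next
  show "fits m (n * n) (Var Verts) s \<and> hval (Var Verts) s = n" if "number_inv p s" for p s
    using number_inv_Verts[OF that] by simp
  show "pair_done u v p'" if "pair_done u v p" "extends p p'" for u v p p'
    using that by (rule pair_done_mono)
qed (use assms number_inv_upd extends_order_props m_bounds(3,4) in \<open>auto simp: power2_eq_square\<close>)

lemma number_rest_correct:
  assumes "number_inv p s" "\<forall>u<n. \<forall>v<n. pair_done u v p"
  shows "hoare number_rest s (12 * b ^ 1) (\<lambda>s'. \<exists>p'. number_inv p' s' \<and> (\<forall>u<n. u \<notin> verts P \<longrightarrow> p' u \<noteq> 0))"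
  unfolding number_rest_def
proof (rule ht_For_grow[where le = extends and k = n and T = "8 * b ^ 0" and ?q0.0 = p
      and J = "\<lambda>p s. number_inv p s \<and> (\<forall>u<n. \<forall>v<n. pair_done u v p)" and G = "\<lambda>u p. u \<notin> verts P \<longrightarrow> p u \<noteq> 0"])
  fix i p s assume *: "i < n" "number_inv p s \<and> (\<forall>u<n. \<forall>v<n. pair_done u v p)" "s (X U) = i"
  show "hoare (HIf (unnumbered U) (number U) HSkip) s (8 * b ^ 0) (\<lambda>s'. s' (X U) = i \<and>
      (\<exists>p'. extends p p' \<and> (number_inv p' s' \<and> (\<forall>u<n. \<forall>v<n. pair_done u v p')) \<and> (i \<notin> verts P \<longrightarrow> p' i \<noteq> 0)))"
  proof (rule ht_conseq[OF number_rest_step[of p s i] order_refl])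
    fix s' assume "keeps s s' \<and> (\<exists>p'. extends p p' \<and> number_inv p' s' \<and> (i \<notin> verts P \<longrightarrow> p' i \<noteq> 0))"
    then show "s' (X U) = i \<and> (\<exists>p'. extends p p' \<and> (number_inv p' s' \<and> (\<forall>u<n. \<forall>v<n. pair_done u v p')) \<and>
        (i \<notin> verts P \<longrightarrow> p' i \<noteq> 0))"
      using * pair_done_mono unfolding keeps_def by (metis insertCI)
  qed (use * in auto)
next
  show "2 + n * (8 * b ^ 0 + 2) \<le> 12 * b ^ 1" using loop_time[OF b_bounds, of 8 0] by simp
  show "fits m (n * n) (Var Verts) s \<and> hval (Var Verts) s = n"
    if "number_inv p s \<and> (\<forall>u<n. \<forall>v<n. pair_done u v p)" for p s
    using that number_inv_Verts[of p s] by simp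
  show "i \<notin> verts P \<longrightarrow> p' i \<noteq> 0" if "i \<notin> verts P \<longrightarrow> p i \<noteq> 0" "extends p p'" for i p p'
    using that by (auto simp: extends_def)
qed (use assms number_inv_upd extends_order_props m_bounds(3,4) in auto)

lemma numbered_path_search:
  assumes inv: "number_inv p s" and all: "\<forall>u<n. u \<notin> verts P \<longrightarrow> p u \<noteq> 0" and small: "card P < k"
  shows "path_search G P p k"
proof
  have num: "numbering G (verts P) p" and PP: "packing G P" using inv by (auto simp: number_inv_def marks_def)
  show "packing G P" by fact
  show "path_verts q \<inter> verts P \<noteq> {}" if "is_P2 G q" for q using maximal that by blast
  show "p v = 0 \<longleftrightarrow> v \<in> verts P" if "v < n" for v
    using all num that unfolding numbering_def numbered_def by blast
  show "inj_on p ({..<n} - verts P)"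
    by (rule inj_on_subset[of _ "numbered p"]) (use num all in \<open>auto simp: numbering_def numbered_def\<close>)
  show "p v \<le> n" for v using num numbering_card[OF num] unfolding numbering_def by (meson le_trans)
  show "p u = Suc (p v) \<or> p v = Suc (p u)" if "{u, v} \<in> edges G" "u \<notin> verts P" "v \<notin> verts P" for u v
    using num that all edge_less[OF simple that(1)] unfolding numbering_def by blast
qed (use simple small in auto)

lemma search_correct:
  assumes inv: "number_inv p s" and all: "\<forall>u<n. u \<notin> verts P \<longrightarrow> p u \<noteq> 0" and small: "card P < k"
  shows "hoare (HSeq start_search explore) s (4 + K * (313 * b ^ 5 + 1))
    (\<lambda>s'. s' (X Answer) = (if has_P2_packing G k then 1 else 0))"
proof -
  interpret S: path_search G P p k by (rule numbered_path_search[OF assms])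
  have card: "card {f. S.sane f \<and> S.valid f} \<le> b ^ (n + 2)"
    using S.card_valid_le by (simp add: S.b_def S.d_def)
  interpret R: search_run G P p k m
  proof
    show "b ^ (n + 2) \<le> m" using m_large by simp
    have "(card {f. S.sane f \<and> S.valid f} + 1) * (n + 2) \<le> (b ^ (n + 2) + 1) * (n + 2)"
      using card by (intro mult_le_mono1) simp
    then show "(card {f. S.sane f \<and> S.valid f} + 1) * (n + 2) \<le> m" using m_large by linarith
  qed
  have env: "graph_env s" and cnt: "s (X Count) = card P" and pos: "\<forall>v<n. s (Y Pos v) = p v"
    using inv by (auto simp: number_inv_def marks_def)
  let ?s = "s(X Budget := 6 * k - 4 * card P, X Tail := n + 2, Y Seen 0 := 1)"
  have zero: "horner c (\<lambda>_. 0) i = 0" for c i by (induction i) auto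
  have "R.env ?s" using env pos unfolding R.env_def graph_env_def by (simp add: S.d_def S.b_def)
  moreover have "S.reach (\<lambda>_. 0)" by (rule S.reach.Start)
  \<comment> \<open>The initial state counts no paths, and \<open>small\<close> gives
    \<open>0 < k\<close>; therefore the answer flag 0 is correct.\<close>
  ultimately have wl: "R.worklist 0 [\<lambda>_. 0] ?s"
    using env small unfolding R.worklist_def graph_env_def by (simp add: S.d_def zero)
  show ?thesis
  proof (rule ht_Seq)
    show "hoare start_search s 3 (R.worklist 0 [\<lambda>_. 0])"
    proof (rule ht_wps)
      have "s (X Param) = k" "s (X Dim) = n + 2" using env by (auto simp: graph_env_def)
      moreover have "4 * card P \<le> m" using small m_param by linarith
      moreover have "k + (k + k) + (k + (k + k)) - (card P + card P + (card P + card P)) = 6 * k - 4 * card P"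
        by simp
      ultimately show "wps m (n * n) start_search (R.worklist 0 [\<lambda>_. 0]) s"
        using wl cnt m_param m_bounds(3)
        by (simp add: start_search_def sixfold_def fourfold_def Let_def)
    qed (simp add: start_search_def)
    fix s' assume "R.worklist 0 [\<lambda>_. 0] s'"
    from R.explore_correct[OF this]
    show "hoare explore s' (1 + K * (313 * b ^ 5 + 1)) (\<lambda>s'. s' (X Answer) = (if has_P2_packing G k then 1 else 0))"
    proof (rule ht_conseq)
      have "card {f. S.sane f \<and> S.valid f} \<le> K" by (rule few_states) unfold_locales
      then show "1 + card {f. S.sane f \<and> S.valid f} * (313 * S.b ^ 5 + 1) \<le> 1 + K * (313 * b ^ 5 + 1)"
        unfolding S.b_def by (intro add_mono mult_le_mono1) simp_all
    qed
  qed simp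
qed

end

section \<open>The complete intermediate program\<close>

theorem program_correct:
  "hoare program (start_state G k) (1000 * b ^ 5 * (K + 1))
    (\<lambda>s. s (X Answer) = (if has_P2_packing G k then 1 else 0))"
  (is "hoare _ _ _ ?Q")
proof -
  have 1: "hoare decide s (5 + K * (313 * b ^ 5 + 1)) ?Q"
    if maximal: "\<forall>p. is_P2 G p \<longrightarrow> path_verts p \<inter> verts P \<noteq> {}" and inv: "number_inv P p s"
      and all: "\<forall>u<n. u \<notin> verts P \<longrightarrow> p u \<noteq> 0" for P p s
    unfolding decide_def
  proof (rule ht_If)
    have s: "s (X Param) = k" "s (X Count) = card P" and P: "packing G P"
      using inv by (auto simp: number_inv_def[OF maximal] marks_def graph_env_def)
    show "fits m (n * n) (hle (Var Param) (Var Count)) s" using m_bounds(3) by simp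
    show "hoare (SetV Answer (Lit 1)) s (4 + K * (313 * b ^ 5 + 1)) ?Q" if "holds (hle (Var Param) (Var Count)) s"
    proof -
      have "has_P2_packing G k"
        using that s has_P2_packing_mono[of G "card P" k] P by (auto simp: has_P2_packing_iff)
      then show ?thesis using m_bounds(3) by (intro ht_wps) simp_all
    qed
    show "hoare (HSeq start_search explore) s (4 + K * (313 * b ^ 5 + 1)) ?Q"
      if "\<not> holds (hle (Var Param) (Var Count)) s"
      using that s by (intro search_correct[OF maximal inv all]) simp
  qed simp
  have 2: "hoare number_all s (1 + (16 * b ^ 2 + 12 * b ^ 1))
      (\<lambda>s'. \<exists>p. number_inv P p s' \<and> (\<forall>u<n. u \<notin> verts P \<longrightarrow> p u \<noteq> 0))"
    if inv: "greedy_inv P s" and maximal: "\<forall>p. is_P2 G p \<longrightarrow> path_verts p \<inter> verts P \<noteq> {}" for P s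
    unfolding number_all_def
  proof (rule ht_Seq)
    have "marks P (s(X Temp := 0))" using inv marks_cong[of s "s(X Temp := 0)" P] by (simp add: greedy_inv_def)
    moreover have "numbering G (verts P) (\<lambda>_. 0)" by (simp add: numbering_def numbered_def)
    ultimately have "number_inv P (\<lambda>_. 0) (s(X Temp := 0))"
      using inv by (simp add: number_inv_def[OF maximal] greedy_inv_def numbered_def)
    then show "hoare (SetV Temp (Lit 0)) s 1 (number_inv P (\<lambda>_. 0))" by (intro ht_wps) simp_all
    fix s1 assume "number_inv P (\<lambda>_. 0) s1"
    note pairs = number_pairs_correct[OF maximal this]
    show "hoare (HSeq number_pairs number_rest) s1 (16 * b ^ 2 + 12 * b ^ 1)
      (\<lambda>s'. \<exists>p. number_inv P p s' \<and> (\<forall>u<n. u \<notin> verts P \<longrightarrow> p u \<noteq> 0))"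
      by (rule ht_Seq[OF pairs _ order_refl]) (use number_rest_correct[OF maximal] in blast)
  qed simp
  have 3: "hoare set_dims s 2 (greedy_inv {})"
    if s: "(\<forall>u<n. s (Y Row u) = u * n) \<and> frame ({X U, X Temp} \<union> range (Y Row)) (start_state G k) s" for s
  proof -
    have eq: "s l = start_state G k l" if "l \<notin> {X U, X Temp} \<union> range (Y Row)" for l
      using s that by (simp add: frame_def)
    have fr: "x \<notin> {U, Temp} \<Longrightarrow> s (X x) = start_state G k (X x)" "a \<noteq> Row \<Longrightarrow> s (Y a i) = 0"
      and In: "s (In i) = start_state G k (In i)" for x a i
      using eq[of "X x"] eq[of "Y a i"] eq[of "In i"] by (auto simp: start_state_def image_iff)
    have v: "s (X Verts) = n" by (simp add: fr start_state_def)
    let ?s = "s(X Dim := n + 2, X Base := b)"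
    have "s (In (u * n + v)) = (if {u, v} \<in> edges G then 1 else 0)" if "u < n" "v < n" for u v
      using index_less[OF that] that by (simp add: In start_state_def)
    then have "graph_env ?s" using s by (simp add: graph_env_def fr start_state_def)
    then have "greedy_inv {} ?s"
      by (simp add: greedy_inv_def marks_def packing_def verts_def fr start_state_def)
    then show ?thesis using v m_bounds(2) by (intro ht_wps) (simp_all add: set_dims_def)
  qed
  show ?thesis unfolding program_def
  proof (rule ht_Seq[OF fill_rows_correct])
    fix s1 assume "(\<forall>u<n. s1 (Y Row u) = u * n) \<and> frame ({X U, X Temp} \<union> range (Y Row)) (start_state G k) s1"
    note dims = 3[OF this]
    show "hoare (HSeq set_dims (HSeq greedy (HSeq number_all decide))) s1
       (2 + (20 * b ^ 3 + (1 + (16 * b ^ 2 + 12 * b ^ 1) + (5 + K * (313 * b ^ 5 + 1))))) ?Q"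
    proof (rule ht_Seq[OF dims _ order_refl])
      fix s2 assume "greedy_inv {} s2"
      note g = greedy_correct[OF this]
      show "hoare (HSeq greedy (HSeq number_all decide)) s2
        (20 * b ^ 3 + (1 + (16 * b ^ 2 + 12 * b ^ 1) + (5 + K * (313 * b ^ 5 + 1)))) ?Q"
      proof (rule ht_Seq[OF g _ order_refl])
        fix s3 assume "\<exists>P. greedy_inv P s3 \<and> (\<forall>p. is_P2 G p \<longrightarrow> path_verts p \<inter> verts P \<noteq> {})"
        then obtain P where P: "greedy_inv P s3" "\<forall>p. is_P2 G p \<longrightarrow> path_verts p \<inter> verts P \<noteq> {}" by blast
        show "hoare (HSeq number_all decide) s3
          (1 + (16 * b ^ 2 + 12 * b ^ 1) + (5 + K * (313 * b ^ 5 + 1))) ?Q"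
          by (rule ht_Seq[OF 2[OF P] _ order_refl]) (use 1[OF P(2)] in blast)
      qed
    qed
  next
    have pw: "b ^ i \<le> b ^ 5" if "i \<le> 5" for i using that by (intro power_increasing) auto
    have p: "1 \<le> b ^ 5" "b \<le> b ^ 5" "b ^ 2 \<le> b ^ 5" "b ^ 3 \<le> b ^ 5"
      using pw[of 0] pw[of 1] pw[of 2] pw[of 3] by simp_all
    have "K * 1 \<le> K * b ^ 5" by (intro mult_le_mono2) simp
    then have x: "K * (313 * b ^ 5 + 1) \<le> 314 * (K * b ^ 5)" by (simp add: algebra_simps)
    have eq: "1000 * b ^ 5 * (K + 1) = 1000 * (K * b ^ 5) + 1000 * b ^ 5" by (simp add: algebra_simps)
    have sum: "6 * u + (2 + (20 * v + (1 + (16 * w + 12 * u) + (5 + x)))) \<le> 1000 * z + 1000 * y"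
      if "1 \<le> y" "u \<le> y" "w \<le> y" "v \<le> y" "x \<le> 314 * z" for u v w x y z :: nat
      using that by linarith
    show "6 * b + (2 + (20 * b ^ 3 + (1 + (16 * b ^ 2 + 12 * b ^ 1) + (5 + K * (313 * b ^ 5 + 1)))))
        \<le> 1000 * b ^ 5 * (K + 1)"
      unfolding eq power_one_right by (rule sum[OF p x])
  qed
qed

end

section \<open>The machine program\<close>

text \<open>The base address of the intermediate language is \<open>n\<^sup>2 + 3\<close>.  While it is computed, only diagonal
  cells of the adjacency matrix (or cells behind it) serve as variables.\<close>

definition counter :: aexp where
  "counter = Add (Num 3) (Cell (Num 1))"

text \<open>Squaring by repeated addition: cell 2, the matrix entry (0, 0), collects the multiples
  of n, and cell n + 3, the entry (1, 1), counts the rounds.\<close>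

definition square_loop :: com where
  "square_loop = While (Sub (Cell (Num 1)) (Cell counter))
     (Seq (Store (Num 2) (Add (Cell (Num 2)) (Cell (Num 1)))) (Store counter (Add (Cell counter) (Num 1))))"

text \<open>The order matters. The counter is cleared first because for n <= 1 its cell is also the
  cell of \<open>Verts\<close>; the parameter is copied before the base address overwrites it; and
  cell 2, which holds the square, is restored last.\<close>

definition input_copy :: com where
  "input_copy = Seq (Store counter (Num 0))
     (Seq (Store (Add (Num (3 + 8 * var_index Verts)) (Cell (Num 2))) (Cell (Num 1)))
     (Seq (Store (Add (Num (3 + 8 * var_index Param)) (Cell (Num 2))) (Cell (Num 0)))
     (Seq (Store (Num 0) (Add (Cell (Num 2)) (Num 3))) (Store (Num 2) (Num 0)))))"

lemma exec_Store_below: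
  assumes "below K a \<sigma>" "below K b \<sigma>" "\<sigma>' = \<sigma>(aval a \<sigma> := aval b \<sigma>)"
  shows "\<exists>t\<le>com_size (Store a b) * len K. exec (Store a b) \<sigma> t \<sigma>'"
  using exec.Store[of a b \<sigma>] store_cost[OF assms(1,2)] assms(3) by blast

lemma exec_Seq_below:
  assumes "\<exists>t\<le>T1. exec c1 \<sigma> t \<sigma>1" "\<exists>t\<le>T2. exec c2 \<sigma>1 t \<sigma>2" "T1 + T2 \<le> T"
  shows "\<exists>t\<le>T. exec (Seq c1 c2) \<sigma> t \<sigma>2"
proof -
  obtain t1 t2 where "t1 \<le> T1" "exec c1 \<sigma> t1 \<sigma>1" "t2 \<le> T2" "exec c2 \<sigma>1 t2 \<sigma>2" using assms(1,2) by blast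
  then have "exec (Seq c1 c2) \<sigma> (t1 + t2) \<sigma>2" "t1 + t2 \<le> T" using exec.Seq assms(3) by auto
  then show ?thesis by blast
qed

lemma guard_cost_below:
  "below K b \<sigma> \<Longrightarrow> acost b \<sigma> + len (aval b \<sigma>) \<le> (exp_size b + 1) * len K"
  using below_acost[of K b \<sigma>] len_mono[OF below_aval, of K b \<sigma>] by simp

context
  fixes G k n K \<sigma>
  assumes simple: "simple_graph G"
  defines "n \<equiv> nverts G" and "\<sigma> \<equiv> input_mem G k"
  assumes K: "n * n + n + k + 50 \<le> K"
begin

text \<open>For \<open>i < n\<close> the entry is 0 because there are no loops; for larger
  \<open>i\<close> the address lies behind the matrix. Small graphs thus need no special
  treatment.\<close>

lemma diagonal: "\<sigma> (i * n + (i + 2)) = 0"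
proof (cases "i < n")
  case True
  then have "(i * n + i) div n = i" "(i * n + i) mod n = i" by simp_all
  moreover have "{i, i} \<notin> edges G" using edge_less[OF simple, of i i] by blast
  ultimately show ?thesis by (simp add: \<sigma>_def input_mem_def n_def add.assoc[symmetric])
next
  case False
  then have "n * n \<le> i * n" by simp
  then have "\<not> i * n + i < n * n" by linarith
  then show ?thesis by (simp add: \<sigma>_def input_mem_def n_def)
qed

lemma scratch_zero: "\<sigma> 2 = 0" "\<sigma> (n + 3) = 0" "\<sigma> 0 = k" "\<sigma> (Suc 0) = n"
  using diagonal[of 0] diagonal[of 1] by (simp_all add: \<sigma>_def input_mem_def n_def numeral_2_eq_2 numeral_3_eq_3)

lemma exec_square_loop:
  assumes "i + j = n"
  shows "\<exists>t\<le>(j + 1) * (com_size square_loop * len K).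
    exec square_loop (\<sigma>(2 := i * n, n + 3 := i)) t (\<sigma>(2 := n * n, n + 3 := n))"
  using assms
proof (induction j arbitrary: i)
  case 0
  let ?s = "\<sigma>(2 := i * n, n + 3 := i)" and ?g = "Sub (Cell (Num 1)) (Cell counter)"
  have v: "aval ?g ?s = 0" "below K ?g ?s" using 0 K scratch_zero by (simp_all add: counter_def add.commute)
  have run: "exec square_loop ?s (acost ?g ?s + len (aval ?g ?s)) ?s"
    unfolding square_loop_def by (rule exec.WhileFalse[OF v(1)])
  have "(exp_size ?g + 1) * len K \<le> (0 + 1) * (com_size square_loop * len K)"
    unfolding square_loop_def com_size.simps by (simp add: algebra_simps)
  then have "acost ?g ?s + len (aval ?g ?s) \<le> (0 + 1) * (com_size square_loop * len K)"
    using guard_cost_below[OF v(2)] by (rule le_trans[rotated])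
  moreover have "i = n" using 0 by simp
  ultimately show ?case using run by blast
next
  case (Suc j)
  let ?s = "\<sigma>(2 := i * n, n + 3 := i)" and ?g = "Sub (Cell (Num 1)) (Cell counter)"
  let ?s1 = "\<sigma>(2 := Suc i * n, n + 3 := i)" and ?s2 = "\<sigma>(2 := Suc i * n, n + 3 := Suc i)"
  let ?c1 = "Store (Num 2) (Add (Cell (Num 2)) (Cell (Num 1)))" and ?c2 = "Store counter (Add (Cell counter) (Num 1))"
  have v: "aval ?g ?s \<noteq> 0" "below K ?g ?s" using Suc.prems K scratch_zero by (simp_all add: counter_def add.commute)
  have "Suc i * n \<le> n * n" using Suc.prems by (intro mult_le_mono1) simp
  then have ub: "i * n + n \<le> K" "i * n \<le> K" using K by simp_all
  have "\<exists>t\<le>com_size ?c1 * len K. exec ?c1 ?s t ?s1"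
    by (rule exec_Store_below) (use K scratch_zero ub in \<open>auto simp: fun_eq_iff\<close>)
  moreover have "\<exists>t\<le>com_size ?c2 * len K. exec ?c2 ?s1 t ?s2"
    by (rule exec_Store_below) (use Suc.prems K scratch_zero in \<open>auto simp: counter_def fun_eq_iff add.commute\<close>)
  ultimately obtain t1 where t1: "t1 \<le> com_size ?c1 * len K + com_size ?c2 * len K" "exec (Seq ?c1 ?c2) ?s t1 ?s2"
    using exec_Seq_below[OF _ _ order_refl] by blast
  obtain t2 where t2: "t2 \<le> (j + 1) * (com_size square_loop * len K)"
    "exec square_loop ?s2 t2 (\<sigma>(2 := n * n, n + 3 := n))"
  proof -
    have "Suc i + j = n" using Suc.prems by simp
    from Suc.IH[OF this] show ?thesis using that by blast
  qed
  have "exec square_loop ?s (acost ?g ?s + len (aval ?g ?s) + t1 + t2) (\<sigma>(2 := n * n, n + 3 := n))"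
    using exec.WhileTrue[OF v(1) t1(2)] t2(2) unfolding square_loop_def by blast
  moreover have "com_size square_loop * len K = (exp_size ?g + 1) * len K + (com_size ?c1 * len K + com_size ?c2 * len K)"
    unfolding square_loop_def com_size.simps by (simp add: algebra_simps)
  then have "acost ?g ?s + len (aval ?g ?s) + t1 + t2 \<le> (Suc j + 1) * (com_size square_loop * len K)"
    using guard_cost_below[OF v(2)] t1(1) t2(1) by simp
  ultimately show ?case by blast
qed

lemma exec_input_copy:
  "\<exists>t\<le>com_size input_copy * len K. exec input_copy (\<sigma>(2 := n * n, n + 3 := n)) t
     (\<sigma>(n * n + 3 := n, n * n + 11 := k, 0 := n * n + 3))"
proof -
  let ?s0 = "\<sigma>(2 := n * n, n + 3 := n)"
  let ?s1 = "\<sigma>(2 := n * n)"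
  let ?s2 = "?s1(n * n + 3 := n)"
  let ?s3 = "?s2(n * n + 11 := k)"
  let ?s4 = "?s3(0 := n * n + 3)"
  let ?s5 = "\<sigma>(n * n + 3 := n, n * n + 11 := k, 0 := n * n + 3)"
  have 1: "\<exists>t\<le>com_size (Store counter (Num 0)) * len K. exec (Store counter (Num 0)) ?s0 t ?s1"
    by (rule exec_Store_below) (use K scratch_zero in \<open>auto simp: counter_def fun_eq_iff add.commute\<close>)
  let ?c2 = "Store (Add (Num (3 + 8 * var_index Verts)) (Cell (Num 2))) (Cell (Num 1))"
  have 2: "\<exists>t\<le>com_size ?c2 * len K. exec ?c2 ?s1 t ?s2"
    by (rule exec_Store_below) (use K scratch_zero in \<open>auto simp: fun_eq_iff add.commute\<close>)
  let ?c3 = "Store (Add (Num (3 + 8 * var_index Param)) (Cell (Num 2))) (Cell (Num 0))"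
  have 3: "\<exists>t\<le>com_size ?c3 * len K. exec ?c3 ?s2 t ?s3"
    by (rule exec_Store_below) (use K scratch_zero in \<open>auto simp: fun_eq_iff add.commute\<close>)
  let ?c4 = "Store (Num 0) (Add (Cell (Num 2)) (Num 3))"
  have 4: "\<exists>t\<le>com_size ?c4 * len K. exec ?c4 ?s3 t ?s4"
    by (rule exec_Store_below) (use K scratch_zero in \<open>auto simp: fun_eq_iff add.commute\<close>)
  have 5: "\<exists>t\<le>com_size (Store (Num 2) (Num 0)) * len K. exec (Store (Num 2) (Num 0)) ?s4 t ?s5"
    by (rule exec_Store_below) (use K scratch_zero in \<open>auto simp: fun_eq_iff\<close>)
  show ?thesis unfolding input_copy_def
    by (rule exec_Seq_below[OF 1 exec_Seq_below[OF 2 exec_Seq_below[OF 3 exec_Seq_below[OF 4 5 order_refl] order_refl] order_refl]])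
      (simp only: com_size.simps add_mult_distrib)
qed

lemma represents_start:
  assumes "n \<le> m" "k \<le> m" "1 \<le> m"
  shows "represents (n * n + 3) m (n * n) (start_state G k) (\<sigma>(n * n + 3 := n, n * n + 11 := k, 0 := n * n + 3))"
  unfolding represents_def
proof (intro conjI allI impI)
  let ?\<sigma> = "\<sigma>(n * n + 3 := n, n * n + 11 := k, 0 := n * n + 3)"
  have far: "\<sigma> i = 0" if "i \<ge> n * n + 2" for i using that by (simp add: \<sigma>_def input_mem_def n_def)
  show "?\<sigma> (address (n * n + 3) (X x)) = start_state G k (X x)" for x
    using far by (cases x) (simp_all add: start_state_def n_def)
  show "start_state G k (X x) \<le> m" for x using assms by (simp add: start_state_def n_def)
  show "?\<sigma> (address (n * n + 3) (Y a i)) = start_state G k (Y a i)" for a i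
  proof -
    \<comment> \<open>The offsets 0 and 8 belong to \<open>Verts\<close> and \<open>Param\<close>,
      the only cells filled so far beyond the input.\<close>
    have "arr_index a + 8 * i \<noteq> 0" "arr_index a + 8 * i \<noteq> 8" using arr_index_bounds[of a] by presburger+
    then show ?thesis using far by (auto simp: start_state_def)
  qed
  show "start_state G k (Y a i) \<le> m" for a i by (simp add: start_state_def)
  show "?\<sigma> (address (n * n + 3) (In i)) = start_state G k (In i)" if "i < n * n" for i
    using that by (simp add: start_state_def \<sigma>_def input_mem_def n_def)
  show "start_state G k (In i) \<le> m" for i using assms by (simp add: start_state_def)
qed simp_all

end

definition machine_program :: com where
  "machine_program = Seq square_loop (Seq input_copy (Seq (compile program) (Store (Num 0) (Cell (var_addr Answer)))))"

section \<open>Lengths of numbers and the final bound\<close>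

lemma len_le: "a \<le> 2 ^ e \<Longrightarrow> len a \<le> e + 1"
proof -
  assume "a \<le> 2 ^ e"
  moreover have "(2::nat) ^ e < 2 ^ (e + 1)" by simp
  ultimately have "a < 2 ^ (e + 1)" by (rule le_less_trans)
  then show ?thesis unfolding len_def by (intro max.boundedI floorlog_leI) simp_all
qed

text \<open>Since \<open>6 * k - 4 * j = 2 * j + 6 * (k - j)\<close> for \<open>j = card P\<close>,
  each path of \<open>P\<close> contributes (3/2)^2 (151/81)^3 < 14.6 and each missing path (3/2)^6
  < 11.4, both below 2.482^3. The states without unfinished centres number at most 8^j up to the
  polynomial factor and are absorbed by the factor 2.\<close>

lemma few_valid_states:
  assumes "path_search G P pos k"
  shows "card {f. path_search.sane G P pos f \<and> path_search.valid G P k f} \<le>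
    nat \<lfloor>2 * real ((nverts G + 1)\<^sup>2) * 2.482 ^ (3 * k)\<rfloor>"
proof -
  interpret path_search G P pos k by fact
  let ?j = "card P" and ?c = "2.482 ^ 3 :: real"
  have jk: "?j \<le> k" using small by simp
  have ck: "?c ^ ?j * ?c ^ (k - ?j) = ?c ^ k" using jk by (simp add: power_add[symmetric])
  have "6 * k - 4 * ?j = 2 * ?j + 6 * (k - ?j)" using jk by simp
  then have "(3/2::real) ^ (6 * k - 4 * ?j) * (151/81) ^ (3 * ?j) =
      ((3/2) ^ 2) ^ ?j * ((3/2) ^ 6) ^ (k - ?j) * ((151/81) ^ 3) ^ ?j"
    by (simp only: power_add power_mult)
  also have "\<dots> = ((3/2) ^ 2 * (151/81) ^ 3) ^ ?j * ((3/2) ^ 6) ^ (k - ?j)"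
    by (simp only: power_mult_distrib mult_ac)
  also have "\<dots> \<le> ?c ^ ?j * ?c ^ (k - ?j)"
    by (intro mult_mono power_mono) (simp_all add: power_divide field_simps)
  finally have 1: "(3/2::real) ^ (6 * k - 4 * ?j) * (151/81) ^ (3 * ?j) \<le> 2.482 ^ (3 * k)"
    using ck by (simp add: power_mult)
  have "(2::real) ^ (3 * ?j) \<le> 2 ^ (3 * k)" using jk by (intro power_increasing) auto
  also have "\<dots> \<le> 2.482 ^ (3 * k)" by (intro power_mono) auto
  finally have "real ((n + 1)\<^sup>2) * ((3/2) ^ (6 * k - 4 * ?j) * (151/81) ^ (3 * ?j) + 2 ^ (3 * ?j)) \<le>
      real ((n + 1)\<^sup>2) * (2 * 2.482 ^ (3 * k))"
    using 1 by (intro mult_left_mono) auto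
  with valid_count(2) have "real (card {f. sane f \<and> valid f}) \<le> real ((n + 1)\<^sup>2) * (2 * 2.482 ^ (3 * k))"
    by (rule order_trans)
  then have "real (card {f. sane f \<and> valid f}) \<le> 2 * real ((n + 1)\<^sup>2) * 2.482 ^ (3 * k)"
    by (simp only: mult_ac)
  then show ?thesis by (simp add: le_nat_floor)
qed

lemma machine_program_correct:
  fixes k :: nat
  assumes simple: "simple_graph G"
  defines "n \<equiv> nverts G"
  defines "b \<equiv> n + 5"
  defines "N \<equiv> nat \<lfloor>2 * real ((n + 1)\<^sup>2) * 2.482 ^ (3 * k)\<rfloor>"
  shows "\<exists>t s. exec machine_program (input_mem G k) t s \<and> s 0 = (if has_P2_packing G k then 1 else 0) \<and>
    t \<le> 1000 * b ^ 5 * (N + 1) * (com_size machine_program * (b * b + k + 20))"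
proof -
  \<comment> \<open>Chosen such that \<open>2 ^ e\<close> exceeds all numbers of the program while
    \<open>e\<close>, and with it every length, is polynomial: \<open>b \<le> 2 ^ b\<close> bounds
    the codes and queue addresses by an exponent of about \<open>b * b\<close>, and
    \<open>k + 6\<close> leaves room for \<open>6 * k\<close>.\<close>
  define e where "e = b * b + k + 6"
  define m where "m = (2::nat) ^ e"
  define L where "L = len (max_cell (n * n + 3) m)"
  have b2: "b \<le> 2 ^ b" by (simp add: less_imp_le)
  have "((b ^ (n + 2) + 1) * (n + 2)) \<le> (2 * b ^ (n + 2)) * b" by (intro mult_le_mono) (simp_all add: b_def)
  also have "\<dots> = 2 * b ^ (n + 3)" by (simp add: numeral_3_eq_3)
  also have "\<dots> \<le> 2 * (2 ^ b) ^ (n + 3)" using b2 by (intro mult_le_mono2 power_mono) auto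
  also have "\<dots> = 2 ^ (1 + b * (n + 3))" by (simp add: power_mult)
  also have "\<dots> \<le> m" unfolding m_def e_def by (intro power_increasing) (simp_all add: b_def algebra_simps)
  finally have m_large: "(b ^ (n + 2) + 1) * (n + 2) \<le> m" .
  have "6 * k \<le> 8 * 2 ^ k" using less_exp[of k] by linarith
  also have "\<dots> = (2::nat) ^ (3 + k)" by (simp add: power_add)
  also have "\<dots> \<le> m" unfolding m_def e_def by (intro power_increasing) simp_all
  finally have m_param: "6 * k \<le> m" .
  have "b * b + k + 6 < m" unfolding m_def e_def by (rule less_exp)
  moreover have bb: "n * n + n + 3 \<le> b * b" "n \<le> b * b" by (simp_all add: b_def algebra_simps)
  ultimately have small: "n * n + n + 3 + k \<le> m" "n \<le> m" "k \<le> m" "1 \<le> m" by linarith+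
  have "max_cell (n * n + 3) m \<le> 2 ^ 8 * m" unfolding max_cell_def using small by simp
  also have "\<dots> = 2 ^ (e + 8)" by (simp add: m_def power_add)
  finally have "L \<le> e + 8 + 1" unfolding L_def by (rule len_le)
  then have L: "L \<le> b * b + k + 20" by (simp add: e_def)
  interpret graph_input G k m N
  proof
    show "card {f. path_search.sane G P pos f \<and> path_search.valid G P k f} \<le> N" if "path_search G P pos k" for P pos
      using few_valid_states[OF that] by (simp add: N_def n_def)
  qed (use simple m_large m_param in \<open>simp_all add: b_def n_def\<close>)
  obtain t s' where hr: "hrun m (n * n) program (start_state G k) t s'" "t \<le> 1000 * b ^ 5 * (N + 1)"
    and ans: "s' (X Answer) = (if has_P2_packing G k then 1 else 0)"
    using program_correct unfolding ht_def n_def[symmetric] b_def[symmetric] by blast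
  let ?K = "max_cell (n * n + 3) m"
  have K: "n * n + n + k + 50 \<le> ?K" using small by (simp add: max_cell_def)
  note K' = K[unfolded n_def]
  obtain t1 where t1: "t1 \<le> (n + 1) * (com_size square_loop * L)"
    "exec square_loop (input_mem G k) t1 ((input_mem G k)(2 := n * n, n + 3 := n))"
  proof -
    \<comment> \<open>Both scratch cells already contain 0, so the input memory is the state of the
      loop before its first round.\<close>
    have "(input_mem G k)(2 := 0 * nverts G, nverts G + 3 := 0) = input_mem G k"
      using scratch_zero[OF simple K'] by (auto simp: fun_eq_iff)
    then show ?thesis using exec_square_loop[OF simple K', of 0 n] that by (auto simp: n_def L_def)
  qed
  obtain t2 where t2: "t2 \<le> com_size input_copy * L"
    "exec input_copy ((input_mem G k)(2 := n * n, n + 3 := n)) t2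
      ((input_mem G k)(n * n + 3 := n, n * n + 11 := k, 0 := n * n + 3))"
    using exec_input_copy[OF simple K'] unfolding n_def[symmetric] L_def[symmetric] by blast
  obtain t3 \<sigma>3 where t3: "exec (compile program) ((input_mem G k)(n * n + 3 := n, n * n + 11 := k, 0 := n * n + 3)) t3 \<sigma>3"
    "represents (n * n + 3) m (n * n) s' \<sigma>3" "t3 \<le> t * (com_size (compile program) * L)"
    using compile_correct[OF hr(1) represents_start[OF simple K', of m, folded n_def]] small
    unfolding L_def by blast
  have v: "aval (Cell (var_addr Answer)) \<sigma>3 = s' (X Answer)" "below ?K (Cell (var_addr Answer)) \<sigma>3"
    using compile_exp_correct[OF t3(2), of "Var Answer"] by simp_all
  have "\<exists>t\<le>com_size (Store (Num 0) (Cell (var_addr Answer))) * len ?K.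
      exec (Store (Num 0) (Cell (var_addr Answer))) \<sigma>3 t (\<sigma>3(0 := s' (X Answer)))"
    using v by (intro exec_Store_below) simp_all
  then obtain t4 where t4: "t4 \<le> com_size (Store (Num 0) (Cell (var_addr Answer))) * L"
    "exec (Store (Num 0) (Cell (var_addr Answer))) \<sigma>3 t4 (\<sigma>3(0 := s' (X Answer)))"
    unfolding L_def by blast
  have run: "exec machine_program (input_mem G k) (t1 + (t2 + (t3 + t4))) (\<sigma>3(0 := s' (X Answer)))"
    unfolding machine_program_def by (rule exec.Seq[OF t1(2) exec.Seq[OF t2(2) exec.Seq[OF t3(1) t4(2)]]])
  let ?T = "1000 * b ^ 5 * (N + 1)"
  have "b ^ 1 \<le> b ^ 5" by (rule power_increasing) (simp_all add: b_def)
  then have "b \<le> 1000 * b ^ 5" by simp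
  then have "b * 1 \<le> ?T" by (intro mult_le_mono) simp_all
  then have T: "n + 1 \<le> ?T" "1 \<le> ?T" by (simp_all add: b_def)
  have "t1 + (t2 + (t3 + t4)) \<le> ?T * (com_size square_loop * L) + (?T * (com_size input_copy * L) +
      (?T * (com_size (compile program) * L) + ?T * (com_size (Store (Num 0) (Cell (var_addr Answer))) * L)))"
  proof (intro add_mono)
    show "t1 \<le> ?T * (com_size square_loop * L)" using t1(1) T(1) by (meson le_trans mult_le_mono1)
    show "t2 \<le> ?T * (com_size input_copy * L)" using t2(1) T(2) by (metis le_trans mult_le_mono1 mult_1)
    show "t3 \<le> ?T * (com_size (compile program) * L)" using t3(3) hr(2) by (meson le_trans mult_le_mono1)
    show "t4 \<le> ?T * (com_size (Store (Num 0) (Cell (var_addr Answer))) * L)"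
      using t4(1) T(2) by (metis le_trans mult_le_mono1 mult_1)
  qed
  also have "\<dots> = ?T * (com_size machine_program * L)"
    unfolding machine_program_def com_size.simps(3) by (simp only: add_mult_distrib add_mult_distrib2)
  also have "\<dots> \<le> ?T * (com_size machine_program * (b * b + k + 20))"
    using L by (intro mult_le_mono2)
  finally show ?thesis using run ans
    by (intro exI[of _ "t1 + (t2 + (t3 + t4))"] exI[of _ "\<sigma>3(0 := s' (X Answer))"] conjI) (simp_all only: fun_upd_same)
qed

theorem theorem6:
  "solvable_in_Ostar has_P2_packing (\<lambda>k. 2.482 ^ (3 * k))"
  unfolding solvable_in_Ostar_def
\<comment> \<open>With z the instance size plus 1, \<open>b \<le> 5 * z\<close> gives 5^5 and z^5,
  the number of states gives 3 z^2, and the lengths give 46 z^2, where 46 = 25 + 1 + 20; this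
  explains the exponent 9 = 5 + 2 + 2.\<close>
proof (rule exI[of _ machine_program], rule exI[of _ "real (1000 * 5 ^ 5 * 46 * 3 * com_size machine_program)"], rule exI[of _ 9], intro allI impI)
  define c where "c = com_size machine_program"
  fix G k assume simple: "simple_graph G"
  define n where "n = nverts G"
  define b where "b = n + 5"
  define F :: real where "F = 2.482 ^ (3 * k)"
  define N where "N = nat \<lfloor>2 * real ((n + 1)\<^sup>2) * F\<rfloor>"
  define z where "z = graph_size G + k + 1"
  obtain t s where t: "exec machine_program (input_mem G k) t s" "s 0 = (if has_P2_packing G k then 1 else 0)"
    "t \<le> 1000 * b ^ 5 * (N + 1) * (c * (b * b + k + 20))"
    using machine_program_correct[OF simple, of k] unfolding c_def N_def F_def b_def n_def by blast
  have F1: "1 \<le> F" unfolding F_def by (rule one_le_power) simp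
  have z: "1 \<le> z" "n + 1 \<le> z" "k \<le> z" by (simp_all add: z_def n_def graph_size_def)
  have b: "b \<le> 5 * z" using z(2) unfolding b_def by linarith
  have zz: "z \<le> z ^ 2" "1 \<le> z ^ 2" using z(1) by (simp_all add: power2_eq_square)
  have "real N \<le> 2 * real ((n + 1)\<^sup>2) * F" unfolding N_def using F1 by (intro of_nat_floor) simp
  also have "\<dots> \<le> 2 * real (z ^ 2) * F"
    using z(2) F1 by (intro mult_right_mono mult_left_mono) (auto intro: power_mono)
  finally have "real N \<le> 2 * real (z ^ 2) * F" .
  moreover have "real 1 \<le> real (z ^ 2)" using zz(2) by (rule of_nat_mono)
  then have "1 * 1 \<le> real (z ^ 2) * F" using F1 by (intro mult_mono) simp_all
  ultimately have N1: "real N + 1 \<le> 3 * real (z ^ 2) * F" by linarith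
  have "b * b \<le> (5 * z) * (5 * z)" by (rule mult_le_mono[OF b b])
  moreover have "(5 * z) * (5 * z) = 25 * z ^ 2" by (simp add: power2_eq_square)
  ultimately have "b * b + k + 20 \<le> 46 * z ^ 2" using zz z(3) by linarith
  then have "1000 * b ^ 5 * (c * (b * b + k + 20)) \<le> 1000 * (5 * z) ^ 5 * (c * (46 * z ^ 2))"
    using b by (intro mult_le_mono power_mono) auto
  then have *: "real (1000 * b ^ 5 * (c * (b * b + k + 20))) \<le> real (1000 * (5 * z) ^ 5 * (c * (46 * z ^ 2)))"
    by (rule of_nat_mono)
  have "real t \<le> real (1000 * b ^ 5 * (N + 1) * (c * (b * b + k + 20)))" using t(3) by (rule of_nat_mono)
  also have "1000 * b ^ 5 * (N + 1) * (c * (b * b + k + 20)) = 1000 * b ^ 5 * (c * (b * b + k + 20)) * (N + 1)"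
    by (simp only: mult_ac)
  also have "real \<dots> = real (1000 * b ^ 5 * (c * (b * b + k + 20))) * (real N + 1)"
    by (simp only: of_nat_mult of_nat_add of_nat_1)
  also have "\<dots> \<le> real (1000 * (5 * z) ^ 5 * (c * (46 * z ^ 2))) * (3 * real (z ^ 2) * F)"
    using * N1 by (intro mult_mono) auto
  also have "\<dots> = real (1000 * 5 ^ 5 * 46 * 3 * c) * F * real z ^ 9"
  proof -
    have "real z ^ 9 = real z ^ 5 * (real z ^ 2 * real z ^ 2)" by (simp flip: power_add)
    then show ?thesis by (simp add: power_mult_distrib)
  qed
  finally have "real t \<le> real (1000 * 5 ^ 5 * 46 * 3 * c) * F * real z ^ 9" .
  with t(1,2) show "\<exists>t s. exec machine_program (input_mem G k) t s \<and> s 0 = (if has_P2_packing G k then 1 else 0) \<and>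
      real t \<le> real (1000 * 5 ^ 5 * 46 * 3 * com_size machine_program) * 2.482 ^ (3 * k) *
        real (graph_size G + k + 1) ^ 9"
    unfolding F_def c_def z_def by blast
qed

end
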